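(* Let $g\in H^2(\partial\mathbb B)$. Then the following are equivalent: (i) $g$ is cyclic, i.e. $E_g=H^2(\partial\mathbb B)$; (ii) for any $f\in H^2(\partial\mathbb B)$ such that $f*g^{-*}\in L^2_s(\partial\mathbb B)$, we have that $f*g^{-*}\in H^2(\partial\mathbb B)$; (iii) $g$ is outer, i.e. if $f\in H^2(\partial\mathbb B)$ is such that $|f|=|g|$ $\Sigma$-almost everywhere on $\partial\mathbb B$, then $|f(q)|\le|g(q)|$ for any $q\in\mathbb B$.
   Context: $\mathbb H$ is the skew field of quaternions, $\mathbb B=\{q\in\mathbb H:|q|<1\}$, $\mathbb S=\{q\in\mathbb H: q^2=-1\}$, and $\partial\mathbb B=\{e^{tI}: t\in\mathbb R, I\in\mathbb S\}$, where $e^{tI}=\cos t+I\sin t$. It carries the measure $d\Sigma(e^{tI})=d\sigma(I)\,dt$, with $dt$ Lebesgue measure and $\sigma$ the area measure on $\mathbb S$, normalized so that $\sigma(\mathbb S)=\Sigma(\partial\mathbb B)=1$. A function $f:\partial\mathbb B\to\mathbb H$ is a slice function if for all $J\ne K$ in $\mathbb S$ and all $x+yI\in\partial\mathbb B$ ($x,y\in\mathbb R$, $I\in\mathbb S$), $f(x+yI)=\big((J-K)^{-1}J+I(J-K)^{-1}\big)f(x+yJ)-\big((J-K)^{-1}K+I(J-K)^{-1}\big)f(x+yK)$. $L^2_s(\partial\mathbb B)$ is the space of slice functions $f$ with $\int_{\partial\mathbb B}|f|^2\,d\Sigma<\infty$, functions equal $\Sigma$-a.e. being identified. It consists exactly of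 the functions $f(q)=\sum_{n\in\mathbb Z}q^na_n$ ($\Sigma$-a.e.) with $\{a_n\}\in\ell^2(\mathbb Z,\mathbb H)$, and it is a quaternionic right Hilbert space with inner product $\langle\sum q^na_n,\sum q^nb_n\rangle=\sum_n\overline{b_n}a_n$. $H^2(\partial\mathbb B)$ is the closed subspace of those $f$ with $a_n=0$ for all $n<0$; such $f$ is the boundary value of the function $\sum_{n\ge0}q^na_n$ on $\mathbb B$ (a slice regular function, i.e. holomorphic on each slice $\mathbb B\cap(\mathbb R+\mathbb RI)$, $I\in\mathbb S$), also denoted $f$, so that $f(q)$ makes sense for $|q|<1$. For slice functions $f(q)=\sum_n q^na_n$ and $g(q)=\sum_n q^nb_n$, the $*$-product is $f*g(q)=\sum_{n}q^n\sum_{k}a_kb_{n-k}$; pointwise, $f*g(q)=0$ if $f(q)=0$ and $f*g(q)=f(q)\,g(f(q)^{-1}qf(q))$ if $f(q)\ne0$. The conjugate of $g(q)=\sum q^nb_n$ is $g^c(q)=\sum q^n\overline{b_n}$, its symmetrization is $g^s=g*g^c=g^c*g$, and its $*$-reciprocal is $g^{-*}(q)=(g^s(q))^{-1}g^c(q)$, defined on the set where $g^s(q)\ne0$; there it satisfies $g*g^{-*}=g^{-*}*g=1$. For $g\in H^2(\partial\mathbb B)$, $E_g$ denotes the closure in $H^2(\partial\mathbb B)$ of the right $\mathbb H$-linear span of $\{q^n*g: n\ge0\}$, i.e. of the set of functions $g*p$ with $p(q)=\sum_{n=0}^Mq^n\alpha_n$ a quaternionic polynomial, $\alpha_n\in\mathbb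 H$.
   Formalization: The formal theorem assumes that g is not Σ-a.e. zero; for g = 0 the equivalence fails, since (iii) holds (|f| = 0 a.e. forces f = 0), (i) fails because E_0 = {0}, and g^{-*} in (ii) has empty domain. *)

theory Defs
  imports "HOL-Probability.Probability"
begin

section \<open>Quaternions\<close>

datatype quat = Quat (qRe: real) (qI: real) (qJ: real) (qK: real)

lemma quat_eq_iff: "p = q \<longleftrightarrow> qRe p = qRe q \<and> qI p = qI q \<and> qJ p = qJ q \<and> qK p = qK q"
  by (cases p; cases q) simp

lemma quat_eqI: "qRe p = qRe q \<Longrightarrow> qI p = qI q \<Longrightarrow> qJ p = qJ q \<Longrightarrow> qK p = qK q \<Longrightarrow> p = q"
  by (simp add: quat_eq_iff)

definition qcnj :: "quat \<Rightarrow> quat" where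
  "qcnj q = Quat (qRe q) (- qI q) (- qJ q) (- qK q)"

lemma qcnj_sel [simp]:
  "qRe (qcnj q) = qRe q" "qI (qcnj q) = - qI q" "qJ (qcnj q) = - qJ q" "qK (qcnj q) = - qK q"
  by (simp_all add: qcnj_def)

instantiation quat :: ab_group_add
begin

definition zero_quat_def: "0 = Quat 0 0 0 0"
definition plus_quat_def:
  "p + q = Quat (qRe p + qRe q) (qI p + qI q) (qJ p + qJ q) (qK p + qK q)"
definition minus_quat_def:
  "p - q = Quat (qRe p - qRe q) (qI p - qI q) (qJ p - qJ q) (qK p - qK q)"
definition uminus_quat_def: "- q = Quat (- qRe q) (- qI q) (- qJ q) (- qK q)"

instance
  by standard
    (simp_all add: zero_quat_def plus_quat_def minus_quat_def uminus_quat_def quat_eq_iff)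

end

lemma quat_add_sel [simp]:
  "qRe 0 = 0" "qI 0 = 0" "qJ 0 = 0" "qK 0 = 0"
  "qRe (p + q) = qRe p + qRe q" "qI (p + q) = qI p + qI q"
  "qJ (p + q) = qJ p + qJ q" "qK (p + q) = qK p + qK q"
  "qRe (p - q) = qRe p - qRe q" "qI (p - q) = qI p - qI q"
  "qJ (p - q) = qJ p - qJ q" "qK (p - q) = qK p - qK q"
  "qRe (- q) = - qRe q" "qI (- q) = - qI q" "qJ (- q) = - qJ q" "qK (- q) = - qK q"
  by (simp_all add: zero_quat_def plus_quat_def minus_quat_def uminus_quat_def)

instantiation quat :: ring_1
begin

definition one_quat_def: "1 = Quat 1 0 0 0"
definition times_quat_def:
  "p * q = Quat
     (qRe p * qRe q - qI p * qI q - qJ p * qJ q - qK p * qK q)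
     (qRe p * qI q + qI p * qRe q + qJ p * qK q - qK p * qJ q)
     (qRe p * qJ q - qI p * qK q + qJ p * qRe q + qK p * qI q)
     (qRe p * qK q + qI p * qJ q - qJ p * qI q + qK p * qRe q)"

instance
  by standard (simp_all add: one_quat_def times_quat_def quat_eq_iff algebra_simps)

end

lemma quat_mult_sel [simp]:
  "qRe 1 = 1" "qI 1 = 0" "qJ 1 = 0" "qK 1 = 0"
  "qRe (p * q) = qRe p * qRe q - qI p * qI q - qJ p * qJ q - qK p * qK q"
  "qI (p * q) = qRe p * qI q + qI p * qRe q + qJ p * qK q - qK p * qJ q"
  "qJ (p * q) = qRe p * qJ q - qI p * qK q + qJ p * qRe q + qK p * qI q"
  "qK (p * q) = qRe p * qK q + qI p * qJ q - qJ p * qI q + qK p * qRe q"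
  by (simp_all add: one_quat_def times_quat_def)

instantiation quat :: real_algebra_1
begin

definition scaleR_quat_def: "r *\<^sub>R q = Quat (r * qRe q) (r * qI q) (r * qJ q) (r * qK q)"

instance
  by standard (simp_all add: scaleR_quat_def quat_eq_iff algebra_simps)

end

lemma quat_scaleR_sel [simp]:
  "qRe (r *\<^sub>R q) = r * qRe q" "qI (r *\<^sub>R q) = r * qI q"
  "qJ (r *\<^sub>R q) = r * qJ q" "qK (r *\<^sub>R q) = r * qK q"
  by (simp_all add: scaleR_quat_def)

lemma quat_of_real_sel [simp]:
  "qRe (of_real r) = r" "qI (of_real r) = 0" "qJ (of_real r) = 0" "qK (of_real r) = 0"
  by (simp_all add: of_real_def)

instantiation quat :: real_inner
begin

definition inner_quat_def:
  "inner p q = qRe p * qRe q + qI p * qI q + qJ p * qJ q + qK p * qK q"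
definition norm_quat_def: "norm q = sqrt ((qRe q)\<^sup>2 + (qI q)\<^sup>2 + (qJ q)\<^sup>2 + (qK q)\<^sup>2)"
definition sgn_quat_def: "sgn (q::quat) = q /\<^sub>R norm q"
definition dist_quat_def: "dist (p::quat) q = norm (p - q)"
definition uniformity_quat_def [code del]:
  "(uniformity :: (quat \<times> quat) filter) = (INF e\<in>{0 <..}. principal {(x, y). dist x y < e})"
definition open_quat_def [code del]:
  "open (U :: quat set) \<longleftrightarrow> (\<forall>x\<in>U. eventually (\<lambda>(x', y). x' = x \<longrightarrow> y \<in> U) uniformity)"

instance
proof
  fix p q r :: quat and c :: real
  show "dist p q = norm (p - q)" by (rule dist_quat_def)
  show "sgn p = p /\<^sub>R norm p" by (rule sgn_quat_def)
  show "inner p q = inner q p"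
    by (simp add: inner_quat_def mult.commute)
  show "inner (p + q) r = inner p r + inner q r"
    by (simp add: inner_quat_def algebra_simps)
  show "inner (c *\<^sub>R p) q = c * inner p q"
    by (simp add: inner_quat_def algebra_simps)
  show "0 \<le> inner p p"
    by (simp add: inner_quat_def)
  show "inner p p = 0 \<longleftrightarrow> p = 0"
    by (simp add: inner_quat_def quat_eq_iff add_nonneg_eq_0_iff)
  show "norm p = sqrt (inner p p)"
    by (simp add: inner_quat_def norm_quat_def power2_eq_square)
qed (rule uniformity_quat_def open_quat_def)+

end

lemma norm_quat_squared: "(norm q)\<^sup>2 = (qRe q)\<^sup>2 + (qI q)\<^sup>2 + (qJ q)\<^sup>2 + (qK q)\<^sup>2"
  by (simp add: norm_quat_def)

lemma qcnj_mult_self: "q * qcnj q = of_real ((norm q)\<^sup>2)" "qcnj q * q = of_real ((norm q)\<^sup>2)"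
  unfolding norm_quat_squared by (simp_all add: quat_eq_iff power2_eq_square)

instantiation quat :: euclidean_space
begin

definition Basis_quat_def:
  "Basis = {1, Quat 0 1 0 0, Quat 0 0 1 0, Quat 0 0 0 1}"

instance
proof
  show "(Basis :: quat set) \<noteq> {}" "finite (Basis :: quat set)"
    by (simp_all add: Basis_quat_def)
  show "inner u v = (if u = v then 1 else 0)" if "u \<in> Basis" "v \<in> Basis" for u v :: quat
    using that unfolding Basis_quat_def
    by (elim insertE emptyE) (simp_all add: inner_quat_def one_quat_def)
  show "(\<forall>u\<in>Basis. inner q u = 0) \<longleftrightarrow> q = 0" for q :: quat
    unfolding Basis_quat_def by (simp add: inner_quat_def zero_quat_def one_quat_def) (cases q; auto)
qed

end

instantiation quat :: real_normed_div_algebra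
begin

definition inverse_quat_def: "inverse q = qcnj q /\<^sub>R (norm q)\<^sup>2"
definition divide_quat_def: "p div (q::quat) = p * inverse q"

instance
proof
  fix p q :: quat
  show "p \<noteq> 0 \<Longrightarrow> inverse p * p = 1" "p \<noteq> 0 \<Longrightarrow> p * inverse p = 1"
    by (simp_all add: inverse_quat_def qcnj_mult_self of_real_def)
  show "p div q = p * inverse q" by (rule divide_quat_def)
  show "inverse (0::quat) = 0" by (simp add: inverse_quat_def quat_eq_iff)
  have "(norm (p * q))\<^sup>2 = (norm p * norm q)\<^sup>2"
    unfolding power_mult_distrib norm_quat_squared
    by (simp add: power2_eq_square algebra_simps)
  then show "norm (p * q) = norm p * norm q"
    by (rule power2_eq_imp_eq) auto
qed

end


section \<open>The boundary of the quaternionic unit ball and its measure\<close>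

definition imag_units :: "quat set" where
  "imag_units = {q. q\<^sup>2 = - 1}"

text \<open>\<open>qcis t I\<close> is \<open>e\<^sup>t\<^sup>I\<close> for an imaginary unit \<open>I\<close>.\<close>

definition qcis :: "real \<Rightarrow> quat \<Rightarrow> quat" where
  "qcis t I = of_real (cos t) + of_real (sin t) * I"

definition bdry :: "quat set" where
  "bdry = {qcis t I | t I. I \<in> imag_units}"

lemma imag_units_eq: "imag_units = {q. qRe q = 0 \<and> norm q = 1}"
proof (intro set_eqI iffI)
  fix q :: quat
  assume "q \<in> imag_units"
  then have *: "q * q = - 1" by (simp add: imag_units_def power2_eq_square)
  then have r: "qRe q * qRe q - qI q * qI q - qJ q * qJ q - qK q * qK q = - 1"
    and i: "qRe q * qI q = 0" "qRe q * qJ q = 0" "qRe q * qK q = 0"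
    by (simp_all add: quat_eq_iff algebra_simps)
  have "qRe q = 0"
  proof (rule ccontr)
    assume "qRe q \<noteq> 0"
    with i r have "qRe q * qRe q = - 1" by simp
    then show False by (metis not_numeral_le_zero le_minus_one_simps(3) zero_le_square)
  qed
  moreover from this r have "(norm q)\<^sup>2 = 1"
    unfolding norm_quat_squared by (simp add: power2_eq_square)
  ultimately show "q \<in> {q. qRe q = 0 \<and> norm q = 1}"
    by (simp add: power2_eq_1_iff) (smt (verit) norm_ge_zero)
next
  fix q :: quat
  assume "q \<in> {q. qRe q = 0 \<and> norm q = 1}"
  then have "qRe q = 0" "(norm q)\<^sup>2 = 1" by auto
  then show "q \<in> imag_units"
    unfolding norm_quat_squared by (simp add: imag_units_def quat_eq_iff power2_eq_square)
qed

lemma bdry_eq_sphere: "bdry = sphere 0 1"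
proof (intro set_eqI iffI)
  fix q :: quat
  assume "q \<in> bdry"
  then obtain t I where q: "q = qcis t I" and I: "qRe I = 0" "norm I = 1"
    by (auto simp: bdry_def imag_units_eq)
  from I have I2: "(qI I)\<^sup>2 + (qJ I)\<^sup>2 + (qK I)\<^sup>2 = 1"
    using norm_quat_squared[of I] by simp
  have "(norm q)\<^sup>2 = (cos t)\<^sup>2 + (sin t)\<^sup>2 * ((qI I)\<^sup>2 + (qJ I)\<^sup>2 + (qK I)\<^sup>2)"
    using I by (simp add: q qcis_def norm_quat_squared power_mult_distrib algebra_simps)
  also have "\<dots> = 1" by (simp add: I2)
  finally have "norm q = 1"
    by (simp add: power2_eq_1_iff) (smt (verit) norm_ge_zero)
  then show "q \<in> sphere 0 1" by simp
next
  fix q :: quat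
  assume "q \<in> sphere 0 1"
  then have n: "(norm q)\<^sup>2 = 1" by simp
  define v where "v = Quat 0 (qI q) (qJ q) (qK q)"
  have "(qRe q)\<^sup>2 + (norm v)\<^sup>2 = 1"
    using n by (simp add: norm_quat_squared v_def)
  then obtain t where t: "qRe q = cos t" "norm v = sin t"
    using sincos_total_2pi by metis
  show "q \<in> bdry"
  proof (cases "v = 0")
    case True
    have "Quat 0 1 0 0 \<in> imag_units"
      by (simp add: imag_units_eq norm_quat_def)
    moreover have "sin t = 0" using True t(2) by simp
    then have "q = qcis t (Quat 0 1 0 0)"
      using True t(1) by (auto simp: qcis_def quat_eq_iff v_def)
    ultimately show ?thesis by (auto simp: bdry_def)
  next
    case False
    have "v /\<^sub>R norm v \<in> imag_units"
      using False by (auto simp: imag_units_eq v_def)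
    moreover have "q = qcis t (v /\<^sub>R norm v)"
    proof -
      have "qcis t (v /\<^sub>R norm v) = of_real (cos t) + v"
        using False by (simp add: qcis_def t(2)[symmetric] of_real_def)
      then show ?thesis using t(1) by (simp add: quat_eq_iff v_def)
    qed
    ultimately show ?thesis by (auto simp: bdry_def)
  qed
qed

text \<open>Normalized area on the two-sphere of imaginary units, in spherical coordinates: the area
  element is \<open>sin \<theta> d\<theta> d\<phi>\<close> and the total area is \<open>4 * pi\<close>.\<close>

definition spherical :: "real \<times> real \<Rightarrow> quat" where
  "spherical = (\<lambda>(\<theta>, \<phi>). Quat 0 (sin \<theta> * cos \<phi>) (sin \<theta> * sin \<phi>) (cos \<theta>))"

definition area_imag_units :: "quat measure" where
  "area_imag_units =
     distr
       (density lborel (\<lambda>(\<theta>, \<phi>).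
          ennreal (indicator ({0..pi} \<times> {0..2*pi}) (\<theta>, \<phi>) * sin \<theta> / (4 * pi))))
       (restrict_space borel imag_units) spherical"

text \<open>The angle \<open>t\<close> runs over one period; \<open>1 / (2 * pi)\<close> is the normalization of \<open>dt\<close>.  Every
  non-real boundary point \<open>qcis t I = qcis (- t) (- I)\<close> is parametrized twice, which has no effect
  on the normalized measure because the area measure is invariant under \<open>I \<mapsto> - I\<close>.\<close>

definition bdry_measure :: "quat measure" where
  "bdry_measure =
     distr (uniform_measure lborel {0..2*pi} \<Otimes>\<^sub>M area_imag_units)
       (restrict_space borel bdry) (\<lambda>(t, I). qcis t I)"

lemma spherical_measurable: "spherical \<in> lborel \<rightarrow>\<^sub>M restrict_space borel imag_units"
proof (rule measurable_restrict_space2)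
  have "spherical = (\<lambda>x. (sin (fst x) * cos (snd x)) *\<^sub>R Quat 0 1 0 0
      + (sin (fst x) * sin (snd x)) *\<^sub>R Quat 0 0 1 0 + cos (fst x) *\<^sub>R Quat 0 0 0 1)"
    by (auto simp: spherical_def quat_eq_iff)
  moreover have "continuous_on UNIV (\<lambda>x :: real \<times> real. (sin (fst x) * cos (snd x)) *\<^sub>R Quat 0 1 0 0
      + (sin (fst x) * sin (snd x)) *\<^sub>R Quat 0 0 1 0 + cos (fst x) *\<^sub>R Quat 0 0 0 1)"
    by (intro continuous_intros)
  ultimately have "continuous_on UNIV spherical" by (simp only:)
  then show "spherical \<in> lborel \<rightarrow>\<^sub>M borel"
    using borel_measurable_continuous_onI by simp
  have "(norm (spherical x))\<^sup>2 = 1" for x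
  proof -
    have "(norm (spherical x))\<^sup>2 =
        (sin (fst x))\<^sup>2 * ((cos (snd x))\<^sup>2 + (sin (snd x))\<^sup>2) + (cos (fst x))\<^sup>2"
      by (simp add: spherical_def case_prod_beta norm_quat_squared power_mult_distrib
          algebra_simps del: sin_cos_squared_add sin_cos_squared_add2)
    then show ?thesis by simp
  qed
  then have "norm (spherical x) = 1" for x
    by (metis norm_ge_zero power2_eq_imp_eq power_one zero_le_one)
  moreover have "qRe (spherical x) = 0" for x
    by (simp add: spherical_def case_prod_beta)
  ultimately show "spherical \<in> space lborel \<rightarrow> imag_units"
    by (simp add: imag_units_eq)
qed

lemma prob_space_area_imag_units: "prob_space area_imag_units"
proof -
  define w :: "real \<times> real \<Rightarrow> ennreal" where
    "w = (\<lambda>(\<theta>, \<phi>). ennreal (indicator ({0..pi} \<times> {0..2*pi}) (\<theta>, \<phi>) * sin \<theta> / (4 * pi)))"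
  have w: "w (x, y) =
      (ennreal (sin x / (4 * pi)) * indicator {0..pi} x) * indicator {0..2*pi} y" for x y
    by (auto simp: w_def indicator_def)
  have w_meas: "w \<in> borel_measurable (lborel \<Otimes>\<^sub>M lborel)"
    unfolding w_def by measurable
  have "(\<integral>\<^sup>+ z. w z \<partial>lborel) = (\<integral>\<^sup>+ z. w z \<partial>(lborel \<Otimes>\<^sub>M lborel))"
    by (simp add: lborel_prod)
  also have "\<dots> = (\<integral>\<^sup>+ x. \<integral>\<^sup>+ y. w (x, y) \<partial>lborel \<partial>lborel)"
    using lborel.nn_integral_fst[OF w_meas] by simp
  also have "\<dots> = (\<integral>\<^sup>+ x. (ennreal (sin x / (4 * pi)) * indicator {0..pi} x) * ennreal (2 * pi) \<partial>lborel)"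
  proof (rule nn_integral_cong)
    fix x :: real
    let ?c = "ennreal (sin x / (4 * pi)) * indicator {0..pi} x"
    have "(\<integral>\<^sup>+ y. w (x, y) \<partial>lborel) = (\<integral>\<^sup>+ y. ?c * indicator {0..2*pi} y \<partial>lborel)"
      by (simp only: w)
    also have "\<dots> = ?c * emeasure lborel {0..2*pi}"
      by (rule nn_integral_cmult_indicator) simp
    also have "emeasure lborel {0..2*pi} = ennreal (2 * pi)"
      by simp
    finally show "(\<integral>\<^sup>+ y. w (x, y) \<partial>lborel) = ?c * ennreal (2 * pi)" .
  qed
  also have "\<dots> = (\<integral>\<^sup>+ x. ennreal (sin x / (4 * pi)) * indicator {0..pi} x \<partial>lborel) * ennreal (2 * pi)"
    by (rule nn_integral_multc) measurable
  also have "(\<integral>\<^sup>+ x. ennreal (sin x / (4 * pi)) * indicator {0..pi} x \<partial>lborel) =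
      ennreal (- cos pi / (4 * pi) - (- cos 0 / (4 * pi)))"
    by (rule nn_integral_FTC_Icc)
      (auto intro!: derivative_eq_intros divide_nonneg_nonneg sin_ge_zero
        simp flip: has_real_derivative_iff_has_vector_derivative)
  also have "\<dots> * ennreal (2 * pi) = 1"
    by (simp flip: ennreal_mult)
  finally have "(\<integral>\<^sup>+ z. w z \<partial>lborel) = 1" .
  moreover have "w \<in> borel_measurable lborel"
    using w_meas by (simp add: lborel_prod)
  ultimately have "prob_space (density lborel w)"
    by (intro prob_spaceI) (simp add: emeasure_density)
  then show ?thesis
    unfolding area_imag_units_def w_def
    by (rule prob_space.prob_space_distr) (use spherical_measurable in simp)
qed

lemma qcis_measurable:
  "(\<lambda>(t, I). qcis t I) \<in> uniform_measure lborel {0..2*pi} \<Otimes>\<^sub>M area_imag_units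
     \<rightarrow>\<^sub>M restrict_space borel bdry"
proof (rule measurable_restrict_space2)
  have sp: "space area_imag_units = imag_units"
    by (simp add: area_imag_units_def space_restrict_space)
  have "(\<lambda>I. I) \<in> restrict_space borel imag_units \<rightarrow>\<^sub>M (borel :: quat measure)"
    by (rule measurable_restrict_space1) simp
  then have id_meas: "(\<lambda>I. I) \<in> area_imag_units \<rightarrow>\<^sub>M (borel :: quat measure)"
    by (simp add: area_imag_units_def)
  show "(\<lambda>(t, I). qcis t I) \<in> uniform_measure lborel {0..2*pi} \<Otimes>\<^sub>M area_imag_units \<rightarrow>\<^sub>M borel"
  proof -
    have "continuous_on UNIV (\<lambda>(t, I). qcis t I)"
      unfolding qcis_def case_prod_beta of_real_def
      by (intro continuous_intros)
    then have "(\<lambda>(t, I). qcis t I) \<in> borel_measurable (borel \<Otimes>\<^sub>M borel)"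
      unfolding borel_prod by (rule borel_measurable_continuous_onI)
    moreover have "(\<lambda>z. (fst z, snd z)) \<in>
        uniform_measure lborel {0..2*pi} \<Otimes>\<^sub>M area_imag_units \<rightarrow>\<^sub>M borel \<Otimes>\<^sub>M borel"
    proof (rule measurable_Pair)
      show "fst \<in> uniform_measure lborel {0..2*pi} \<Otimes>\<^sub>M area_imag_units \<rightarrow>\<^sub>M borel"
        using measurable_fst[of "uniform_measure lborel {0..2*pi}" area_imag_units] by simp
      show "snd \<in> uniform_measure lborel {0..2*pi} \<Otimes>\<^sub>M area_imag_units \<rightarrow>\<^sub>M borel"
        by (rule measurable_compose[OF measurable_snd id_meas])
    qed
    ultimately have "(\<lambda>z. (\<lambda>(t, I). qcis t I) (fst z, snd z)) \<in>
        uniform_measure lborel {0..2*pi} \<Otimes>\<^sub>M area_imag_units \<rightarrow>\<^sub>M borel"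
      by (rule measurable_compose[rotated])
    then show ?thesis by (simp only: prod.collapse)
  qed
  show "(\<lambda>(t, I). qcis t I) \<in>
      space (uniform_measure lborel {0..2*pi} \<Otimes>\<^sub>M area_imag_units) \<rightarrow> bdry"
    by (auto simp: space_pair_measure sp bdry_def)
qed

lemma prob_space_bdry_measure: "prob_space bdry_measure"
proof -
  have "prob_space (uniform_measure lborel {0..2*pi})"
    by (rule prob_space_uniform_measure) simp_all
  then interpret pair_prob_space "uniform_measure lborel {0..2*pi}" area_imag_units
    using prob_space_area_imag_units
    by (simp add: pair_prob_space_def pair_sigma_finite_def prob_space_imp_sigma_finite)
  show ?thesis
    unfolding bdry_measure_def by (rule prob_space_distr) (rule qcis_measurable)
qed

lemma space_bdry_measure: "space bdry_measure = bdry"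
  by (simp add: bdry_measure_def space_restrict_space)


section \<open>Slice functions and the spaces \<open>L\<^sup>2\<^sub>s\<close> and \<open>H\<^sup>2\<close>\<close>

definition slice_fun :: "(quat \<Rightarrow> quat) \<Rightarrow> bool" where
  "slice_fun f \<longleftrightarrow>
     (\<forall>J\<in>imag_units. \<forall>K\<in>imag_units. \<forall>I\<in>imag_units. \<forall>x y :: real.
        J \<noteq> K \<longrightarrow> of_real x + of_real y * I \<in> bdry \<longrightarrow>
        f (of_real x + of_real y * I) =
          (inverse (J - K) * J + I * inverse (J - K)) * f (of_real x + of_real y * J)
          - (inverse (J - K) * K + I * inverse (J - K)) * f (of_real x + of_real y * K))"

text \<open>Elements of the function spaces are represented by functions that satisfy the slice identity
  at every boundary point; two of them represent the same element if they agree almost everywhere.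
  Values off \<open>bdry\<close> are irrelevant.\<close>

definition L2s :: "(quat \<Rightarrow> quat) set" where
  "L2s = {f. slice_fun f \<and> f \<in> borel_measurable bdry_measure \<and>
             (\<integral>\<^sup>+ q. ennreal ((norm (f q))\<^sup>2) \<partial>bdry_measure) < \<infinity>}"

text \<open>\<open>f(q) = \<Sum>n\<in>\<int>. q\<^sup>n a\<^sub>n\<close> with square-summable coefficients, where the series converges
  unconditionally in the \<open>L\<^sup>2\<close> norm.\<close>

definition has_expansion :: "(quat \<Rightarrow> quat) \<Rightarrow> (int \<Rightarrow> quat) \<Rightarrow> bool" where
  "has_expansion f a \<longleftrightarrow>
     (\<lambda>n. (norm (a n))\<^sup>2) summable_on UNIV \<and>
     ((\<lambda>N. \<integral>\<^sup>+ q. ennreal ((norm (f q - (\<Sum>n\<in>N. q powi n * a n)))\<^sup>2) \<partial>bdry_measure) \<longlongrightarrow> 0)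
       (finite_subsets_at_top UNIV)"

definition coef :: "(quat \<Rightarrow> quat) \<Rightarrow> int \<Rightarrow> quat" where
  "coef f = (THE a. has_expansion f a)"

definition slice_inner :: "(quat \<Rightarrow> quat) \<Rightarrow> (quat \<Rightarrow> quat) \<Rightarrow> quat" where
  "slice_inner f h = (\<Sum>\<^sub>\<infinity>n\<in>UNIV. qcnj (coef h n) * coef f n)"

definition slice_norm :: "(quat \<Rightarrow> quat) \<Rightarrow> real" where
  "slice_norm f = sqrt (qRe (slice_inner f f))"

definition H2 :: "(quat \<Rightarrow> quat) set" where
  "H2 = {f \<in> L2s. \<forall>n<0. coef f n = 0}"

definition ball_ext :: "(quat \<Rightarrow> quat) \<Rightarrow> quat \<Rightarrow> quat" where
  "ball_ext f q = (\<Sum>n. q ^ n * coef f (int n))"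

text \<open>Membership in a function space for a function that is only determined almost everywhere.\<close>

definition ae_in :: "(quat \<Rightarrow> quat) \<Rightarrow> (quat \<Rightarrow> quat) set \<Rightarrow> bool" where
  "ae_in h X \<longleftrightarrow> (\<exists>f\<in>X. AE q in bdry_measure. h q = f q)"


section \<open>The star product\<close>

definition star :: "(quat \<Rightarrow> quat) \<Rightarrow> (quat \<Rightarrow> quat) \<Rightarrow> quat \<Rightarrow> quat" (infixl \<open>\<circledast>\<close> 70) where
  "(f \<circledast> g) q = (if f q = 0 then 0 else f q * g (inverse (f q) * q * f q))"

text \<open>The element \<open>q \<mapsto> \<Sum>n. q\<^sup>n cnj(b\<^sub>n)\<close>, where \<open>b\<close> are the coefficients of \<open>g\<close>.  The chosen
  representative is a slice function, so it is determined on almost every sphere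
  \<open>x + y * imag_units\<close> at every point; hence \<open>g \<circledast> star_conj g\<close> is determined almost everywhere.\<close>

definition star_conj :: "(quat \<Rightarrow> quat) \<Rightarrow> quat \<Rightarrow> quat" where
  "star_conj g = (SOME h. h \<in> L2s \<and> has_expansion h (\<lambda>n. qcnj (coef g n)))"

definition symmetrization :: "(quat \<Rightarrow> quat) \<Rightarrow> quat \<Rightarrow> quat" where
  "symmetrization g = g \<circledast> star_conj g"

text \<open>Where the symmetrization vanishes (a null set if \<open>g\<close> is a non-zero element of \<open>H2\<close>) the
  value is \<open>0\<close>, because \<open>inverse 0 = 0\<close>.\<close>

definition star_recip :: "(quat \<Rightarrow> quat) \<Rightarrow> quat \<Rightarrow> quat" where
  "star_recip g q = inverse (symmetrization g q) * star_conj g q"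


section \<open>Cyclic and outer functions\<close>

definition shift_span :: "(quat \<Rightarrow> quat) \<Rightarrow> (quat \<Rightarrow> quat) set" where
  "shift_span g = {(\<lambda>q. \<Sum>n\<le>M. ((\<lambda>q. q ^ n) \<circledast> g) q * \<alpha> n) | (M :: nat) \<alpha>. True}"

lemma shift_span_eq_star_polynomials:
  "shift_span g = {g \<circledast> (\<lambda>q. \<Sum>n\<le>M. q ^ n * \<alpha> n) | (M :: nat) \<alpha>. True}"
proof -
  have conj: "(inverse a * q * a) ^ n = inverse a * q ^ n * a" if "a \<noteq> 0" for a q :: quat and n
  proof (induction n)
    case (Suc n)
    have "a * inverse a = 1" using that by simp
    have "(inverse a * q * a) ^ Suc n = inverse a * q * (a * inverse a) * q ^ n * a"
      by (simp only: power_Suc Suc.IH) (simp only: mult.assoc)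
    also have "\<dots> = inverse a * q ^ Suc n * a"
      unfolding \<open>a * inverse a = 1\<close> by (simp only: mult_1_right power_Suc mult.assoc)
    finally show ?case .
  qed (use that in simp)
  have monom: "((\<lambda>q. q ^ n) \<circledast> g) q = q ^ n * g q" for q n
  proof (cases "q ^ n = 0")
    case False
    have "inverse (q ^ n) * q * q ^ n = inverse (q ^ n) * q ^ n * q"
      by (simp only: mult.assoc power_commutes)
    also have "\<dots> = q" using False by simp
    finally show ?thesis using False by (simp only: star_def if_False)
  qed (simp add: star_def)
  have "(g \<circledast> (\<lambda>q. \<Sum>n\<le>M. q ^ n * \<alpha> n)) q = (\<Sum>n\<le>M. ((\<lambda>q. q ^ n) \<circledast> g) q * \<alpha> n)" for M \<alpha> q
  proof (cases "g q = 0")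
    case False
    then have inv: "g q * inverse (g q) = 1" by simp
    have "g q * (inverse (g q) * q ^ n * g q * \<alpha> n) = q ^ n * g q * \<alpha> n" for n
    proof -
      have "g q * (inverse (g q) * q ^ n * g q * \<alpha> n)
          = (g q * inverse (g q)) * (q ^ n * g q * \<alpha> n)"
        by (simp only: mult.assoc)
      then show ?thesis by (simp only: inv mult_1_left)
    qed
    moreover have "(g \<circledast> (\<lambda>q. \<Sum>n\<le>M. q ^ n * \<alpha> n)) q
        = (\<Sum>n\<le>M. g q * (inverse (g q) * q ^ n * g q * \<alpha> n))"
      using False by (simp only: star_def conj[OF False] sum_distrib_left if_False)
    ultimately show ?thesis by (simp only: monom)
  next
    case True
    then show ?thesis unfolding monom by (simp add: star_def)
  qed
  then have "g \<circledast> (\<lambda>q. \<Sum>n\<le>M. q ^ n * \<alpha> n) = (\<lambda>q. \<Sum>n\<le>M. ((\<lambda>q. q ^ n) \<circledast> g) q * \<alpha> n)" for M \<alpha>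
    by blast
  then show ?thesis by (simp add: shift_span_def)
qed

definition E_span :: "(quat \<Rightarrow> quat) \<Rightarrow> (quat \<Rightarrow> quat) set" where
  "E_span g = {f \<in> H2. \<forall>\<epsilon>>0. \<exists>h\<in>shift_span g. slice_norm (\<lambda>q. f q - h q) < \<epsilon>}"

definition cyclic :: "(quat \<Rightarrow> quat) \<Rightarrow> bool" where
  "cyclic g \<longleftrightarrow> E_span g = H2"

definition outer :: "(quat \<Rightarrow> quat) \<Rightarrow> bool" where
  "outer g \<longleftrightarrow>
     (\<forall>f\<in>H2. (AE q in bdry_measure. norm (f q) = norm (g q)) \<longrightarrow>
        (\<forall>q\<in>ball 0 1. norm (ball_ext f q) \<le> norm (ball_ext g q)))"

end

theory Submission
  imports Defs
begin

text \<open>On the sphere of the points \<open>qcis t I\<close>, a slice function has the form \<open>b t + I * c t\<close>, so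
  it is determined by a pair of functions of the angle, with \<open>b\<close> even and \<open>c\<close> odd. In terms of
  such pairs the star product is the pointwise product of the algebra \<open>H \<otimes> C\<close>, the coefficients
  are ordinary Fourier coefficients, and the determinant of a pair corresponds to the
  symmetrization.

  Let \<open>g\<close> be a nonzero element of \<open>H2\<close>. The component \<open>\<phi>\<close> of \<open>g\<close> orthogonal to \<open>q * E_span g\<close>
  is, after normalization, unitary on the boundary, and \<open>g = \<phi> * h\<close> with \<open>h\<close> in \<open>H2\<close>. The
  quotient of \<open>h\<close> by \<open>g\<close> is the adjoint of \<open>\<phi>\<close>, so condition (ii) forces \<open>\<phi>\<close> to be constant and
  \<open>g\<close> to be cyclic. Conversely, if \<open>g * p\<^sub>n\<close> tends to \<open>1\<close>, then the negative coefficients of a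
  quotient \<open>r\<close> are the limits of those of \<open>r * g * p\<^sub>n\<close>, which vanish if \<open>r * g\<close> is in \<open>H2\<close>.

  Cyclicity passes to the conjugate of \<open>g\<close>. Two functions have the same modulus almost
  everywhere iff they differ by a unitary factor on the right. If \<open>g\<close> is cyclic, such a factor
  belongs to \<open>H2\<close> and is bounded by \<open>1\<close> in the ball, so \<open>g\<close> is outer. If \<open>g\<close> is outer, factor
  its conjugate as above and conjugate back, so that \<open>g = k * \<phi>\<close> with \<open>\<phi>\<close> unitary on the
  boundary: comparing the lowest coefficients of \<open>g\<close> and \<open>k\<close> gives \<open>1 \<le> norm (\<phi> 0)\<close>, so \<open>\<phi>\<close> is
  constant.\<close>

section \<open>Square-summable sequences and orthogonal projection\<close>

text \<open>The main obstacle is that left and right factors behave differently.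
  \<open>E_span g\<close> is stable under right multiplication by polynomials, so its inner factor
  splits off \<open>g\<close> on the left, and the quotients in (ii) also stand to the left of
  \<open>g\<close>. Equality of moduli, however, produces a factor on the right. Conjugation
  reverses products and links the two sides; that it preserves cyclicity rests on the determinant
  being central.

  A second obstacle is that products of square-integrable pairs are merely integrable, so the star
  product is not an operation on the Hilbert space. Only its single coefficients
  \<open>conv_at a b n\<close> are used: they are bounded and linear in \<open>b\<close>, so
  identities are checked on monomials and extended by density. Fourier uniqueness is therefore
  proved for integrable functions.

  Finally, evaluation in the ball is multiplicative only up to a conjugation of the point: f = g * w
  has the value g(q) w(p) at q, where p is q conjugated by g(q). A bound for w is thus needed on the
  whole ball.\<close>

lemma qcnj_simps [simp]:
  "qcnj (x + y) = qcnj x + qcnj y" "qcnj (x - y) = qcnj x - qcnj y" "qcnj (- x) = - qcnj x"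
  "qcnj 0 = 0" "qcnj 1 = 1" "qcnj (x * y) = qcnj y * qcnj x" "qcnj (qcnj x) = x"
  "qcnj (r *\<^sub>R x) = r *\<^sub>R qcnj x" "norm (qcnj x) = norm x"
  by (auto simp: quat_eq_iff norm_quat_def algebra_simps)

lemma bounded_linear_qcnj: "bounded_linear qcnj"
  by (rule bounded_linear_intro[of _ 1]) auto

lemma inner_quat_mult:
  "inner (x * y) z = inner y (qcnj x * z)" "inner (x * y) z = inner x (z * qcnj y)"
  by (auto simp: inner_quat_def algebra_simps)

text \<open>A type rather than a set of sequences, so that it can be an instance of
  \<open>complete_space\<close> and the projection theorem applies. All integer indices occur
  because adjoints and quotients leave the Hardy space.\<close>

typedef l2 = "{a :: int \<Rightarrow> quat. (\<lambda>n. (norm (a n))\<^sup>2) summable_on UNIV}"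
  morphisms cf Abs_l2
  by (rule exI[of _ "\<lambda>_. 0"]) auto

setup_lifting type_definition_l2

lemma summable_cf: "(\<lambda>n. (norm (cf a n))\<^sup>2) summable_on UNIV"
  using cf by blast

lemma l2_eqI: "(\<And>n. cf a n = cf b n) \<Longrightarrow> a = b"
  by (metis cf_inject ext)

lemma norm_add_squared_le:
  fixes x y :: "'a :: real_normed_vector"
  shows "(norm (x + y))\<^sup>2 \<le> 2 * (norm x)\<^sup>2 + 2 * (norm y)\<^sup>2"
proof -
  have "(norm (x + y))\<^sup>2 \<le> (norm x + norm y)\<^sup>2"
    by (intro power_mono norm_triangle_ineq) auto
  also have "\<dots> \<le> 2 * (norm x)\<^sup>2 + 2 * (norm y)\<^sup>2"
    using zero_le_power2[of "norm x - norm y"] by (simp add: power2_sum power2_diff)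
  finally show ?thesis .
qed

lemma square_summable_add:
  fixes a b :: "int \<Rightarrow> quat"
  assumes "(\<lambda>n. (norm (a n))\<^sup>2) summable_on UNIV" "(\<lambda>n. (norm (b n))\<^sup>2) summable_on UNIV"
  shows "(\<lambda>n. (norm (a n + b n))\<^sup>2) summable_on UNIV"
proof (rule summable_on_comparison_test)
  show "(\<lambda>n. 2 * (norm (a n))\<^sup>2 + 2 * (norm (b n))\<^sup>2) summable_on UNIV"
    by (intro summable_on_add summable_on_cmult_right assms)
  show "(norm (a n + b n))\<^sup>2 \<le> 2 * (norm (a n))\<^sup>2 + 2 * (norm (b n))\<^sup>2" for n
    by (rule norm_add_squared_le)
qed auto

instantiation l2 :: real_vector
begin

lift_definition zero_l2 :: l2 is "\<lambda>_. 0" by simp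
lift_definition plus_l2 :: "l2 \<Rightarrow> l2 \<Rightarrow> l2" is "\<lambda>a b n. a n + b n"
  by (rule square_summable_add)
lift_definition uminus_l2 :: "l2 \<Rightarrow> l2" is "\<lambda>a n. - a n" by simp
lift_definition minus_l2 :: "l2 \<Rightarrow> l2 \<Rightarrow> l2" is "\<lambda>a b n. a n - b n"
  subgoal for a b using square_summable_add[of a "\<lambda>n. - b n"] by simp
  done
lift_definition scaleR_l2 :: "real \<Rightarrow> l2 \<Rightarrow> l2" is "\<lambda>r a n. r *\<^sub>R a n"
  by (simp add: power_mult_distrib summable_on_cmult_right)

instance
  by standard (transfer; simp add: algebra_simps fun_eq_iff)+

end

lemma cf_simps [simp]:
  "cf 0 n = 0" "cf (a + b) n = cf a n + cf b n" "cf (a - b) n = cf a n - cf b n"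
  "cf (- a) n = - cf a n" "cf (r *\<^sub>R a) n = r *\<^sub>R cf a n"
  by (transfer; simp)+

lemma summable_inner_cf: "(\<lambda>n. inner (cf a n) (cf b n)) summable_on UNIV"
proof (rule abs_summable_summable, rule Infinite_Sum.abs_summable_on_comparison_test')
  show "(\<lambda>n. (norm (cf a n))\<^sup>2 + (norm (cf b n))\<^sup>2) summable_on UNIV"
    by (intro summable_on_add summable_cf)
  show "norm (inner (cf a n) (cf b n)) \<le> (norm (cf a n))\<^sup>2 + (norm (cf b n))\<^sup>2" for n
    using Cauchy_Schwarz_ineq2[of "cf a n" "cf b n"]
      zero_le_power2[of "norm (cf a n) - norm (cf b n)"]
      mult_nonneg_nonneg[OF norm_ge_zero norm_ge_zero, of "cf a n" "cf b n"]
    unfolding power2_diff real_norm_def by linarith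
qed

instantiation l2 :: real_inner
begin

text \<open>The real part of the quaternionic inner product. Real orthogonality to all right
  quaternionic multiples of a vector is quaternionic orthogonality to it, so real Hilbert space
  theory suffices.\<close>

definition inner_l2 :: "l2 \<Rightarrow> l2 \<Rightarrow> real" where
  "inner_l2 a b = (\<Sum>\<^sub>\<infinity>n. inner (cf a n) (cf b n))"
definition norm_l2 :: "l2 \<Rightarrow> real" where "norm_l2 a = sqrt (inner a a)"
definition sgn_l2 :: "l2 \<Rightarrow> l2" where "sgn_l2 a = a /\<^sub>R norm a"
definition dist_l2 :: "l2 \<Rightarrow> l2 \<Rightarrow> real" where "dist_l2 a b = norm (a - b)"
definition uniformity_l2 :: "(l2 \<times> l2) filter" where [code del]:
  "uniformity_l2 = (INF e\<in>{0 <..}. principal {(x, y). dist x y < e})"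
definition open_l2 :: "l2 set \<Rightarrow> bool" where [code del]:
  "open_l2 U \<longleftrightarrow> (\<forall>x\<in>U. eventually (\<lambda>(x', y). x' = x \<longrightarrow> y \<in> U) uniformity)"

instance
proof
  fix a b c :: l2 and r :: real
  show "dist a b = norm (a - b)" by (rule dist_l2_def)
  show "sgn a = a /\<^sub>R norm a" by (rule sgn_l2_def)
  show "inner a b = inner b a" by (simp add: inner_l2_def inner_commute)
  show "inner (a + b) c = inner a c + inner b c"
    by (simp add: inner_l2_def inner_add_left infsum_add summable_inner_cf)
  show "inner (r *\<^sub>R a) b = r * inner a b"
    by (simp add: inner_l2_def infsum_cmult_right')
  show "0 \<le> inner a a" by (simp add: inner_l2_def infsum_nonneg)
  show "inner a a = 0 \<longleftrightarrow> a = 0"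
  proof
    assume "inner a a = 0"
    then have "inner (cf a n) (cf a n) = 0" for n
      unfolding inner_l2_def
      using nonneg_infsum_le_0D[of "\<lambda>n. inner (cf a n) (cf a n)" UNIV n] summable_inner_cf[of a a]
      by auto
    then show "a = 0" by (intro l2_eqI) auto
  qed (simp add: inner_l2_def)
  show "norm a = sqrt (inner a a)" by (rule norm_l2_def)
qed (rule uniformity_l2_def open_l2_def)+

end

lemma has_sum_inner_l2: "((\<lambda>n. inner (cf a n) (cf b n)) has_sum inner a b) UNIV"
  by (simp add: inner_l2_def summable_inner_cf)

lemma has_sum_norm_l2: "((\<lambda>n. (norm (cf a n))\<^sup>2) has_sum (norm a)\<^sup>2) UNIV"
  using has_sum_inner_l2[of a a] by (simp add: power2_norm_eq_inner)

lemma sum_norm_cf_le: "finite N \<Longrightarrow> (\<Sum>n\<in>N. (norm (cf a n))\<^sup>2) \<le> (norm a)\<^sup>2"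
  using finite_sum_le_has_sum[OF has_sum_norm_l2, of N a] by auto

lemma norm_cf_le: "norm (cf a n) \<le> norm a"
  using sum_norm_cf_le[of "{n}" a] by (auto intro: power2_le_imp_le)

lemma bounded_linear_cf: "bounded_linear (\<lambda>a. cf a n)"
  by (rule bounded_linear_intro[of _ 1]) (auto simp: norm_cf_le)

lemma norm_l2_leI:
  assumes "\<And>N. finite N \<Longrightarrow> (\<Sum>n\<in>N. (norm (cf a n))\<^sup>2) \<le> c\<^sup>2" "0 \<le> c"
  shows "norm a \<le> c"
proof -
  have "(norm a)\<^sup>2 \<le> c\<^sup>2"
    using has_sum_le_finite_sums[OF has_sum_norm_l2] assms(1) by blast
  then show ?thesis using assms(2) by (rule power2_le_imp_le)
qed

instance l2 :: complete_space
proof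
  fix X :: "nat \<Rightarrow> l2"
  assume X: "Cauchy X"
  have "Cauchy (\<lambda>j. cf (X j) n)" for n
    by (rule bounded_linear.Cauchy[OF bounded_linear_cf X])
  then obtain y where y: "\<And>n. (\<lambda>j. cf (X j) n) \<longlonglongrightarrow> y n"
    unfolding Cauchy_convergent_iff convergent_def by metis
  \<comment> \<open>Bounds on finitely many coordinates survive the coordinatewise limit
    \<open>y\<close>; \<open>norm_l2_leI\<close> turns them into bounds on norms.\<close>
  have fin: "(\<Sum>n\<in>N. (norm (cf (X j) n - y n))\<^sup>2) \<le> e\<^sup>2"
    if "finite N" and J: "\<And>i j. J \<le> i \<Longrightarrow> J \<le> j \<Longrightarrow> norm (X i - X j) \<le> e" and "J \<le> j" for N J e j
  proof (rule tendsto_upperbound)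
    show "(\<lambda>i. \<Sum>n\<in>N. (norm (cf (X j) n - cf (X i) n))\<^sup>2) \<longlonglongrightarrow> (\<Sum>n\<in>N. (norm (cf (X j) n - y n))\<^sup>2)"
      by (intro tendsto_intros y)
    have "(\<Sum>n\<in>N. (norm (cf (X j) n - cf (X i) n))\<^sup>2) \<le> e\<^sup>2" if "J \<le> i" for i
    proof -
      have "(\<Sum>n\<in>N. (norm (cf (X j) n - cf (X i) n))\<^sup>2) \<le> (norm (X j - X i))\<^sup>2"
        using sum_norm_cf_le[OF \<open>finite N\<close>, of "X j - X i"] by simp
      also have "\<dots> \<le> e\<^sup>2" using J[OF \<open>J \<le> j\<close> that] by (intro power_mono) auto
      finally show ?thesis .
    qed
    then show "\<forall>\<^sub>F i in sequentially. (\<Sum>n\<in>N. (norm (cf (X j) n - cf (X i) n))\<^sup>2) \<le> e\<^sup>2"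
      unfolding eventually_sequentially by blast
  qed simp
  have unif: "\<exists>J. \<forall>i\<ge>J. \<forall>j\<ge>J. norm (X i - X j) \<le> e" if "0 < e" for e
    using X that unfolding Cauchy_def dist_norm by (meson less_imp_le)
  have sq: "(\<lambda>n. (norm (cf (X j) n - y n))\<^sup>2) summable_on UNIV"
    if J: "\<And>i j. J \<le> i \<Longrightarrow> J \<le> j \<Longrightarrow> norm (X i - X j) \<le> e" and "J \<le> j" for J j e
    by (rule nonneg_bdd_above_summable_on) (auto intro!: bdd_aboveI2 fin[OF _ J] that)
  obtain J where J: "\<And>i j. J \<le> i \<Longrightarrow> J \<le> j \<Longrightarrow> norm (X i - X j) \<le> 1"
    using unif[of 1] by auto
  have "(\<lambda>n. (norm (y n))\<^sup>2) summable_on UNIV"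
    using square_summable_add[OF summable_cf[of "X J"], of "\<lambda>n. - (cf (X J) n - y n)"]
      sq[OF J, of J] by (simp add: norm_minus_commute)
  then obtain L where L: "\<And>n. cf L n = y n" using cf_cases by (metis Abs_l2_inverse mem_Collect_eq)
  have "X \<longlonglongrightarrow> L"
  proof (rule LIMSEQ_I)
    fix r :: real
    assume "0 < r"
    obtain J where J: "\<And>i j. J \<le> i \<Longrightarrow> J \<le> j \<Longrightarrow> norm (X i - X j) \<le> r / 2"
      using unif[of "r/2"] \<open>0 < r\<close> by auto
    have "norm (X j - L) \<le> r / 2" if "J \<le> j" for j
      by (rule norm_l2_leI) (use fin[OF _ J that] \<open>0 < r\<close> in \<open>auto simp: L\<close>)
    then show "\<exists>no. \<forall>j\<ge>no. norm (X j - L) < r"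
      using \<open>0 < r\<close> by (intro exI[of _ J]) fastforce
  qed
  then show "convergent X" by (auto simp: convergent_def)
qed

theorem orthogonal_projection_exists:
  fixes K :: "'a::{real_inner, complete_space} set"
  assumes K: "closed K" "subspace K"
  obtains y where "y \<in> K" "\<And>z. z \<in> K \<Longrightarrow> inner (x - y) z = 0"
proof -
  define d where "d = infdist x K"
  have ne: "K \<noteq> {}" using K(2) subspace_0 by blast
  have "\<exists>y\<in>K. dist x y < d + inverse (real (Suc j))" for j
  proof -
    have "(INF a\<in>K. dist x a) < d + inverse (real (Suc j))"
      using ne by (simp add: d_def infdist_notempty)
    then show ?thesis by (subst (asm) cINF_less_iff[OF ne]) auto
  qed
  then obtain y where y: "\<And>j. y j \<in> K" "\<And>j. dist x (y j) < d + inverse (real (Suc j))"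
    by metis
  have d0: "0 \<le> d" by (simp add: d_def infdist_nonneg)
  have ge: "d \<le> norm (x - z)" if "z \<in> K" for z
    using infdist_le[OF that, of x] by (simp add: d_def dist_norm)
  \<comment> \<open>The parallelogram law, with the midpoint of \<open>y i\<close> and
    \<open>y j\<close> at distance at least \<open>d\<close> from \<open>x\<close>. It makes the
    minimizing sequence Cauchy.\<close>
  have par: "(norm (y i - y j))\<^sup>2 \<le> 2 * (norm (x - y i))\<^sup>2 + 2 * (norm (x - y j))\<^sup>2 - 4 * d\<^sup>2"
    for i j
  proof -
    have "(1/2) *\<^sub>R (y i + y j) \<in> K"
      by (intro subspace_scale[OF K(2)] subspace_add[OF K(2)] y)
    from ge[OF this] have "d\<^sup>2 \<le> (norm (x - (1/2) *\<^sub>R (y i + y j)))\<^sup>2"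
      using d0 by (rule power_mono)
    moreover have "4 * (norm (x - (1/2) *\<^sub>R (y i + y j)))\<^sup>2 + (norm (y i - y j))\<^sup>2
        = 2 * (norm (x - y i))\<^sup>2 + 2 * (norm (x - y j))\<^sup>2"
      by (simp add: power2_norm_eq_inner inner_simps inner_commute algebra_simps)
    ultimately show ?thesis by linarith
  qed
  have lim: "(\<lambda>j. norm (x - y j)) \<longlonglongrightarrow> d"
  proof (rule tendsto_sandwich[of "\<lambda>_. d" _ _ "\<lambda>j. d + inverse (real (Suc j))"])
    show "(\<lambda>j. d + inverse (real (Suc j))) \<longlonglongrightarrow> d"
      using tendsto_add[OF tendsto_const LIMSEQ_inverse_real_of_nat, of d] by simp
    show "\<forall>\<^sub>F j in sequentially. norm (x - y j) \<le> d + inverse (real (Suc j))"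
      using y(2) by (auto simp: dist_norm intro!: always_eventually less_imp_le)
  qed (use ge y in auto)
  have "Cauchy y"
  proof (rule CauchyI)
    fix e :: real assume "0 < e"
    have "(\<lambda>j. (norm (x - y j))\<^sup>2) \<longlonglongrightarrow> d\<^sup>2" by (intro tendsto_intros lim)
    moreover have "d\<^sup>2 < d\<^sup>2 + e\<^sup>2 / 4" using \<open>0 < e\<close> by simp
    ultimately have "\<forall>\<^sub>F j in sequentially. (norm (x - y j))\<^sup>2 < d\<^sup>2 + e\<^sup>2 / 4"
      by (rule order_tendstoD(2))
    then obtain M where M: "\<And>j. j \<ge> M \<Longrightarrow> (norm (x - y j))\<^sup>2 < d\<^sup>2 + e\<^sup>2 / 4"
      by (auto simp: eventually_sequentially)
    have "norm (y i - y j) < e" if "M \<le> i" "M \<le> j" for i j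
    proof -
      have "(norm (y i - y j))\<^sup>2 < e\<^sup>2"
        using par[of i j] M[OF that(1)] M[OF that(2)] by (simp add: field_simps)
      then show ?thesis using \<open>0 < e\<close> by (simp add: power2_less_imp_less)
    qed
    then show "\<exists>M. \<forall>m\<ge>M. \<forall>n\<ge>M. norm (y m - y n) < e" by blast
  qed
  then obtain L where L: "y \<longlonglongrightarrow> L" using Cauchy_convergent_iff convergent_def by blast
  have LK: "L \<in> K" using closed_sequentially[OF K(1) _ L] y by blast
  have "(\<lambda>j. norm (x - y j)) \<longlonglongrightarrow> norm (x - L)" by (intro tendsto_intros L)
  with lim have dL: "norm (x - L) = d" using LIMSEQ_unique by blast
  have "inner (x - L) z = 0" if "z \<in> K" for z
  proof (cases "z = 0")
    case False
    \<comment> \<open>The minimizer of the squared norm of \<open>x - L - r z\<close> over real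
      \<open>r\<close>; a nonzero inner product would bring \<open>x\<close> closer to
      \<open>K\<close> than \<open>d\<close>.\<close>
    define r where "r = inner (x - L) z / inner z z"
    have "d \<le> norm (x - (L + r *\<^sub>R z))"
      by (intro ge subspace_add[OF K(2)] subspace_scale[OF K(2)] LK that)
    then have "d\<^sup>2 \<le> (norm ((x - L) - r *\<^sub>R z))\<^sup>2"
      using d0 power_mono by (metis diff_diff_eq)
    also have "\<dots> = (norm (x - L))\<^sup>2 - 2 * r * inner (x - L) z + r * r * inner z z"
      unfolding power2_norm_eq_inner by (simp add: inner_diff_left inner_diff_right inner_commute
        algebra_simps)
    also have "\<dots> = d\<^sup>2 - (inner (x - L) z)\<^sup>2 / inner z z"
      using False by (simp add: dL r_def power2_eq_square)
    finally have "(inner (x - L) z)\<^sup>2 / inner z z \<le> 0" by simp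
    moreover have "0 < inner z z" using False by simp
    ultimately show ?thesis by (simp add: divide_le_0_iff)
  qed simp
  with LK that show ?thesis by blast
qed

section \<open>Uniqueness of Fourier coefficients on the circle\<close>

text \<open>A measure on the whole line carried by one period. Functions of the angle need not be
  periodic, and the change of sign of the angle appears as \<open>2 * pi - t\<close>, which
  preserves this period.\<close>

definition circ :: "real measure" where
  "circ = uniform_measure lborel {0..2*pi}"

lemma sets_circ [measurable_cong, simp]: "sets circ = sets borel"
  by (simp add: circ_def)

lemma space_circ [simp]: "space circ = UNIV"
  by (simp add: circ_def)

interpretation circ: prob_space circ
  unfolding circ_def by (rule prob_space_uniform_measure) simp_all

lemma nn_integral_circ:
  assumes [measurable]: "f \<in> borel_measurable borel"
  shows "(\<integral>\<^sup>+ t. f t \<partial>circ) = (\<integral>\<^sup>+ t. f t * indicator {0..2*pi} t \<partial>lborel) / ennreal (2 * pi)"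
  unfolding circ_def by (subst nn_integral_uniform_measure) auto

lemma AE_circ_iff: "(AE t in circ. P t) \<longleftrightarrow> (AE t in lborel. t \<in> {0..2*pi} \<longrightarrow> P t)"
  unfolding circ_def by (subst AE_uniform_measure) auto

lemma integral_circ:
  fixes f :: "real \<Rightarrow> real"
  assumes [measurable]: "f \<in> borel_measurable borel"
  shows "(\<integral>t. f t \<partial>circ) = (\<integral>t. f t * indicator {0..2*pi} t \<partial>lborel) / (2 * pi)"
proof -
  have "circ = density lborel (\<lambda>t. ennreal (indicator {0..2*pi} t / (2 * pi)))"
    unfolding circ_def uniform_measure_def
    by (intro density_cong) (auto simp: indicator_def divide_ennreal simp flip: ennreal_1)
  then have "(\<integral>t. f t \<partial>circ) = (\<integral>t. f t \<partial>density lborel (\<lambda>t. ennreal (indicator {0..2*pi} t / (2 *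
    pi))))"
    by (rule arg_cong)
  also have "\<dots> = (\<integral>t. f t * indicator {0..2*pi} t / (2 * pi) \<partial>lborel)"
    by (subst integral_density) (auto simp: mult.commute)
  finally have "(\<integral>t. f t \<partial>circ) = (\<integral>t. f t * indicator {0..2*pi} t / (2 * pi) \<partial>lborel)" .
  then show ?thesis by simp
qed

lemma distr_circ_reflect: "distr circ borel (\<lambda>t. 2 * pi - t) = circ"
proof (rule measure_eqI)
  fix A :: "real set"
  assume "A \<in> sets (distr circ borel (\<lambda>t. 2 * pi - t))"
  then have [measurable]: "A \<in> sets borel" by simp
  have "emeasure (distr circ borel (\<lambda>t. 2 * pi - t)) A = (\<integral>\<^sup>+ t. indicator A (2 * pi - t) \<partial>circ)"
    by (subst nn_integral_distr[of "\<lambda>t. 2 * pi - t" circ borel "indicator A", symmetric]) auto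
  also have "\<dots> = (\<integral>\<^sup>+ t. indicator A (2 * pi
    - t) * indicator {0..2*pi} t \<partial>lborel) / ennreal (2 * pi)"
    by (rule nn_integral_circ) measurable
  also have "(\<integral>\<^sup>+ t. indicator A (2 * pi - t) * indicator {0..2*pi} t \<partial>lborel)
      = (\<integral>\<^sup>+ t. indicator A (2 * pi - (2 * pi + (-1) * t)) * indicator {0..2*pi} (2 * pi
        + (-1) * t) \<partial>lborel)"
    by (subst nn_integral_real_affine[where c = "-1" and t = "2 * pi"]) auto
  also have "\<dots> = (\<integral>\<^sup>+ t. indicator A t * indicator {0..2*pi} t \<partial>lborel)"
    by (intro nn_integral_cong) (auto simp: indicator_def)
  also have "\<dots> / ennreal (2 * pi) = (\<integral>\<^sup>+ t. indicator A t \<partial>circ)"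
    by (rule nn_integral_circ[symmetric]) measurable
  also have "\<dots> = emeasure circ A" by simp
  finally show "emeasure (distr circ borel (\<lambda>t. 2 * pi - t)) A = emeasure circ A" .
qed simp

lemma AE_circ_reflect: "(AE t in circ. P t) \<Longrightarrow> (AE t in circ. P (2 * pi - t))"
  by (rule AE_distrD[of "\<lambda>t. 2 * pi - t" circ borel]) (simp_all only: distr_circ_reflect,
    measurable)

lemma nn_integral_circ_reflect:
  assumes [measurable]: "f \<in> borel_measurable borel"
  shows "(\<integral>\<^sup>+ t. f (2 * pi - t) \<partial>circ) = (\<integral>\<^sup>+ t. f t \<partial>circ)"
  using nn_integral_distr[of "\<lambda>t. 2 * pi - t" circ borel f] by (simp add: distr_circ_reflect)

lemma integral_circ_reflect:
  fixes f :: "real \<Rightarrow> 'b :: {banach, second_countable_topology}"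
  assumes [measurable]: "f \<in> borel_measurable borel"
  shows "(\<integral>t. f (2 * pi - t) \<partial>circ) = (\<integral>t. f t \<partial>circ)"
  using integral_distr[of "\<lambda>t. 2 * pi - t" circ borel f] by (simp add: distr_circ_reflect)

lemma integral_cos_circ: "(\<integral>t. cos (of_int n * t) \<partial>circ) = (if n = 0 then 1 else 0)"
proof (cases "n = 0")
  case False
  have "(\<integral>t. cos (of_int n * t) * indicator {0..2*pi} t \<partial>lborel)
      = sin (of_int n * (2 * pi)) / of_int n - sin (of_int n * 0) / of_int n"
    by (rule integral_FTC_Icc_real)
      (use False in \<open>auto intro!: derivative_eq_intros continuous_intros\<close>)
  also have "\<dots> = 0" using sin_int_2pin[of n] by (simp add: mult.commute)
  finally show ?thesis using False by (subst integral_circ) auto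
qed (use circ.prob_space in simp)

lemma integrable_circ_bounded:
  fixes v :: "real \<Rightarrow> real" and u :: "real \<Rightarrow> 'b :: {banach, second_countable_topology}"
  assumes u: "integrable circ u" and [measurable]: "v \<in> borel_measurable borel"
    and v: "\<And>t. \<bar>v t\<bar> \<le> c"
  shows "integrable circ (\<lambda>t. v t *\<^sub>R u t)"
proof (rule Bochner_Integration.integrable_bound)
  show "integrable circ (\<lambda>t. c *\<^sub>R norm (u t))" using u by simp
  have [measurable]: "u \<in> borel_measurable circ" using u by simp
  show "(\<lambda>t. v t *\<^sub>R u t) \<in> borel_measurable circ" by measurable
  have "0 \<le> c" using v[of 0] by linarith
  then show "AE t in circ. norm (v t *\<^sub>R u t) \<le> norm (c *\<^sub>R norm (u t))"
    using v by (auto intro!: mult_right_mono)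
qed

section \<open>Integrable functions with vanishing trigonometric moments\<close>

definition trig_null :: "(real \<Rightarrow> real) \<Rightarrow> bool" where
  "trig_null v \<longleftrightarrow> integrable circ v \<and>
     (\<forall>n::int. (\<integral>t. cos (of_int n * t) * v t \<partial>circ) = 0 \<and> (\<integral>t. sin (of_int n * t) * v t \<partial>circ) = 0)"

lemma integrable_trig_mult:
  fixes v :: "real \<Rightarrow> real"
  assumes "integrable circ v"
  shows "integrable circ (\<lambda>t. cos (r * t) * v t)" "integrable circ (\<lambda>t. sin (r * t) * v t)"
  using integrable_circ_bounded[OF assms, of "\<lambda>t. cos (r * t)" 1]
    integrable_circ_bounded[OF assms, of "\<lambda>t. sin (r * t)" 1] by simp_all

lemma trig_null_add: "trig_null v \<Longrightarrow> trig_null w \<Longrightarrow> trig_null (\<lambda>t. v t + w t)"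
  by (auto simp: trig_null_def distrib_left integrable_trig_mult)

lemma trig_null_cmult: "trig_null v \<Longrightarrow> trig_null (\<lambda>t. c * v t)"
  by (auto simp: trig_null_def mult.left_commute[of _ c])

text \<open>Product-to-sum formulas move the extra factor into the frequencies \<open>n + 1\<close>
  and \<open>n - 1\<close>.\<close>

lemma trig_null_cos_sin:
  assumes v: "trig_null v"
  shows "trig_null (\<lambda>t. cos t * v t)" "trig_null (\<lambda>t. sin t * v t)"
proof -
  have i: "integrable circ v"
    and z: "\<And>n::int. (\<integral>t. cos (of_int n * t) * v t \<partial>circ) = 0"
      "\<And>n::int. (\<integral>t. sin (of_int n * t) * v t \<partial>circ) = 0"
    using v by (auto simp: trig_null_def)
  have s: "of_int (n + 1) * t = of_int n * t + t" "of_int (n - 1) * t = of_int n * t - t"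
    for n :: int and t :: real
    by (simp_all add: algebra_simps)
  have *: "cos (of_int n * t) * (cos t * v t)
    = (cos (of_int (n+1) * t) * v t + cos (of_int (n-1) * t) * v t) / 2"
    "sin (of_int n * t) * (cos t * v t) = (sin (of_int (n+1) * t) * v t
      + sin (of_int (n-1) * t) * v t) / 2"
    "cos (of_int n * t) * (sin t * v t) = (sin (of_int (n+1) * t) * v t
      - sin (of_int (n-1) * t) * v t) / 2"
    "sin (of_int n * t) * (sin t * v t) = (cos (of_int (n-1) * t) * v t
      - cos (of_int (n+1) * t) * v t) / 2"
    for n :: int and t
    unfolding s cos_add cos_diff sin_add sin_diff by (simp_all add: field_simps)
  show "trig_null (\<lambda>t. cos t * v t)" "trig_null (\<lambda>t. sin t * v t)"
    unfolding trig_null_def * using integrable_trig_mult[OF i] integrable_trig_mult[OF i, of 1]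
    by (auto simp: z simp del: of_int_add of_int_diff)
qed

text \<open>The functions with vanishing moments form a module over the polynomials in cosine and
  sine. The induction varies \<open>v\<close>, because the product case applies the hypothesis for
  one factor to the other factor times \<open>v\<close>.\<close>

lemma trig_null_polynomial:
  fixes p :: "complex \<Rightarrow> real"
  assumes "real_polynomial_function p" "trig_null v"
  shows "trig_null (\<lambda>t. p (cis t) * v t)"
  using assms
proof (induction arbitrary: v rule: real_polynomial_function.induct)
  case (linear f)
  have "f (cis t) = cos t * f 1 + sin t * f \<i>" for t
  proof -
    have "cis t = cos t *\<^sub>R 1 + sin t *\<^sub>R \<i>" by (simp add: complex_eq_iff)
    then show ?thesis
      using linear(1) by (simp add: linear_simps)
  qed
  then have "(\<lambda>t. f (cis t) * v t) = (\<lambda>t. f 1 * (cos t * v t) + f \<i> * (sin t * v t))"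
    by (auto simp: algebra_simps)
  then show ?case
    using trig_null_add[OF trig_null_cmult trig_null_cmult] trig_null_cos_sin[OF linear(2)] by metis
next
  case (const c)
  then show ?case by (rule trig_null_cmult)
next
  case (add f g)
  then show ?case using trig_null_add[of "\<lambda>t. f (cis t) * v t" "\<lambda>t. g (cis t) * v t"]
    by (simp add: distrib_right)
next
  case (mult f g)
  then show ?case using mult.IH(1)[of "\<lambda>t. g (cis t) * v t"] by (simp add: mult.assoc)
qed

text \<open>Weierstrass approximation on the unit circle; the error is controlled uniformly because
  \<open>v\<close> is only integrable.\<close>

lemma trig_null_continuous:
  fixes \<phi> :: "complex \<Rightarrow> real"
  assumes v: "trig_null v" and \<phi>: "continuous_on UNIV \<phi>"
  shows "(\<integral>t. \<phi> (cis t) * v t \<partial>circ) = 0"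
proof -
  have iv: "integrable circ v" using v by (simp add: trig_null_def)
  have cis_meas [measurable]: "cis \<in> borel_measurable borel"
    by (intro borel_measurable_continuous_onI continuous_intros)
  have [measurable]: "\<phi> \<in> borel_measurable borel"
    using \<phi> by (rule borel_measurable_continuous_onI)
  have "compact (\<phi> ` sphere 0 1)"
    by (intro compact_continuous_image continuous_on_subset[OF \<phi>]) auto
  then obtain B where B: "\<And>z. z \<in> sphere 0 1 \<Longrightarrow> \<bar>\<phi> z\<bar> \<le> B"
    unfolding compact_eq_bounded_closed bounded_real by (meson imageI)
  have i\<phi>: "integrable circ (\<lambda>t. \<phi> (cis t) * v t)"
    using integrable_circ_bounded[OF iv, of "\<lambda>t. \<phi> (cis t)" B] B by simp
  define I where "I = (\<integral>t. \<bar>v t\<bar> \<partial>circ)"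
  have "\<bar>\<integral>t. \<phi> (cis t) * v t \<partial>circ\<bar> \<le> e * I" if "0 < e" for e
  proof -
    obtain p where p: "real_polynomial_function p" "\<And>z. z \<in> sphere 0 1 \<Longrightarrow> \<bar>\<phi> z - p z\<bar> < e"
      using Stone_Weierstrass_real_polynomial_function[of "sphere (0::complex) 1" \<phi> e]
        continuous_on_subset[OF \<phi>] \<open>0 < e\<close> by auto
    have pn: "trig_null (\<lambda>t. p (cis t) * v t)" by (rule trig_null_polynomial[OF p(1) v])
    then have ip: "integrable circ (\<lambda>t. p (cis t) * v t)" by (simp add: trig_null_def)
    have "(\<integral>t. p (cis t) * v t \<partial>circ) = 0"
      using pn[unfolded trig_null_def, THEN conjunct2, THEN spec, of 0] by simp
    then have "(\<integral>t. \<phi> (cis t) * v t \<partial>circ) = (\<integral>t. \<phi> (cis t) * v t - p (cis t) * v t \<partial>circ)"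
      using i\<phi> ip by simp
    also have "\<bar>\<dots>\<bar> \<le> (\<integral>t. \<bar>\<phi> (cis t) * v t - p (cis t) * v t\<bar> \<partial>circ)"
      by (rule integral_abs_bound)
    also have "\<dots> \<le> (\<integral>t. e * \<bar>v t\<bar> \<partial>circ)"
    proof (rule integral_mono)
      show "\<bar>\<phi> (cis t) * v t - p (cis t) * v t\<bar> \<le> e * \<bar>v t\<bar>" for t
        using p(2)[of "cis t"]
        by (simp add: left_diff_distrib[symmetric] abs_mult mult_right_mono)
    qed (use i\<phi> ip iv in auto)
    also have "\<dots> = e * I" by (simp add: I_def)
    finally show ?thesis .
  qed
  then have "\<bar>\<integral>t. \<phi> (cis t) * v t \<partial>circ\<bar> \<le> 0 + e" if "0 < e" for e
  proof -
    have "0 \<le> I" by (simp add: I_def)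
    from \<open>0 < e\<close> this have "0 < e / (I + 1)" by simp
    from \<open>\<And>e. 0 < e \<Longrightarrow> _ \<le> e * I\<close>[OF this] have "\<bar>\<integral>t. \<phi> (cis t) * v t \<partial>circ\<bar> \<le> e / (I + 1) * I" .
    also have "\<dots> \<le> e" using \<open>0 \<le> I\<close> \<open>0 < e\<close> by (simp add: field_simps)
    finally show ?thesis by simp
  qed
  then have "\<bar>\<integral>t. \<phi> (cis t) * v t \<partial>circ\<bar> \<le> 0" by (rule field_le_epsilon)
  then show ?thesis by simp
qed

lemma trig_null_compact:
  assumes v: "trig_null v" and A: "compact A" "A \<noteq> {}"
  shows "(\<integral>t. indicator A (cis t) * v t \<partial>circ) = 0"
proof -
  have iv: "integrable circ v" using v by (simp add: trig_null_def)
  then have [measurable]: "v \<in> borel_measurable borel" by (auto dest: borel_measurable_integrable)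
  have [measurable]: "cis \<in> borel_measurable borel"
    by (intro borel_measurable_continuous_onI continuous_intros)
  have [measurable]: "A \<in> sets borel" using A(1) by (rule borel_compact)
  \<comment> \<open>Continuous functions that decrease to the indicator of the closed set
    \<open>A\<close>; for positive \<open>k\<close> they vanish at distance \<open>1 / k\<close> and
    beyond.\<close>
  define \<phi> where "\<phi> = (\<lambda>(k::nat) z. max 0 (1 - real k * infdist z A))"
  have c: "continuous_on UNIV (\<phi> k)" for k
    unfolding \<phi>_def by (intro continuous_intros)
  then have [measurable]: "\<phi> k \<in> borel_measurable borel" for k
    by (rule borel_measurable_continuous_onI)
  have "(\<lambda>k. \<integral>t. \<phi> k (cis t) * v t \<partial>circ) \<longlonglongrightarrow> (\<integral>t. indicator A (cis t) * v t \<partial>circ)"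
  proof (rule integral_dominated_convergence[where w = "\<lambda>t. \<bar>v t\<bar>"])
    have "(\<lambda>k. \<phi> k z) \<longlonglongrightarrow> indicator A z" for z
    proof (cases "z \<in> A")
      case True
      then show ?thesis by (simp add: \<phi>_def)
    next
      case False
      then have pos: "0 < infdist z A"
        using A compact_imp_closed in_closed_iff_infdist_zero infdist_pos_not_in_closed by blast
      obtain K :: nat where K: "1 / infdist z A < real K" using reals_Archimedean2 by blast
      have "\<phi> k z = 0" if "K \<le> k" for k
      proof -
        have "1 / infdist z A < real k" using K that by linarith
        then show ?thesis using pos by (simp add: \<phi>_def field_simps)
      qed
      then have "\<forall>\<^sub>F k in sequentially. \<phi> k z = 0" by (auto simp: eventually_sequentially)
      then show ?thesis using False by (simp add: tendsto_eventually)
    qed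
    then show "AE t in circ. (\<lambda>k. \<phi> k (cis t) * v t) \<longlonglongrightarrow> indicator A (cis t) * v t"
      by (intro AE_I2 tendsto_intros)
    have "\<bar>\<phi> k z\<bar> \<le> 1" for k z by (simp add: \<phi>_def infdist_nonneg)
    then show "AE t in circ. norm (\<phi> k (cis t) * v t) \<le> \<bar>v t\<bar>" for k
      by (auto simp: abs_mult intro!: mult_left_le_one_le)
  qed (use iv in auto)
  moreover have "(\<lambda>k. \<integral>t. \<phi> k (cis t) * v t \<partial>circ) = (\<lambda>_. 0)"
    using trig_null_continuous[OF v c] by blast
  ultimately show ?thesis using LIMSEQ_unique tendsto_const by metis
qed

lemma AE_circ_singleton: "AE t in circ. t \<noteq> c"
  unfolding AE_circ_iff using AE_lborel_singleton[of c] by eventually_elim auto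

text \<open>By inner regularity it suffices that every compact \<open>K\<close> on which
  \<open>v\<close> is positive is null. The image of \<open>K\<close> on the circle is compact, so
  the integral of \<open>v\<close> over \<open>K\<close> vanishes, and positivity makes
  \<open>K\<close> null.\<close>

lemma trig_null_AE_le_0:
  assumes v: "trig_null v"
  shows "AE t in circ. v t \<le> 0"
proof -
  have iv: "integrable circ v" using v by (simp add: trig_null_def)
  then have [measurable]: "v \<in> borel_measurable borel" by (auto dest: borel_measurable_integrable)
  define B where "B = {t \<in> {0..2*pi}. 0 < v t}"
  have [measurable]: "B \<in> sets borel" unfolding B_def by measurable
  have "emeasure circ K = 0" if K: "K \<subseteq> B" "compact K" for K
  proof (cases "K = {}")
    case False
    have [measurable]: "K \<in> sets borel" using K(2) by (rule borel_compact)
    have "compact (cis ` K)" by (intro compact_continuous_image K continuous_intros)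
    then have "(\<integral>t. indicator (cis ` K) (cis t) * v t \<partial>circ) = 0"
      using trig_null_compact[OF v] False by blast
    moreover have "(\<integral>t. indicator (cis ` K) (cis t) * v t \<partial>circ) = (\<integral>t. indicator K t * v t \<partial>circ)"
    proof (rule integral_cong_AE)
      have [measurable]: "cis \<in> borel_measurable borel"
        by (intro borel_measurable_continuous_onI continuous_intros)
      have [measurable]: "cis ` K \<in> sets borel"
        using \<open>compact (cis ` K)\<close> by (rule borel_compact)
      show "(\<lambda>t. indicator (cis ` K) (cis t) * v t) \<in> borel_measurable circ" by measurable
      show "(\<lambda>t. indicator K t * v t) \<in> borel_measurable circ" by measurable
      have "AE t in circ. t \<in> {0..2*pi}" unfolding AE_circ_iff by simp
      \<comment> \<open>On the closed period \<open>cis\<close> identifies only the two endpoints,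
        which form a null set.\<close>
      then show "AE t in circ. indicator (cis ` K) (cis t) * v t = indicator K t * v t"
        using AE_circ_singleton[of 0] AE_circ_singleton[of "2 * pi"]
      proof eventually_elim
        case (elim t)
        have "t \<in> K" if "cis t = cis s" "s \<in> K" for s
        proof -
          have s: "0 \<le> s" "s \<le> 2 * pi" using that(2) K(1) by (auto simp: B_def)
          have "sin t = sin s \<and> cos t = cos s" using that(1) by (simp add: complex_eq_iff)
          then obtain n :: int where n: "t = s + 2 * pi * of_int n" using sin_cos_eq_iff by auto
          have "- 1 < n" "n < 1"
          proof -
            have t: "0 < t" "t < 2 * pi" using elim by auto
            have "2 * pi * (1 + of_int n) = 2 * pi + t - s" using n by (simp add: algebra_simps)
            then have "0 < 2 * pi * (1 + real_of_int n)" using t s by linarith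
            then have "0 < 1 + real_of_int n" by (simp add: zero_less_mult_iff)
            then show "- 1 < n" by linarith
            have "2 * pi * (1 - of_int n) = 2 * pi - t + s" using n by (simp add: algebra_simps)
            then have "0 < 2 * pi * (1 - real_of_int n)" using t s by linarith
            then have "0 < 1 - real_of_int n" by (simp add: zero_less_mult_iff)
            then show "n < 1" by linarith
          qed
          then have "n = 0" by linarith
          then show ?thesis using n that(2) by simp
        qed
        then have "cis t \<in> cis ` K \<longleftrightarrow> t \<in> K" by auto
        then show ?case by (simp add: indicator_def)
      qed
    qed
    ultimately have "(\<integral>t. indicator K t * v t \<partial>circ) = 0" by simp
    moreover have "integrable circ (\<lambda>t. indicator K t * v t)"
      using integrable_circ_bounded[OF iv, of "indicator K" 1] by (auto simp: indicator_def)
    moreover have "AE t in circ. 0 \<le> indicator K t * v t"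
      using K by (intro AE_I2) (auto simp: B_def indicator_def intro: less_imp_le)
    ultimately have "AE t in circ. indicator K t * v t = 0"
      using integral_nonneg_eq_0_iff_AE by blast
    then have "AE t in circ. t \<notin> K"
      by eventually_elim (use K in \<open>auto simp: B_def indicator_def\<close>)
    then have "K \<in> null_sets circ" by (simp only: AE_iff_null_sets \<open>K \<in> sets borel\<close> sets_circ)
    then show ?thesis by (rule null_setsD1)
  qed simp
  note null = this
  have "emeasure circ B = (SUP K \<in> {K. K \<subseteq> B \<and> compact K}. emeasure circ K)"
    by (rule inner_regular) (simp_all add: circ.emeasure_space_1[unfolded space_circ])
  also have "\<dots> \<le> 0" by (rule SUP_least) (auto simp: null)
  finally have "emeasure circ B = 0" by simp
  then have "AE t in circ. t \<notin> B" by (intro AE_not_in) (auto simp: null_sets_def)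
  moreover have "AE t in circ. t \<in> {0..2*pi}" unfolding AE_circ_iff by simp
  ultimately show ?thesis by eventually_elim (auto simp: B_def)
qed

theorem Fourier_unique:
  fixes u :: "real \<Rightarrow> 'b :: euclidean_space"
  assumes u: "integrable circ u"
    and "\<And>n::int. (\<integral>t. cos (of_int n * t) *\<^sub>R u t \<partial>circ) = 0"
    and "\<And>n::int. (\<integral>t. sin (of_int n * t) *\<^sub>R u t \<partial>circ) = 0"
  shows "AE t in circ. u t = 0"
proof -
  have null: "trig_null (\<lambda>t. inner (u t) b)" for b
  proof -
    have i: "integrable circ (\<lambda>t. cos (of_int n * t) *\<^sub>R u t)"
      "integrable circ (\<lambda>t. sin (of_int n * t) *\<^sub>R u t)" for n :: int
      by (rule integrable_circ_bounded[OF u, of _ 1]; simp)+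
    have "(\<integral>t. cos (of_int n * t) * inner (u t) b \<partial>circ) = 0"
      "(\<integral>t. sin (of_int n * t) * inner (u t) b \<partial>circ) = 0" for n
      using integral_inner_left[OF i(1)[of n], of b] integral_inner_left[OF i(2)[of n], of b]
      by (simp_all add: assms(2,3))
    then show ?thesis using u by (simp add: trig_null_def)
  qed
  have "AE t in circ. inner (u t) b \<le> 0" for b
    by (rule trig_null_AE_le_0[OF null])
  \<comment> \<open>The one-sided bound for both \<open>b\<close> and \<open>- b\<close> makes each
    component vanish.\<close>
  then have "AE t in circ. \<forall>b\<in>Basis. inner (u t) b \<le> 0 \<and> inner (u t) (- b) \<le> 0"
    by (intro AE_ball_countable[THEN iffD2] ballI AE_conjI countable_finite finite_Basis)
  then show ?thesis
    by eventually_elim (rule euclidean_eqI, force)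
qed

section \<open>Pairs of quaternions and their Fourier coefficients\<close>

text \<open>Squared L2 increments bounded by \<open>(1/4) ^ j\<close> give L1 increments bounded by
  \<open>(1/2) ^ j\<close>, so the series of increments converges absolutely almost
  everywhere.\<close>

lemma L2_limit:
  fixes S :: "nat \<Rightarrow> 'a \<Rightarrow> 'b :: {banach, second_countable_topology}"
  assumes M: "prob_space M" and [measurable]: "\<And>j. S j \<in> borel_measurable M"
    and fast: "\<And>j. (\<integral>\<^sup>+ x. ennreal ((norm (S (Suc j) x - S j x))\<^sup>2) \<partial>M) \<le> ennreal ((1/4) ^ j)"
  shows "AE x in M. convergent (\<lambda>j. S j x)"
proof -
  interpret prob_space M by (rule M)
  define d where "d = (\<lambda>j x. norm (S (Suc j) x - S j x))"
  have [measurable]: "d j \<in> borel_measurable M" for j unfolding d_def by measurable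
  have "(\<integral>\<^sup>+ x. ennreal (d j x) \<partial>M) \<le> ennreal ((1/2) ^ j)" for j
  proof -
    have "(\<integral>\<^sup>+ x. ennreal (d j x) \<partial>M) \<le> (\<integral>\<^sup>+ x. ennreal (2 ^ j / 2) * ennreal ((d j x)\<^sup>2)
      + ennreal ((1/2) ^ j / 2) \<partial>M)"
    proof (rule nn_integral_mono)
      fix x
      have d0: "0 \<le> d j x" by (simp add: d_def)
      \<comment> \<open>A weighted inequality of arithmetic and geometric means; the weight
        \<open>2 ^ j\<close> makes both resulting terms contribute
        \<open>(1/2) ^ j / 2\<close>.\<close>
      have "0 \<le> 2 ^ j * (d j x - (1/2) ^ j)\<^sup>2" by simp
      also have "\<dots> = 2 ^ j * (d j x)\<^sup>2 - 2 * d j x + (1/2) ^ j"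
        by (simp add: power2_eq_square algebra_simps power_one_over)
      finally have "d j x \<le> 2 ^ j / 2 * (d j x)\<^sup>2 + (1/2) ^ j / 2" by simp
      then have "ennreal (d j x) \<le> ennreal (2 ^ j / 2 * (d j x)\<^sup>2 + (1/2) ^ j / 2)"
        by (rule ennreal_leI)
      also have "\<dots> = ennreal (2 ^ j / 2) * ennreal ((d j x)\<^sup>2) + ennreal ((1/2) ^ j / 2)"
        by (subst ennreal_plus) (auto simp: ennreal_mult simp del: times_divide_eq_left)
      finally show "ennreal (d j x) \<le> ennreal (2 ^ j / 2) * ennreal ((d j x)\<^sup>2)
        + ennreal ((1/2) ^ j / 2)" .
    qed
    also have "\<dots> = ennreal (2 ^ j / 2) * (\<integral>\<^sup>+ x. ennreal ((d j x)\<^sup>2) \<partial>M) + ennreal ((1/2) ^ j / 2)"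
      by (subst nn_integral_add) (auto simp: nn_integral_cmult emeasure_space_1)
    also have "\<dots> \<le> ennreal (2 ^ j / 2) * ennreal ((1/4) ^ j) + ennreal ((1/2) ^ j / 2)"
      using fast[of j] by (intro add_mono mult_left_mono) (auto simp: d_def)
    also have "\<dots> = ennreal (2 ^ j / 2 * (1/4) ^ j + (1/2) ^ j / 2)"
    proof -
      have "ennreal (2 ^ j / 2) * ennreal ((1/4) ^ j) = ennreal (2 ^ j / 2 * (1/4) ^ j)"
        by (rule ennreal_mult[symmetric]) simp_all
      then show ?thesis by (simp only:) (rule ennreal_plus[symmetric], simp_all)
    qed
    also have "2 ^ j / 2 * (1/4) ^ j + (1/2) ^ j / 2 = ((1/2) ^ j :: real)"
    proof -
      have "2 ^ j * (1/4) ^ j = ((1/2) ^ j :: real)" by (simp flip: power_mult_distrib)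
      then show ?thesis by simp
    qed
    finally show ?thesis .
  qed
  then have "(\<integral>\<^sup>+ x. (\<Sum>j. ennreal (d j x)) \<partial>M) \<le> (\<Sum>j. ennreal ((1/2) ^ j))"
    by (subst nn_integral_suminf) (auto intro!: suminf_le)
  also have "\<dots> = ennreal (\<Sum>j. (1/2) ^ j)"
    by (rule suminf_ennreal2) (auto intro!: summable_geometric)
  also have "\<dots> < \<infinity>" by simp
  finally have "(\<integral>\<^sup>+ x. (\<Sum>j. ennreal (d j x)) \<partial>M) \<noteq> \<infinity>" by simp
  then have "AE x in M. (\<Sum>j. ennreal (d j x)) \<noteq> \<infinity>"
    by (intro nn_integral_PInf_AE) auto
  then show ?thesis
  proof eventually_elim
    case (elim x)
    then have "summable (\<lambda>j. d j x)"
      by (intro summable_suminf_not_top) (auto simp: d_def)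
    then have "summable (\<lambda>j. S (Suc j) x - S j x)"
      unfolding d_def by (rule summable_norm_cancel)
    then have "convergent (\<lambda>n. \<Sum>j<n. S (Suc j) x - S j x)"
      by (simp add: summable_iff_convergent)
    then have "convergent (\<lambda>n. S n x - S 0 x)"
      by (simp only: sum_lessThan_telescope[of "\<lambda>j. S j x"])
    from convergent_add[OF this convergent_const[of "S 0 x"]] show ?case by simp
  qed
qed

text \<open>Fatou's lemma for squared norms. The threshold \<open>J\<close> admits bounds that hold
  only along the tail, as for differences from a fixed member of the sequence.\<close>

lemma L2_Fatou:
  fixes S :: "nat \<Rightarrow> 'a \<Rightarrow> 'b :: {banach, second_countable_topology}"
  assumes [measurable]: "\<And>j. S j \<in> borel_measurable M"
    and lim: "AE x in M. (\<lambda>j. S j x) \<longlonglongrightarrow> u x" "u \<in> borel_measurable M"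
    and le: "\<And>j. J \<le> j \<Longrightarrow> (\<integral>\<^sup>+ x. ennreal ((norm (S j x))\<^sup>2) \<partial>M) \<le> c"
  shows "(\<integral>\<^sup>+ x. ennreal ((norm (u x))\<^sup>2) \<partial>M) \<le> c"
proof -
  have "(\<integral>\<^sup>+ x. ennreal ((norm (u x))\<^sup>2) \<partial>M) = (\<integral>\<^sup>+ x. liminf (\<lambda>j. ennreal ((norm (S j x))\<^sup>2)) \<partial>M)"
  proof (rule nn_integral_cong_AE)
    show "AE x in M. ennreal ((norm (u x))\<^sup>2) = liminf (\<lambda>j. ennreal ((norm (S j x))\<^sup>2))"
      using lim(1)
    proof eventually_elim
      case (elim x)
      then have "(\<lambda>j. ennreal ((norm (S j x))\<^sup>2)) \<longlonglongrightarrow> ennreal ((norm (u x))\<^sup>2)"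
        by (intro tendsto_intros)
      then show ?case by (intro lim_imp_Liminf[symmetric]) auto
    qed
  qed
  also have "\<dots> \<le> liminf (\<lambda>j. \<integral>\<^sup>+ x. ennreal ((norm (S j x))\<^sup>2) \<partial>M)"
    by (rule nn_integral_liminf) measurable
  also have "\<dots> \<le> limsup (\<lambda>j. \<integral>\<^sup>+ x. ennreal ((norm (S j x))\<^sup>2) \<partial>M)"
    by (rule Liminf_le_Limsup) simp
  also have "\<dots> \<le> c"
    by (rule Limsup_bounded) (use le in \<open>auto simp: eventually_sequentially\<close>)
  finally show ?thesis .
qed

section \<open>The algebra of pairs and its involutions\<close>

lemma borel_measurable_fst_snd [measurable (raw)]:
  fixes u :: "'a \<Rightarrow> 'b :: second_countable_topology \<times> 'c :: second_countable_topology"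
  assumes "u \<in> borel_measurable M"
  shows "(\<lambda>t. fst (u t)) \<in> borel_measurable M" "(\<lambda>t. snd (u t)) \<in> borel_measurable M"
  by (intro measurable_compose[OF assms] borel_measurable_continuous_onI continuous_intros)+

text \<open>The pair \<open>(b, c)\<close> stands for \<open>b + \<iota> c\<close> in \<open>H \<otimes> C\<close> with a central imaginary unit \<open>\<iota>\<close>; it
  represents
  the function \<open>I \<mapsto> b + I * c\<close> on a sphere. The map \<open>padj\<close> is the adjoint of \<open>H \<otimes> C\<close> viewed as the
    algebra of
  complex two-by-two matrices, whereas \<open>pcnj\<close> fixes \<open>\<iota>\<close> and corresponds to the adjugate.\<close>

definition pmul :: "quat \<times> quat \<Rightarrow> quat \<times> quat \<Rightarrow> quat \<times> quat" (infixl \<open>\<odot>\<close> 70) where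
  "x \<odot> y = (fst x * fst y - snd x * snd y, snd x * fst y + fst x * snd y)"

definition pcnj :: "quat \<times> quat \<Rightarrow> quat \<times> quat" where
  "pcnj x = (qcnj (fst x), qcnj (snd x))"

text \<open>Conjugation of the central unit: the effect on a pair of replacing \<open>I\<close> by
  \<open>- I\<close> on its sphere.\<close>

definition pflip :: "quat \<times> quat \<Rightarrow> quat \<times> quat" where
  "pflip x = (fst x, - snd x)"

definition padj :: "quat \<times> quat \<Rightarrow> quat \<times> quat" where
  "padj x = (qcnj (fst x), - qcnj (snd x))"

text \<open>The pair of the monomial \<open>q powi n * \<alpha>\<close> on the sphere with angle
  \<open>t\<close>: a central exponential times a constant.\<close>

definition pexp :: "int \<Rightarrow> quat \<Rightarrow> real \<Rightarrow> quat \<times> quat" where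
  "pexp n \<alpha> t = (cos (of_int n * t) *\<^sub>R \<alpha>, sin (of_int n * t) *\<^sub>R \<alpha>)"

lemma pmul_assoc: "(x \<odot> y) \<odot> z = x \<odot> (y \<odot> z)"
  by (simp add: pmul_def algebra_simps)

lemma pmul_one [simp]: "(1, 0) \<odot> x = x" "x \<odot> (1, 0) = x"
  by (simp_all add: pmul_def)

lemma pmul_zero [simp]: "0 \<odot> x = 0" "x \<odot> 0 = 0"
  by (simp_all add: pmul_def zero_prod_def)

lemma pmul_distrib:
  "(x + y) \<odot> z = x \<odot> z + y \<odot> z" "x \<odot> (y + z) = x \<odot> y + x \<odot> z"
  "(x - y) \<odot> z = x \<odot> z - y \<odot> z" "x \<odot> (y - z) = x \<odot> y - x \<odot> z"
  "(r *\<^sub>R x) \<odot> z = r *\<^sub>R (x \<odot> z)" "x \<odot> (r *\<^sub>R z) = r *\<^sub>R (x \<odot> z)"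
  by (simp_all add: pmul_def algebra_simps prod_eq_iff)

lemma norm_pmul_le: "norm (x \<odot> y) \<le> 2 * (norm x * norm y)"
proof -
  have "norm (x \<odot> y) \<le> norm (fst (x \<odot> y)) + norm (snd (x \<odot> y))"
    unfolding norm_prod_def by (intro order_trans[OF sqrt_sum_squares_le_sum]) auto
  moreover have cs: "norm (fst x) * norm b + norm (snd x) * norm c \<le> norm x * norm (b :: quat,
    c :: quat)" for b c
  proof -
    have "inner (norm (fst x), norm (snd x)) (norm b, norm c) \<le> norm (norm (fst x),
      norm (snd x)) * norm (norm b, norm c)"
      by (rule norm_cauchy_schwarz)
    then show ?thesis by (simp add: norm_prod_def inner_prod_def)
  qed
  have "norm (fst (x \<odot> y)) \<le> norm x * norm y"
    using cs[of "fst y" "snd y"] norm_triangle_ineq4[of "fst x * fst y" "snd x * snd y"]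
    by (simp add: pmul_def norm_mult)
  moreover have "norm (snd (x \<odot> y)) \<le> norm x * norm y"
    using cs[of "snd y" "fst y"] norm_triangle_ineq[of "snd x * fst y" "fst x * snd y"]
    by (simp add: pmul_def norm_mult norm_prod_def add.commute)
  ultimately show ?thesis by linarith
qed

lemma bounded_bilinear_pmul: "bounded_bilinear (\<odot>)"
proof
  show "\<exists>K. \<forall>a b. norm (a \<odot> b) \<le> norm a * norm b * K"
    by (rule exI[of _ 2]) (use norm_pmul_le in \<open>simp add: mult_ac\<close>)
qed (simp_all add: pmul_distrib)

lemma borel_measurable_pmul [measurable (raw)]:
  assumes "f \<in> borel_measurable M" "g \<in> borel_measurable M"
  shows "(\<lambda>x. f x \<odot> g x) \<in> borel_measurable M"
  by (rule borel_measurable_continuous_Pair[OF assms])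
    (intro continuous_intros bounded_bilinear.continuous_on[OF bounded_bilinear_pmul])

lemma continuous_on_qcnj [continuous_intros]:
  "continuous_on S f \<Longrightarrow> continuous_on S (\<lambda>x. qcnj (f x))"
  by (rule bounded_linear.continuous_on[OF bounded_linear_qcnj])

lemma borel_measurable_pcnj [measurable]: "pcnj \<in> borel_measurable borel"
  unfolding pcnj_def by (intro borel_measurable_continuous_onI continuous_intros)

lemma borel_measurable_padj [measurable]: "padj \<in> borel_measurable borel"
  unfolding padj_def by (intro borel_measurable_continuous_onI continuous_intros)

lemma borel_measurable_pexp [measurable]: "pexp n \<alpha> \<in> borel_measurable borel"
  unfolding pexp_def by (intro borel_measurable_continuous_onI continuous_intros)

lemma norm_pcnj [simp]: "norm (pcnj x) = norm x" "norm (padj x) = norm x" "norm (pflip x) = norm x"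
  by (simp_all add: pcnj_def padj_def pflip_def norm_prod_def)

lemma norm_pexp [simp]: "norm (pexp n \<alpha> t) = norm \<alpha>"
  by (simp add: pexp_def norm_prod_def power_mult_distrib flip: distrib_right)

lemma pcnj_pmul: "pcnj (x \<odot> y) = pcnj y \<odot> pcnj x"
  and padj_pmul: "padj (x \<odot> y) = padj y \<odot> padj x"
  and pflip_pmul: "pflip (x \<odot> y) = pflip x \<odot> pflip y"
  and pcnj_pcnj [simp]: "pcnj (pcnj x) = x" and padj_padj [simp]: "padj (padj x) = x"
  and pflip_pflip [simp]: "pflip (pflip x) = x"
  and pflip_pcnj: "pflip (pcnj x) = pcnj (pflip x)"
    and pflip_padj: "pflip (padj x) = padj (pflip x)"
  and padj_pcnj: "padj (pcnj x) = pcnj (padj x)"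
  by (simp_all add: pcnj_def padj_def pflip_def pmul_def)

lemma inner_pmul_left: "inner (x \<odot> y) z = inner y (padj x \<odot> z)"
  by (simp add: inner_prod_def pmul_def padj_def inner_add_left inner_add_right inner_diff_left
      inner_diff_right inner_quat_mult(1))

lemma padj_pexp: "padj (pexp n \<alpha> t) = pexp (- n) (qcnj \<alpha>) t"
  by (simp add: padj_def pexp_def)

lemma pexp_diff: "pexp n (\<alpha> - \<beta>) t = pexp n \<alpha> t - pexp n \<beta> t"
  and pexp_zero [simp]: "pexp n 0 t = 0" and pexp_0: "pexp 0 \<alpha> t = (\<alpha>, 0)"
  by (simp_all add: pexp_def algebra_simps zero_prod_def)

lemma pflip_simps [simp]: "pflip 0 = 0" "pflip (x + y) = pflip x + pflip y"
  "pflip (x - y) = pflip x - pflip y"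
  "pflip (r *\<^sub>R x) = r *\<^sub>R pflip x"
  by (simp_all add: pflip_def prod_eq_iff)

lemma pexp_reflect: "pexp n \<alpha> (2 * pi - t) = pflip (pexp n \<alpha> t)"
proof -
  have "cos (of_int n * (2 * pi - t)) = cos (of_int n * t)"
    "sin (of_int n * (2 * pi - t)) = - sin (of_int n * t)"
    using cos_int_2pin[of n] sin_int_2pin[of n]
    by (simp_all add: right_diff_distrib cos_diff sin_diff mult.commute mult.left_commute)
  then show ?thesis by (simp add: pexp_def pflip_def)
qed

section \<open>Symmetric pairs and their Fourier coefficients\<close>

definition psym :: "(real \<Rightarrow> quat \<times> quat) \<Rightarrow> bool" where
  "psym u \<longleftrightarrow> u \<in> borel_measurable borel \<and> (\<forall>t. u (2 * pi - t) = pflip (u t))"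

text \<open>The first component of the integral of the pair against the central exponential of
  frequency \<open>- n\<close>. The second component integrates \<open>cos\<close> times the odd
  part minus \<open>sin\<close> times the even part, which gives zero for a symmetric pair.\<close>

definition fcoef :: "(real \<Rightarrow> quat \<times> quat) \<Rightarrow> int \<Rightarrow> quat" where
  "fcoef u n = (\<integral>t. cos (of_int n * t) *\<^sub>R fst (u t) + sin (of_int n * t) *\<^sub>R snd (u t) \<partial>circ)"

lemma integrable_fcoef:
  fixes u :: "real \<Rightarrow> quat \<times> quat"
  assumes "integrable circ u"
  shows "integrable circ (\<lambda>t. cos (of_int n * t) *\<^sub>R fst (u t))"
    "integrable circ (\<lambda>t. sin (of_int n * t) *\<^sub>R snd (u t))"
    "integrable circ (\<lambda>t. sin (of_int n * t) *\<^sub>R fst (u t))"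
      "integrable circ (\<lambda>t. cos (of_int n * t) *\<^sub>R snd (u t))"
proof -
  have i: "integrable circ (\<lambda>t. fst (u t))" "integrable circ (\<lambda>t. snd (u t))"
    using assms by (simp_all add: integrable_bounded_linear[OF bounded_linear_fst]
      integrable_bounded_linear[OF bounded_linear_snd])
  show "integrable circ (\<lambda>t. cos (of_int n * t) *\<^sub>R fst (u t))"
    by (rule integrable_circ_bounded[OF i(1), of _ 1]) simp_all
  show "integrable circ (\<lambda>t. sin (of_int n * t) *\<^sub>R snd (u t))"
    by (rule integrable_circ_bounded[OF i(2), of _ 1]) simp_all
  show "integrable circ (\<lambda>t. sin (of_int n * t) *\<^sub>R fst (u t))"
    by (rule integrable_circ_bounded[OF i(1), of _ 1]) simp_all
  show "integrable circ (\<lambda>t. cos (of_int n * t) *\<^sub>R snd (u t))"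
    by (rule integrable_circ_bounded[OF i(2), of _ 1]) simp_all
qed

lemma fcoef_split:
  assumes "integrable circ u"
  shows "fcoef u n = (\<integral>t. cos (of_int n * t) *\<^sub>R fst (u t) \<partial>circ)
    + (\<integral>t. sin (of_int n * t) *\<^sub>R snd (u t) \<partial>circ)"
  unfolding fcoef_def by (intro Bochner_Integration.integral_add integrable_fcoef assms)

lemma fcoef_add: "integrable circ u \<Longrightarrow> integrable circ v
  \<Longrightarrow> fcoef (\<lambda>t. u t + v t) n = fcoef u n + fcoef v n"
  and fcoef_diff: "integrable circ u \<Longrightarrow> integrable circ v
    \<Longrightarrow> fcoef (\<lambda>t. u t - v t) n = fcoef u n - fcoef v n"
  by (simp_all add: fcoef_split integrable_fcoef scaleR_add_right scaleR_diff_right)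

lemma fcoef_cong_AE:
  assumes "AE t in circ. u t = v t" "u \<in> borel_measurable borel" "v \<in> borel_measurable borel"
  shows "fcoef u n = fcoef v n"
  unfolding fcoef_def
proof (rule integral_cong_AE)
  show "AE t in circ. cos (of_int n * t) *\<^sub>R fst (u t) + sin (of_int n * t) *\<^sub>R snd (u t)
      = cos (of_int n * t) *\<^sub>R fst (v t) + sin (of_int n * t) *\<^sub>R snd (v t)"
    using assms(1) by eventually_elim simp
qed (use assms(2,3) borel_measurable_fst_snd[OF assms(2)] borel_measurable_fst_snd[OF assms(3)] in
    \<open>auto intro!: borel_measurable_add borel_measurable_scaleR\<close>)

lemma eq_minus_self:
  fixes x :: "'a :: real_vector"
  assumes "- x = x"
  shows "x = 0"
proof -
  have "x + x = x + - x" unfolding assms ..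
  then have "2 *\<^sub>R x = 0" by (simp add: scaleR_2)
  then show ?thesis by simp
qed

text \<open>The coefficients at \<open>n\<close> and \<open>- n\<close> are the sum and the
  difference of the cosine moment of the even part and the sine moment of the odd part, so both
  moments vanish. The two remaining moments vanish by reflection.\<close>

lemma fcoef_unique_0:
  assumes u: "integrable circ u" and sym: "psym u" and z: "\<And>n. fcoef u n = 0"
  shows "AE t in circ. u t = 0"
proof -
  have [measurable]: "u \<in> borel_measurable borel" using sym by (simp add: psym_def)
  note [measurable] = borel_measurable_fst_snd[OF this]
  have r: "fst (u (2 * pi - t)) = fst (u t)" "snd (u (2 * pi - t)) = - snd (u t)" for t
    using sym by (auto simp: psym_def pflip_def)
  have cs: "cos (of_int n * (2 * pi - t)) = cos (of_int n * t)"
    "sin (of_int n * (2 * pi - t)) = - sin (of_int n * t)" for n :: int and t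
    using arg_cong[OF pexp_reflect[of n 1 t], of "\<lambda>x. qRe (fst x)"]
      arg_cong[OF pexp_reflect[of n 1 t], of "\<lambda>x. qRe (snd x)"]
    by (simp_all add: pexp_def pflip_def)
  note i = integrable_fcoef[OF u]
  let ?C = "\<lambda>n::int. \<integral>t. cos (of_int n * t) *\<^sub>R fst (u t) \<partial>circ"
  let ?S = "\<lambda>n::int. \<integral>t. sin (of_int n * t) *\<^sub>R snd (u t) \<partial>circ"
  have 1: "?C n + ?S n = 0" for n using z[of n] fcoef_split[OF u] by simp
  have 2: "?C n - ?S n = 0" for n using 1[of "- n"] by simp
  have C: "?C n = 0" for n
  proof -
    have "2 *\<^sub>R ?C n = (?C n + ?S n) + (?C n - ?S n)" by (simp add: scaleR_2)
    then show ?thesis by (simp only: 1 2) simp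
  qed
  then have S: "?S n = 0" for n using 1[of n] by simp
  have C': "(\<integral>t. sin (of_int n * t) *\<^sub>R fst (u t) \<partial>circ) = 0" for n :: int
  proof -
    have "(\<lambda>t. sin (of_int n * t) *\<^sub>R fst (u t)) \<in> borel_measurable borel" by measurable
    from integral_circ_reflect[OF this] show ?thesis
      by (rule eq_minus_self[OF trans[rotated]]) (simp only: r cs scaleR_minus_left
        scaleR_minus_right integral_minus)
  qed
  have S': "(\<integral>t. cos (of_int n * t) *\<^sub>R snd (u t) \<partial>circ) = 0" for n :: int
  proof -
    have "(\<lambda>t. cos (of_int n * t) *\<^sub>R snd (u t)) \<in> borel_measurable borel" by measurable
    from integral_circ_reflect[OF this] show ?thesis
      by (rule eq_minus_self[OF trans[rotated]]) (simp only: r cs scaleR_minus_left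
        scaleR_minus_right integral_minus)
  qed
  have "AE t in circ. fst (u t) = 0"
    by (rule Fourier_unique) (use integrable_bounded_linear[OF bounded_linear_fst u] C C' in auto)
  moreover have "AE t in circ. snd (u t) = 0"
    by (rule Fourier_unique) (use integrable_bounded_linear[OF bounded_linear_snd u] S S' in auto)
  ultimately show ?thesis by eventually_elim (simp add: prod_eq_iff)
qed

lemma fcoef_unique:
  assumes "integrable circ u" "psym u" "integrable circ v" "psym v" "\<And>n. fcoef u n = fcoef v n"
  shows "AE t in circ. u t = v t"
proof -
  have "AE t in circ. u t - v t = 0"
    by (rule fcoef_unique_0) (use assms in \<open>auto simp: fcoef_diff psym_def\<close>)
  then show ?thesis by eventually_elim simp
qed

lemma fcoef_pexp: "fcoef (pexp m \<alpha>) n = (if n = m then \<alpha> else 0)"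
proof -
  have "fcoef (pexp m \<alpha>) n = (\<integral>t. cos (of_int (n - m) * t) *\<^sub>R \<alpha> \<partial>circ)"
    unfolding fcoef_def pexp_def by (simp add: cos_diff left_diff_distrib scaleR_add_left)
  also have "\<dots> = (\<integral>t. cos (of_int (n - m) * t) \<partial>circ) *\<^sub>R \<alpha>"
    by (rule integral_scaleR_left)
      (use integrable_circ_bounded[of "\<lambda>_. 1::real" "\<lambda>t. cos (of_int (n - m) * t)" 1] in simp)
  finally show ?thesis unfolding integral_cos_circ by auto
qed

section \<open>The Riesz--Fischer theorem\<close>

definition sqf :: "(real \<Rightarrow> quat \<times> quat) \<Rightarrow> bool" where
  "sqf u \<longleftrightarrow> psym u \<and> integrable circ (\<lambda>t. (norm (u t))\<^sup>2)"

lemma psym_measurable: "psym u \<Longrightarrow> u \<in> borel_measurable borel"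
  by (simp add: psym_def)

lemma sqf_psym: "sqf u \<Longrightarrow> psym u"
  by (simp add: sqf_def)

lemma sqf_measurable: "sqf u \<Longrightarrow> u \<in> borel_measurable borel"
  by (simp add: sqf_def psym_def)

lemma psym_intros:
  "psym u \<Longrightarrow> psym v \<Longrightarrow> psym (\<lambda>t. u t + v t)"
  "psym u \<Longrightarrow> psym v \<Longrightarrow> psym (\<lambda>t. u t - v t)"
  "psym u \<Longrightarrow> psym (\<lambda>t. r *\<^sub>R u t)"
  "psym u \<Longrightarrow> psym v \<Longrightarrow> psym (\<lambda>t. u t \<odot> v t)"
  "psym u \<Longrightarrow> psym (\<lambda>t. pcnj (u t))"
  "psym u \<Longrightarrow> psym (\<lambda>t. padj (u t))"
  "psym (pexp n \<alpha>)"
  by (auto simp: psym_def pflip_pmul pflip_pcnj pflip_padj pexp_reflect)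

lemma sqf_integrable:
  assumes "sqf u" shows "integrable circ u"
proof (rule Bochner_Integration.integrable_bound)
  show "integrable circ (\<lambda>t. 1 + (norm (u t))\<^sup>2)" using assms by (simp add: sqf_def)
  have "x \<le> 1 + x\<^sup>2" for x :: real
    using zero_le_power2[of "x - 1"] zero_le_power2[of x]
    unfolding power2_diff one_power2 mult_1_right by linarith
  then have "norm (u t) \<le> norm (1 + (norm (u t))\<^sup>2)" for t
    by (rule order_trans) simp
  then show "AE t in circ. norm (u t) \<le> norm (1 + (norm (u t))\<^sup>2)" by blast
qed (use sqf_measurable[OF assms] in simp)

lemma sqf_bound:
  assumes "psym v" "sqf u" and le: "AE t in circ. norm (v t) \<le> c * norm (u t)"
  shows "sqf v"
  unfolding sqf_def
proof (rule conjI[OF assms(1)], rule Bochner_Integration.integrable_bound)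
  show "integrable circ (\<lambda>t. c\<^sup>2 * (norm (u t))\<^sup>2)" using assms(2) by (simp add: sqf_def)
  show "AE t in circ. norm ((norm (v t))\<^sup>2) \<le> norm (c\<^sup>2 * (norm (u t))\<^sup>2)"
    using le
  proof eventually_elim
    case (elim t)
    have "(norm (v t))\<^sup>2 \<le> (c * norm (u t))\<^sup>2" by (intro power_mono elim) simp
    then show ?case by (simp add: power_mult_distrib)
  qed
qed (use psym_measurable[OF assms(1)] in simp)

lemma sqf_bounded: "psym v \<Longrightarrow> (AE t in circ. norm (v t) \<le> c) \<Longrightarrow> sqf v"
  by (rule sqf_bound[where u = "pexp 0 1" and c = c])
    (simp_all add: sqf_def psym_intros)

lemma sqf_pexp: "sqf (pexp n \<alpha>)"
  by (rule sqf_bounded[of _ "norm \<alpha>"]) (simp_all add: psym_intros)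

lemma sqf_add: assumes "sqf u" "sqf v" shows "sqf (\<lambda>t. u t + v t)"
  unfolding sqf_def
proof (rule conjI[OF psym_intros(1)[OF sqf_psym[OF assms(1)] sqf_psym[OF assms(2)]]],
    rule Bochner_Integration.integrable_bound)
  show "integrable circ (\<lambda>t. 2 * (norm (u t))\<^sup>2 + 2 * (norm (v t))\<^sup>2)" using assms
    by (simp add: sqf_def)
  show "AE t in circ. norm ((norm (u t + v t))\<^sup>2) \<le> norm (2 * (norm (u t))\<^sup>2 + 2 * (norm (v t))\<^sup>2)"
    by (intro AE_I2) (simp add: norm_add_squared_le)
qed (use sqf_measurable[OF assms(1)] sqf_measurable[OF assms(2)] in simp)

lemma sqf_scaleR: "sqf u \<Longrightarrow> sqf (\<lambda>t. r *\<^sub>R u t)"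
  by (rule sqf_bound[where u = u and c = "\<bar>r\<bar>"]) (simp_all add: psym_intros sqf_psym)

lemma sqf_diff: "sqf u \<Longrightarrow> sqf v \<Longrightarrow> sqf (\<lambda>t. u t - v t)"
  using sqf_add[of u "\<lambda>t. (-1) *\<^sub>R v t"] sqf_scaleR[of v "-1"] by simp

lemma sqf_pcnj: "sqf u \<Longrightarrow> sqf (\<lambda>t. pcnj (u t))" and sqf_padj: "sqf u \<Longrightarrow> sqf (\<lambda>t. padj (u t))"
  by (auto simp: sqf_def psym_intros)

lemma sqf_sum: "(\<And>n. n \<in> N \<Longrightarrow> sqf (f n)) \<Longrightarrow> sqf (\<lambda>t. \<Sum>n\<in>N. f n t)"
proof (induction N rule: infinite_finite_induct)
  case (insert n N)
  then show ?case using sqf_add[of "f n" "\<lambda>t. \<Sum>n\<in>N. f n t"] by simp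
qed (use sqf_bounded[of "\<lambda>_. 0" 0] in \<open>simp_all add: psym_def\<close>)

lemma integrable_mult_norm:
  assumes u: "sqf u" and v: "sqf v"
  shows "integrable circ (\<lambda>t. norm (u t) * norm (v t))"
proof (rule Bochner_Integration.integrable_bound)
  show "integrable circ (\<lambda>t. (norm (u t))\<^sup>2 + (norm (v t))\<^sup>2)" using assms by (simp add: sqf_def)
  show "AE t in circ. norm (norm (u t) * norm (v t)) \<le> norm ((norm (u t))\<^sup>2 + (norm (v t))\<^sup>2)"
  proof (rule AE_I2)
    fix t
    have "norm (u t) * norm (v t) \<le> (norm (u t))\<^sup>2 + (norm (v t))\<^sup>2"
      using zero_le_power2[of "norm (u t) - norm (v t)"]
        mult_nonneg_nonneg[OF norm_ge_zero norm_ge_zero, of "u t" "v t"]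
      unfolding power2_diff by linarith
    then show "norm (norm (u t) * norm (v t)) \<le> norm ((norm (u t))\<^sup>2 + (norm (v t))\<^sup>2)"
      by simp
  qed
qed (use sqf_measurable[OF assms(1)] sqf_measurable[OF assms(2)] in simp)

lemma integrable_inner_sqf:
  assumes u: "sqf u" and v: "sqf v"
  shows "integrable circ (\<lambda>t. inner (u t) (v t))"
proof (rule Bochner_Integration.integrable_bound[OF integrable_mult_norm[OF u v]])
  show "AE t in circ. norm (inner (u t) (v t)) \<le> norm (norm (u t) * norm (v t))"
    by (intro AE_I2) (simp add: Cauchy_Schwarz_ineq2)
qed (use sqf_measurable[OF assms(1)] sqf_measurable[OF assms(2)] in simp)

lemma integrable_pmul:
  assumes u: "sqf u" and v: "sqf v"
  shows "integrable circ (\<lambda>t. u t \<odot> v t)"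
proof (rule Bochner_Integration.integrable_bound)
  show "integrable circ (\<lambda>t. 2 * (norm (u t) * norm (v t)))" using integrable_mult_norm[OF u v]
    by simp
  show "AE t in circ. norm (u t \<odot> v t) \<le> norm (2 * (norm (u t) * norm (v t)))"
    by (intro AE_I2) (simp add: norm_pmul_le)
qed (use sqf_measurable[OF assms(1)] sqf_measurable[OF assms(2)] in simp)

lemma integral_inner_pexp:
  assumes "integrable circ u"
  shows "(\<integral>t. inner (u t) (pexp n \<alpha> t) \<partial>circ) = inner (fcoef u n) \<alpha>"
proof -
  have "inner (u t) (pexp n \<alpha> t) = inner (cos (of_int n * t) *\<^sub>R fst (u t)
    + sin (of_int n * t) *\<^sub>R snd (u t)) \<alpha>" for t
    by (simp add: pexp_def inner_prod_def inner_add_left)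
  moreover have "integrable circ (\<lambda>t. cos (of_int n * t) *\<^sub>R fst (u t)
    + sin (of_int n * t) *\<^sub>R snd (u t))"
    using integrable_fcoef[OF assms] by simp
  ultimately show ?thesis unfolding fcoef_def by (simp add: integral_inner_left)
qed

definition ptrig :: "int set \<Rightarrow> (int \<Rightarrow> quat) \<Rightarrow> real \<Rightarrow> quat \<times> quat" where
  "ptrig N c t = (\<Sum>n\<in>N. pexp n (c n) t)"

lemma sqf_ptrig: "sqf (ptrig N c)"
  unfolding ptrig_def[abs_def] by (rule sqf_sum) (rule sqf_pexp)

lemma integral_inner_ptrig:
  assumes "sqf u"
  shows "(\<integral>t. inner (u t) (ptrig N c t) \<partial>circ) = (\<Sum>n\<in>N. inner (fcoef u n) (c n))"
  unfolding ptrig_def inner_sum_right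
  by (subst Bochner_Integration.integral_sum)
    (simp_all add: integrable_inner_sqf assms sqf_pexp integral_inner_pexp sqf_integrable)

lemma fcoef_ptrig:
  assumes "finite N"
  shows "fcoef (ptrig N c) n = (if n \<in> N then c n else 0)"
proof (rule vector_eq_rdot[THEN iffD1], rule allI)
  fix \<alpha> :: quat
  have "inner (fcoef (ptrig N c) n) \<alpha> = (\<integral>t. inner (pexp n \<alpha> t) (ptrig N c t) \<partial>circ)"
    by (subst integral_inner_pexp[symmetric]) (simp_all add: sqf_ptrig sqf_integrable inner_commute)
  also have "\<dots> = (\<Sum>m\<in>N. if m = n then inner \<alpha> (c m) else 0)"
    unfolding integral_inner_ptrig[OF sqf_pexp] fcoef_pexp by (intro sum.cong) auto
  also have "\<dots> = inner (if n \<in> N then c n else 0) \<alpha>"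
    using assms by (simp add: inner_commute)
  finally show "inner (fcoef (ptrig N c) n) \<alpha> = inner (if n \<in> N then c n else 0) \<alpha>" .
qed

lemma integral_norm_ptrig:
  assumes "finite N"
  shows "(\<integral>t. (norm (ptrig N c t))\<^sup>2 \<partial>circ) = (\<Sum>n\<in>N. (norm (c n))\<^sup>2)"
  using integral_inner_ptrig[OF sqf_ptrig, of N c N c] fcoef_ptrig[OF assms, of c]
  by (simp add: power2_norm_eq_inner)

text \<open>Bessel's inequality, from the squared distance between \<open>u\<close> and its partial
  sum over \<open>N\<close>.\<close>

lemma sum_norm_fcoef_le:
  assumes "sqf u" "finite N"
  shows "(\<Sum>n\<in>N. (norm (fcoef u n))\<^sup>2) \<le> (\<integral>t. (norm (u t))\<^sup>2 \<partial>circ)"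
proof -
  let ?p = "ptrig N (fcoef u)"
  have "0 \<le> (\<integral>t. (norm (u t - ?p t))\<^sup>2 \<partial>circ)" by simp
  also have "\<dots> = (\<integral>t. (norm (u t))\<^sup>2 - 2 * inner (u t) (?p t) + (norm (?p t))\<^sup>2 \<partial>circ)"
    by (simp add: power2_norm_eq_inner inner_diff_left inner_diff_right inner_commute algebra_simps)
  also have "\<dots> = (\<integral>t. (norm (u t))\<^sup>2 \<partial>circ) - 2 * (\<integral>t. inner (u t) (?p t) \<partial>circ)
    + (\<integral>t. (norm (?p t))\<^sup>2 \<partial>circ)"
    using assms(1) sqf_ptrig[of N "fcoef u"] integrable_inner_sqf[OF assms(1) sqf_ptrig]
    by (simp add: sqf_def)
  also have "\<dots> = (\<integral>t. (norm (u t))\<^sup>2 \<partial>circ) - (\<Sum>n\<in>N. (norm (fcoef u n))\<^sup>2)"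
    unfolding integral_inner_ptrig[OF assms(1)] integral_norm_ptrig[OF assms(2)]
    by (simp add: power2_norm_eq_inner)
  finally show ?thesis by simp
qed

text \<open>Meaningful for \<open>sqf u\<close>, where Bessel's inequality makes the coefficients
  square-summable; elsewhere \<open>Abs_l2\<close> may be applied outside its domain.\<close>

definition fourier :: "(real \<Rightarrow> quat \<times> quat) \<Rightarrow> l2" where
  "fourier u = Abs_l2 (fcoef u)"

lemma cf_fourier:
  assumes "sqf u" shows "cf (fourier u) n = fcoef u n"
proof -
  have "(\<lambda>n. (norm (fcoef u n))\<^sup>2) summable_on UNIV"
    by (rule nonneg_bdd_above_summable_on) (auto intro!: bdd_aboveI2 sum_norm_fcoef_le assms)
  then show ?thesis by (simp add: fourier_def Abs_l2_inverse)
qed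

section \<open>Monomials and truncated sequences\<close>

lemma square_summable_finite_support:
  fixes a :: "int \<Rightarrow> quat"
  assumes "finite N" "\<And>n. n \<notin> N \<Longrightarrow> a n = 0"
  shows "(\<lambda>n. (norm (a n))\<^sup>2) summable_on UNIV"
  using summable_on_cong_neutral[of N UNIV "\<lambda>n. (norm (a n))\<^sup>2" "\<lambda>n. (norm (a n))\<^sup>2"] assms by auto

lift_definition single :: "int \<Rightarrow> quat \<Rightarrow> l2" is "\<lambda>n \<alpha> k. if k = n then \<alpha> else 0"
  by (rule square_summable_finite_support[of "{_}"]) auto

lemma cf_single [simp]: "cf (single n \<alpha>) k = (if k = n then \<alpha> else 0)"
  by transfer simp

lemma cf_sum [simp]: "cf (\<Sum>n\<in>N. f n) k = (\<Sum>n\<in>N. cf (f n) k)"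
  by (rule bounded_linear.linear[OF bounded_linear_cf, THEN linear_sum])

definition trunc :: "int set \<Rightarrow> l2 \<Rightarrow> l2" where
  "trunc N a = (\<Sum>n\<in>N. single n (cf a n))"

lemma cf_trunc [simp]: "finite N \<Longrightarrow> cf (trunc N a) k = (if k \<in> N then cf a k else 0)"
  by (simp add: trunc_def if_distrib cong: if_cong)

lemma inner_single: "inner a (single n \<alpha>) = inner (cf a n) \<alpha>"
proof -
  have "((\<lambda>k. inner (cf a k) (cf (single n \<alpha>) k)) has_sum inner (cf a n) \<alpha>) UNIV"
    by (rule has_sum_finite_neutralI[of "{n}"]) auto
  then show ?thesis using has_sum_inner_l2 has_sum_unique by blast
qed

lemma norm_single [simp]: "norm (single n \<alpha>) = norm \<alpha>"
  by (simp add: norm_eq_sqrt_inner inner_single)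

lemma norm_diff_trunc:
  assumes "finite N"
  shows "(norm (a - trunc N a))\<^sup>2 = (norm a)\<^sup>2 - (\<Sum>n\<in>N. (norm (cf a n))\<^sup>2)"
proof -
  have "inner b (trunc N a) = (\<Sum>n\<in>N. inner (cf b n) (cf a n))" for b
    by (simp add: trunc_def inner_sum_right inner_single)
  then have "inner a (trunc N a) = (\<Sum>n\<in>N. (norm (cf a n))\<^sup>2)"
    "inner (trunc N a) (trunc N a) = (\<Sum>n\<in>N. (norm (cf a n))\<^sup>2)"
    using assms by (simp_all add: power2_norm_eq_inner)
  then show ?thesis
    by (simp add: power2_norm_eq_inner inner_diff_left inner_diff_right inner_commute)
qed

lemma tendsto_trunc: "((\<lambda>N. trunc N a) \<longlongrightarrow> a) (finite_subsets_at_top UNIV)"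
proof -
  have "((\<lambda>N. \<Sum>n\<in>N. (norm (cf a n))\<^sup>2) \<longlongrightarrow> (norm a)\<^sup>2) (finite_subsets_at_top UNIV)"
    using has_sum_norm_l2 unfolding has_sum_def .
  from tendsto_diff[OF tendsto_const this, of "(norm a)\<^sup>2"]
  have "((\<lambda>N. (norm a)\<^sup>2 - (\<Sum>n\<in>N. (norm (cf a n))\<^sup>2)) \<longlongrightarrow> 0) (finite_subsets_at_top UNIV)" by simp
  then have "((\<lambda>N. (norm (a - trunc N a))\<^sup>2) \<longlongrightarrow> 0) (finite_subsets_at_top UNIV)"
    by (rule Lim_transform_eventually)
      (auto simp: norm_diff_trunc eventually_finite_subsets_at_top)
  from tendsto_real_sqrt[OF this]
  have "((\<lambda>N. dist (trunc N a) a) \<longlongrightarrow> 0) (finite_subsets_at_top UNIV)"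
    by (simp add: dist_norm norm_minus_commute)
  then show ?thesis by (rule tendsto_dist_iff[THEN iffD2])
qed

lemma trunc_approx:
  assumes "0 < e" obtains N where "finite N" "norm (a - trunc N a) < e"
proof -
  have "\<forall>\<^sub>F N in finite_subsets_at_top UNIV. dist (trunc N a) a < e"
    using tendsto_trunc assms by (rule tendstoD)
  then show ?thesis using that
    by (auto simp: eventually_finite_subsets_at_top dist_norm norm_minus_commute)
qed

lemma nn_integral_norm_sqf:
  assumes "sqf u"
  shows "(\<integral>\<^sup>+ t. ennreal ((norm (u t))\<^sup>2) \<partial>circ) = ennreal (\<integral>t. (norm (u t))\<^sup>2 \<partial>circ)"
  by (rule nn_integral_eq_integral) (use assms in \<open>auto simp: sqf_def\<close>)

lemma sqf_nn_integralI:
  assumes "psym u" "(\<integral>\<^sup>+ t. ennreal ((norm (u t))\<^sup>2) \<partial>circ) \<le> ennreal c" "0 \<le> c"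
  shows "sqf u" "(\<integral>t. (norm (u t))\<^sup>2 \<partial>circ) \<le> c"
proof -
  have "integrable circ (\<lambda>t. (norm (u t))\<^sup>2)"
    by (rule integrableI_bounded)
      (use psym_measurable[OF assms(1)] assms(2) in \<open>auto intro: le_less_trans\<close>)
  then show s: "sqf u" using assms(1) by (simp add: sqf_def)
  show "(\<integral>t. (norm (u t))\<^sup>2 \<partial>circ) \<le> c"
    using assms(2,3) by (simp add: nn_integral_norm_sqf[OF s])
qed

text \<open>Partial sums over finite sets that exhaust \<open>a\<close> fast enough converge almost
  everywhere; Fatou's lemma bounds the limit and identifies its coefficients. The norm identity is
  included because Parseval's identity is derived from it.\<close>

theorem Riesz_Fischer:
  obtains u where "sqf u" "fourier u = a" "(\<integral>t. (norm (u t))\<^sup>2 \<partial>circ) = (norm a)\<^sup>2"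
proof -
  \<comment> \<open>Half of \<open>(1/2) ^ j\<close>, so that two tails together stay below
    \<open>(1/2) ^ j\<close>, whose square is the rate required by \<open>L2_limit\<close>.\<close>
  have "\<exists>N. finite N \<and> norm (a - trunc N a) < (1/2) ^ j / 2" for j
    by (rule trunc_approx[of "(1/2) ^ j / 2" a]) auto
  then obtain F where F: "\<And>j. finite (F j)" "\<And>j. norm (a - trunc (F j) a) < (1/2) ^ j / 2" by metis
  define S where "S = (\<lambda>j. ptrig (F j) (cf a))"
  have sS: "sqf (S j)" for j unfolding S_def by (rule sqf_ptrig)
  note [measurable] = sqf_measurable[OF sS]
  have diff: "(\<integral>\<^sup>+ t. ennreal ((norm (S k t - S j t))\<^sup>2) \<partial>circ) \<le> ennreal (((1/2) ^ j)\<^sup>2)"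
    if "j \<le> k" for j k
  proof -
    define c where "c = cf (trunc (F k) a - trunc (F j) a)"
    have "S k t - S j t = ptrig (F k \<union> F j) c t" for t
    proof -
      have "S i t = (\<Sum>n\<in>F k \<union> F j. pexp n (cf (trunc (F i) a) n) t)" if "i = k \<or> i = j" for i
        unfolding S_def ptrig_def using that F(1) by (intro sum.mono_neutral_cong_left) auto
      then show ?thesis by (simp add: ptrig_def c_def pexp_diff sum_subtractf)
    qed
    then have "(\<integral>\<^sup>+ t. ennreal ((norm (S k t - S j t))\<^sup>2) \<partial>circ)
      = ennreal (\<Sum>n\<in>F k \<union> F j. (norm (c n))\<^sup>2)"
      using nn_integral_norm_sqf[OF sqf_ptrig, of "F k \<union> F j" c] F(1)
        by (simp add: integral_norm_ptrig)
    also have "\<dots> \<le> ennreal ((norm (trunc (F k) a - trunc (F j) a))\<^sup>2)"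
      unfolding c_def using F(1) by (intro ennreal_leI sum_norm_cf_le) auto
    also have "\<dots> \<le> ennreal (((1/2) ^ j)\<^sup>2)"
    proof (intro ennreal_leI power_mono)
      have "norm (trunc (F k) a - trunc (F j) a)
        \<le> norm (a - trunc (F j) a) + norm (a - trunc (F k) a)"
        by (metis norm_triangle_ineq4 diff_diff_eq2 diff_add_cancel add_diff_cancel_left'
          diff_diff_add)
      also have "\<dots> \<le> (1/2) ^ j / 2 + (1/2) ^ k / 2" using F(2) by (intro add_mono less_imp_le)
      also have "\<dots> \<le> (1/2) ^ j"
      proof -
        have "(1/2) ^ k \<le> ((1/2) ^ j :: real)" by (rule power_decreasing[OF that]) auto
        then show ?thesis by linarith
      qed
      finally show "norm (trunc (F k) a - trunc (F j) a) \<le> (1/2) ^ j" .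
    qed simp
    finally show ?thesis .
  qed
  have conv: "AE t in circ. convergent (\<lambda>j. S j t)"
  proof (rule L2_limit)
    show "(\<integral>\<^sup>+ t. ennreal ((norm (S (Suc j) t - S j t))\<^sup>2) \<partial>circ) \<le> ennreal ((1/4) ^ j)" for j
    proof -
      have "((1/2) ^ j)\<^sup>2 = ((1/4) ^ j :: real)"
        by (simp add: power2_eq_square flip: power_mult_distrib)
      then show ?thesis using diff[of j "Suc j"] by simp
    qed
  qed (auto simp: circ.prob_space_axioms)
  \<comment> \<open>The value 0 where the sums diverge keeps the symmetry at every angle, because
    the set of divergence is invariant under the reflection.\<close>
  define u where "u = (\<lambda>t. if convergent (\<lambda>j. S j t) then lim (\<lambda>j. S j t) else 0)"
  have lim: "(\<lambda>j. S j t) \<longlonglongrightarrow> u t" if "convergent (\<lambda>j. S j t)" for t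
    using that by (simp add: u_def convergent_LIMSEQ_iff)
  have um: "u \<in> borel_measurable borel"
  proof -
    have "{t \<in> space borel. Cauchy (\<lambda>j. S j t)} \<in> sets borel"
      by (rule sets_Collect_Cauchy) measurable
    then have [measurable]: "Measurable.pred borel (\<lambda>t. convergent (\<lambda>j. S j t))"
      by (simp add: pred_def Cauchy_convergent_iff)
    have "(\<lambda>t. lim (\<lambda>j. S j t)) \<in> borel_measurable borel"
      by (rule borel_measurable_lim_metric) measurable
    then show ?thesis unfolding u_def by measurable
  qed
  have "u (2 * pi - t) = pflip (u t)" for t
  proof -
    have fl: "continuous_on UNIV pflip" unfolding pflip_def by (intro continuous_intros)
    have flc: "(\<lambda>j. pflip (X j)) \<longlonglongrightarrow> pflip L" if "X \<longlonglongrightarrow> L" for X L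
      by (rule continuous_on_tendsto_compose[OF fl that]) auto
    have r: "S j (2 * pi - s) = pflip (S j s)" for j s
      using sS by (auto simp: sqf_def psym_def)
    have c: "convergent (\<lambda>j. S j (2 * pi - s))" if "convergent (\<lambda>j. S j s)" for s
      using that flc unfolding r convergent_def by blast
    show ?thesis
    proof (cases "convergent (\<lambda>j. S j t)")
      case True
      from LIMSEQ_unique[OF lim[OF c[OF True]]] flc[OF lim[OF True]] show ?thesis
        unfolding r by blast
    next
      case False
      then have "\<not> convergent (\<lambda>j. S j (2 * pi - t))" using c[of "2 * pi - t"] by auto
      with False show ?thesis by (simp add: u_def)
    qed
  qed
  with um have pu: "psym u" by (simp add: psym_def)
  have limS: "AE t in circ. (\<lambda>j. S j t) \<longlonglongrightarrow> u t" using conv by eventually_elim (rule lim)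
  have "(\<integral>\<^sup>+ t. ennreal ((norm (u t))\<^sup>2) \<partial>circ) \<le> ennreal ((norm a)\<^sup>2)"
  proof (rule L2_Fatou[OF _ limS])
    show "(\<integral>\<^sup>+ t. ennreal ((norm (S j t))\<^sup>2) \<partial>circ) \<le> ennreal ((norm a)\<^sup>2)" for j
      unfolding nn_integral_norm_sqf[OF sS]
      by (simp add: S_def integral_norm_ptrig F(1) sum_norm_cf_le)
  qed (use um in auto)
  from sqf_nn_integralI[OF pu this] have su: "sqf u"
    and ule: "(\<integral>t. (norm (u t))\<^sup>2 \<partial>circ) \<le> (norm a)\<^sup>2"
    by auto
  have coef: "fcoef u n = cf a n" for n
  proof -
    have bd: "norm (fcoef u n - cf a n) \<le> 2 * (1/2) ^ j" for j
    proof -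
      have sd: "sqf (\<lambda>t. u t - S j t)" by (rule sqf_diff[OF su sS])
      have "(\<integral>\<^sup>+ t. ennreal ((norm (u t - S j t))\<^sup>2) \<partial>circ) \<le> ennreal (((1/2) ^ j)\<^sup>2)"
      proof (rule L2_Fatou[where S = "\<lambda>k t. S k t - S j t" and J = j])
        show "AE t in circ. (\<lambda>k. S k t - S j t) \<longlonglongrightarrow> u t - S j t"
          using limS by eventually_elim (intro tendsto_intros)
      qed (use um diff in auto)
      then have le: "(\<integral>t. (norm (u t - S j t))\<^sup>2 \<partial>circ) \<le> ((1/2) ^ j)\<^sup>2"
        using nn_integral_norm_sqf[OF sd] by simp
      have "(norm (fcoef (\<lambda>t. u t - S j t) n))\<^sup>2 \<le> (\<integral>t. (norm (u t - S j t))\<^sup>2 \<partial>circ)"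
        using sum_norm_fcoef_le[OF sd, of "{n}"] by simp
      from order_trans[OF this le] have "norm (fcoef (\<lambda>t. u t - S j t) n) \<le> (1/2) ^ j"
        by (rule power2_le_imp_le) simp
      moreover have "fcoef (\<lambda>t. u t - S j t) n = fcoef u n - cf (trunc (F j) a) n"
        using F(1) by (simp add: fcoef_diff sqf_integrable su sS) (simp add: S_def fcoef_ptrig)
      moreover have "norm (cf a n - cf (trunc (F j) a) n) \<le> (1/2) ^ j"
        using norm_cf_le[of "a - trunc (F j) a" n] F(2)[of j] norm_ge_zero[of "a - trunc (F j) a"]
        unfolding cf_simps by linarith
      ultimately show ?thesis
        using norm_triangle_sub[of "fcoef u n - cf a n" "fcoef u n - cf (trunc (F j) a) n"]
        by (simp add: norm_minus_commute)
    qed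
    have "(\<lambda>j. 2 * (1/2) ^ j :: real) \<longlonglongrightarrow> 2 * 0"
      by (intro tendsto_intros LIMSEQ_realpow_zero) auto
    from LIMSEQ_le_const[OF this, of "norm (fcoef u n - cf a n)"] bd
    have "norm (fcoef u n - cf a n) \<le> 0" by simp
    then show ?thesis by simp
  qed
  have fa: "fourier u = a" by (rule l2_eqI) (simp add: cf_fourier su coef)
  have "norm a \<le> sqrt (\<integral>t. (norm (u t))\<^sup>2 \<partial>circ)"
    by (rule norm_l2_leI) (use sum_norm_fcoef_le[OF su] in \<open>auto simp: coef\<close>)
  from power_mono[OF this norm_ge_zero, of 2]
  have "(norm a)\<^sup>2 \<le> (\<integral>t. (norm (u t))\<^sup>2 \<partial>circ)" by simp
  with ule fa su that show ?thesis by auto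
qed

text \<open>A chosen boundary pair with coefficients \<open>a\<close>. Its values are determined
  almost everywhere only, but measurability and the symmetry \<open>psym\<close> hold without
  exception.\<close>

definition l2_fun :: "l2 \<Rightarrow> real \<Rightarrow> quat \<times> quat" where
  "l2_fun a = (SOME u. sqf u \<and> fourier u = a)"

lemma sqf_l2_fun: "sqf (l2_fun a)" and fourier_l2_fun [simp]: "fourier (l2_fun a) = a"
proof -
  have "\<exists>u. sqf u \<and> fourier u = a" using Riesz_Fischer by metis
  then show "sqf (l2_fun a)" "fourier (l2_fun a) = a" unfolding l2_fun_def
    by (metis (mono_tags, lifting) someI_ex)+
qed

lemma fcoef_l2_fun [simp]: "fcoef (l2_fun a) n = cf a n"
  by (metis cf_fourier fourier_l2_fun sqf_l2_fun)

lemma sqf_AE_eqI: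
  assumes "sqf u" "sqf v" "\<And>n. fcoef u n = fcoef v n"
  shows "AE t in circ. u t = v t"
  using assms fcoef_unique sqf_integrable sqf_psym by blast

lemma l2_fun_fourier: "sqf u \<Longrightarrow> AE t in circ. l2_fun (fourier u) t = u t"
  by (rule sqf_AE_eqI) (simp_all add: sqf_l2_fun cf_fourier)

text \<open>Riesz--Fischer supplies a pair with the same coefficients and the right norm; by
  uniqueness it equals \<open>u\<close> almost everywhere.\<close>

lemma Parseval:
  assumes "sqf u"
  shows "(\<integral>t. (norm (u t))\<^sup>2 \<partial>circ) = (norm (fourier u))\<^sup>2"
proof -
  obtain v where v: "sqf v" "fourier v = fourier u"
    "(\<integral>t. (norm (v t))\<^sup>2 \<partial>circ) = (norm (fourier u))\<^sup>2"
    using Riesz_Fischer by metis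
  have "AE t in circ. u t = v t"
    by (rule sqf_AE_eqI) (use v assms in \<open>auto simp: cf_fourier[symmetric]\<close>)
  then have "(\<integral>t. (norm (u t))\<^sup>2 \<partial>circ) = (\<integral>t. (norm (v t))\<^sup>2 \<partial>circ)"
    by (intro integral_cong_AE) (use sqf_measurable[OF v(1)] sqf_measurable[OF assms] in auto)
  with v(3) show ?thesis by simp
qed

lemma fourier_add: "sqf u \<Longrightarrow> sqf v \<Longrightarrow> fourier (\<lambda>t. u t + v t) = fourier u + fourier v"
  and fourier_diff: "sqf u \<Longrightarrow> sqf v \<Longrightarrow> fourier (\<lambda>t. u t - v t) = fourier u - fourier v"
  by (auto intro!: l2_eqI simp: cf_fourier sqf_add sqf_diff fcoef_add fcoef_diff sqf_integrable)

lemma Parseval_inner: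
  assumes "sqf u" "sqf v"
  shows "(\<integral>t. inner (u t) (v t) \<partial>circ) = inner (fourier u) (fourier v)"
proof -
  have "(\<integral>t. inner (u t) (v t) \<partial>circ) = (\<integral>t. ((norm (u t + v t))\<^sup>2 - (norm (u t))\<^sup>2
    - (norm (v t))\<^sup>2) / 2 \<partial>circ)"
    by (simp add: dot_norm)
  also have "\<dots> = ((\<integral>t. (norm (u t + v t))\<^sup>2 \<partial>circ) - (\<integral>t. (norm (u t))\<^sup>2 \<partial>circ)
    - (\<integral>t. (norm (v t))\<^sup>2 \<partial>circ)) / 2"
    using assms sqf_add[OF assms] by (simp add: sqf_def)
  also have "\<dots> = inner (fourier u) (fourier v)"
    by (simp add: Parseval assms sqf_add fourier_add dot_norm)
  finally show ?thesis .
qed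

section \<open>Products, shifts and cyclic vectors\<close>

lemma fcoef_pmul_pexp_right:
  assumes "integrable circ u"
  shows "fcoef (\<lambda>t. u t \<odot> pexp m \<alpha> t) n = fcoef u (n - m) * \<alpha>"
proof -
  have "cos (of_int n * t) *\<^sub>R fst (u t \<odot> pexp m \<alpha> t)
    + sin (of_int n * t) *\<^sub>R snd (u t \<odot> pexp m \<alpha> t)
      = (cos (of_int (n - m) * t) *\<^sub>R fst (u t) + sin (of_int (n - m) * t) *\<^sub>R snd (u t)) * \<alpha>" for t
    by (simp add: pmul_def pexp_def left_diff_distrib cos_diff sin_diff algebra_simps)
  then show ?thesis
    unfolding fcoef_def using integrable_fcoef[OF assms, of "n - m"]
    by (simp add: integral_mult_left del: of_int_diff)
qed

lemma fcoef_pcnj: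
  assumes "integrable circ u"
  shows "fcoef (\<lambda>t. pcnj (u t)) n = qcnj (fcoef u n)"
  unfolding fcoef_def
  by (subst integral_bounded_linear[OF bounded_linear_qcnj, symmetric])
    (use integrable_fcoef[OF assms, of n] in \<open>simp_all add: pcnj_def\<close>)

lemma fcoef_padj:
  assumes "integrable circ u"
  shows "fcoef (\<lambda>t. padj (u t)) n = qcnj (fcoef u (- n))"
  unfolding fcoef_def
  by (subst integral_bounded_linear[OF bounded_linear_qcnj, symmetric])
    (use integrable_fcoef[OF assms, of n] in \<open>simp_all add: padj_def\<close>)

text \<open>The norm of pairs is not multiplicative in general, but \<open>pexp n \<alpha> t\<close>
  is \<open>norm \<alpha>\<close> times a unitary element or zero.\<close>

lemma norm_pmul_pexp: "norm (x \<odot> pexp n \<alpha> t) = norm x * norm \<alpha>"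
proof -
  have "inner (x \<odot> pexp n \<alpha> t) (x \<odot> pexp n \<alpha> t) = (norm \<alpha>)\<^sup>2 * inner x x"
  proof -
    have "inner (a * \<alpha>) (b * \<alpha>) = (norm \<alpha>)\<^sup>2 * inner a b" for a b
      unfolding inner_quat_mult(2) by (simp add: mult.assoc qcnj_mult_self)
        (simp add: of_real_def)
    moreover have "x \<odot> pexp n \<alpha> t = ((cos (of_int n * t) *\<^sub>R fst x
      - sin (of_int n * t) *\<^sub>R snd x) * \<alpha>,
        (cos (of_int n * t) *\<^sub>R snd x + sin (of_int n * t) *\<^sub>R fst x) * \<alpha>)"
      by (simp add: pmul_def pexp_def algebra_simps)
    moreover have "inner (c *\<^sub>R a - s *\<^sub>R b) (c *\<^sub>R a - s *\<^sub>R b) + inner (c *\<^sub>R b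
      + s *\<^sub>R a) (c *\<^sub>R b + s *\<^sub>R a)
        = (c\<^sup>2 + s\<^sup>2) * (inner a a + inner b b)" for c s and a b :: quat
      by (simp add: inner_simps power2_eq_square inner_commute algebra_simps)
    ultimately show ?thesis
      by (simp add: inner_prod_def flip: distrib_left)
  qed
  then have "(norm (x \<odot> pexp n \<alpha> t))\<^sup>2 = (norm x * norm \<alpha>)\<^sup>2"
    by (simp add: power2_norm_eq_inner power_mult_distrib)
  then show ?thesis by simp
qed

lemma inner_pmul_right: "inner x (y \<odot> z) = inner (x \<odot> padj z) y"
  by (simp add: inner_prod_def pmul_def padj_def inner_add_left inner_add_right inner_diff_left
      inner_diff_right inner_quat_mult(2) inner_commute[of x] inner_commute[of "fst x"]
        inner_commute[of "snd x"])

lemma sqf_pmul_pexp: "sqf u \<Longrightarrow> sqf (\<lambda>t. u t \<odot> pexp n \<alpha> t)"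
  by (rule sqf_bound[where u = u and c = "norm \<alpha>"])
    (simp_all add: psym_intros sqf_psym norm_pmul_pexp mult.commute)

text \<open>Multiplication by \<open>q powi n\<close> and by the constant \<open>\<alpha>\<close> on
  the right. Passing through boundary functions keeps the result in \<open>l2\<close> and gives its
  norm by Parseval's identity.\<close>

definition shift_mult :: "int \<Rightarrow> quat \<Rightarrow> l2 \<Rightarrow> l2" where
  "shift_mult n \<alpha> a = fourier (\<lambda>t. l2_fun a t \<odot> pexp n \<alpha> t)"

definition lcnj :: "l2 \<Rightarrow> l2" where
  "lcnj a = fourier (\<lambda>t. pcnj (l2_fun a t))"

definition ladj :: "l2 \<Rightarrow> l2" where
  "ladj a = fourier (\<lambda>t. padj (l2_fun a t))"

lemmas sqf_l2_fun_intros = sqf_pmul_pexp[OF sqf_l2_fun] sqf_pcnj[OF sqf_l2_fun] sqf_padj[OF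
  sqf_l2_fun]

lemma cf_shift_mult [simp]: "cf (shift_mult n \<alpha> a) k = cf a (k - n) * \<alpha>"
  and cf_lcnj [simp]: "cf (lcnj a) k = qcnj (cf a k)"
  and cf_ladj [simp]: "cf (ladj a) k = qcnj (cf a (- k))"
  unfolding shift_mult_def lcnj_def ladj_def
  by (simp_all add: cf_fourier sqf_l2_fun_intros fcoef_pmul_pexp_right fcoef_pcnj fcoef_padj
    sqf_integrable sqf_l2_fun)

lemma lcnj_lcnj [simp]: "lcnj (lcnj a) = a" and ladj_ladj [simp]: "ladj (ladj a) = a"
  by (auto intro: l2_eqI)

lemma l2_fun_shift_mult: "AE t in circ. l2_fun (shift_mult n \<alpha> a) t = l2_fun a t \<odot> pexp n \<alpha> t"
  and l2_fun_lcnj: "AE t in circ. l2_fun (lcnj a) t = pcnj (l2_fun a t)"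
  and l2_fun_ladj: "AE t in circ. l2_fun (ladj a) t = padj (l2_fun a t)"
  unfolding shift_mult_def lcnj_def ladj_def by (rule l2_fun_fourier, rule sqf_l2_fun_intros)+

lemma norm_lcnj [simp]: "norm (lcnj a) = norm a" and norm_ladj [simp]: "norm (ladj a) = norm a"
proof -
  have "(norm (lcnj a))\<^sup>2 = (norm a)\<^sup>2" "(norm (ladj a))\<^sup>2 = (norm a)\<^sup>2"
    using Parseval[OF sqf_l2_fun, of a] unfolding lcnj_def ladj_def
    by (simp_all flip: Parseval add: sqf_l2_fun_intros)
  then show "norm (lcnj a) = norm a" "norm (ladj a) = norm a" by simp_all
qed

lemma norm_shift_mult [simp]: "norm (shift_mult n \<alpha> a) = norm a * norm \<alpha>"
proof -
  have "(norm (shift_mult n \<alpha> a))\<^sup>2 = (norm a * norm \<alpha>)\<^sup>2"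
    using Parseval[OF sqf_l2_fun, of a] unfolding shift_mult_def
    by (simp flip: Parseval add: sqf_l2_fun_intros norm_pmul_pexp power_mult_distrib)
  then show ?thesis by simp
qed

lemma bounded_linear_shift_mult: "bounded_linear (shift_mult n \<alpha>)"
  by (rule bounded_linear_intro[of _ "norm \<alpha>"]) (auto intro!: l2_eqI simp: distrib_right)

lemma inner_shift_mult: "inner a (shift_mult n \<alpha> b) = inner (shift_mult (- n) (qcnj \<alpha>) a) b"
proof -
  have "inner a (shift_mult n \<alpha> b) = inner (fourier (l2_fun a)) (fourier (\<lambda>t. l2_fun b t \<odot> pexp n \<alpha>
    t))"
    by (simp add: shift_mult_def)
  also have "\<dots> = inner (fourier (\<lambda>t. l2_fun a t \<odot> pexp (- n) (qcnj \<alpha>) t)) (fourier (l2_fun b))"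
    by (subst (1 2) Parseval_inner[symmetric])
      (simp_all add: sqf_l2_fun sqf_l2_fun_intros inner_pmul_right padj_pexp)
  finally show ?thesis by (simp add: shift_mult_def)
qed

text \<open>Convolution of coefficients. It need not be square-summable,
  hence it is not an element of \<open>l2\<close>.\<close>

definition conv_at :: "l2 \<Rightarrow> l2 \<Rightarrow> int \<Rightarrow> quat" where
  "conv_at a b n = fcoef (\<lambda>t. l2_fun a t \<odot> l2_fun b t) n"

lemma fcoef_pmul:
  assumes "AE t in circ. l2_fun a t = u t" "AE t in circ. l2_fun b t = v t"
    and [measurable]: "u \<in> borel_measurable borel" "v \<in> borel_measurable borel"
  shows "fcoef (\<lambda>t. u t \<odot> v t) n = conv_at a b n"
proof -
  have [measurable]: "l2_fun a \<in> borel_measurable borel" "l2_fun b \<in> borel_measurable borel"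
    using sqf_measurable[OF sqf_l2_fun] by auto
  have "AE t in circ. l2_fun a t \<odot> l2_fun b t = u t \<odot> v t" using assms(1,2) by eventually_elim simp
  then show ?thesis unfolding conv_at_def by (intro fcoef_cong_AE[symmetric]) measurable
qed

text \<open>Moving \<open>a\<close> to the other side as its adjoint turns a convolution coefficient
  into an inner product in \<open>l2\<close>. Linearity and continuity in \<open>b\<close> follow
  from this form.\<close>

lemma inner_conv_at: "inner (conv_at a b n) \<alpha> = inner b (shift_mult n \<alpha> (ladj a))"
proof -
  have "inner (conv_at a b n) \<alpha> = (\<integral>t. inner (l2_fun a t \<odot> l2_fun b t) (pexp n \<alpha> t) \<partial>circ)"
    unfolding conv_at_def by (intro integral_inner_pexp[symmetric] integrable_pmul sqf_l2_fun)
  also have "\<dots> = (\<integral>t. inner (l2_fun b t) (padj (l2_fun a t) \<odot> pexp n \<alpha> t) \<partial>circ)"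
    by (simp add: inner_pmul_left)
  also have "\<dots> = inner (fourier (l2_fun b)) (fourier (\<lambda>t. padj (l2_fun a t) \<odot> pexp n \<alpha> t))"
    by (intro Parseval_inner sqf_l2_fun sqf_pmul_pexp sqf_padj)
  also have "fourier (\<lambda>t. padj (l2_fun a t) \<odot> pexp n \<alpha> t) = shift_mult n \<alpha> (ladj a)"
    by (rule l2_eqI) (simp add: cf_fourier sqf_pmul_pexp sqf_padj sqf_l2_fun fcoef_pmul_pexp_right
        sqf_integrable fcoef_padj)
  finally show ?thesis by simp
qed

lemma norm_conv_at_le: "norm (conv_at a b n) \<le> norm a * norm b"
proof (cases "conv_at a b n = 0")
  case False
  have "norm (conv_at a b n) * norm (conv_at a b n)
    = inner b (shift_mult n (conv_at a b n) (ladj a))"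
    by (simp add: inner_conv_at[symmetric] power2_norm_eq_inner flip: power2_eq_square)
  also have "\<dots> \<le> norm b * norm (shift_mult n (conv_at a b n) (ladj a))"
    by (rule norm_cauchy_schwarz)
  also have "\<dots> = norm a * norm b * norm (conv_at a b n)" by simp
  finally show ?thesis using False by simp
qed simp

lemma bounded_linear_conv_at: "bounded_linear (\<lambda>b. conv_at a b n)"
proof (rule bounded_linear_intro)
  show "conv_at a (b + c) n = conv_at a b n + conv_at a c n" for b c
    by (rule vector_eq_rdot[THEN iffD1]) (simp add: inner_add_left inner_conv_at)
  show "conv_at a (r *\<^sub>R b) n = r *\<^sub>R conv_at a b n" for r b
    by (rule vector_eq_rdot[THEN iffD1]) (simp add: inner_conv_at)
  show "norm (conv_at a b n) \<le> norm b * norm a" for b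
    using norm_conv_at_le[of a b n] by (simp add: mult.commute)
qed

lemma conv_at_single: "conv_at a (single k \<beta>) n = cf a (n - k) * \<beta>"
proof (rule vector_eq_rdot[THEN iffD1], rule allI)
  fix \<alpha>
  have "inner (conv_at a (single k \<beta>) n) \<alpha> = inner (shift_mult n \<alpha> (ladj a)) (single k \<beta>)"
    unfolding inner_conv_at by (rule inner_commute)
  also have "\<dots> = inner \<beta> (qcnj (cf a (n - k)) * \<alpha>)"
    unfolding inner_single by (simp add: inner_commute)
  finally show "inner (conv_at a (single k \<beta>) n) \<alpha> = inner (cf a (n - k) * \<beta>) \<alpha>"
    by (simp only: inner_quat_mult(1))
qed

lemma conv_at_shift_mult: "conv_at a (shift_mult k \<alpha> b) n = conv_at a b (n - k) * \<alpha>"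
proof -
  have [measurable]: "l2_fun a \<in> borel_measurable borel" for a using sqf_measurable[OF sqf_l2_fun]
    by auto
  have "conv_at a (shift_mult k \<alpha> b) n = fcoef (\<lambda>t. l2_fun a t \<odot> (l2_fun b t \<odot> pexp k \<alpha> t)) n"
    by (rule fcoef_pmul[symmetric]) (use l2_fun_shift_mult in \<open>auto simp: borel_measurable_pexp\<close>)
  also have "\<dots> = conv_at a b (n - k) * \<alpha>"
    by (simp add: pmul_assoc[symmetric] fcoef_pmul_pexp_right integrable_pmul sqf_l2_fun
      conv_at_def)
  finally show ?thesis .
qed

section \<open>The Hardy space and its shift-invariant subspaces\<close>

definition pos :: "l2 \<Rightarrow> bool" where
  "pos a \<longleftrightarrow> (\<forall>n<0. cf a n = 0)"

lemma pos_lcnj [simp]: "pos (lcnj a) \<longleftrightarrow> pos a"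
  unfolding pos_def by simp (metis qcnj_simps(4,7))

lemma single_0 [simp]: "single n 0 = 0"
  by (rule l2_eqI) simp

text \<open>Truncations of \<open>a\<close> are polynomials that converge to \<open>a\<close>. This
  reduces identities that are linear and continuous on the Hardy space to monomials.\<close>

lemma pos_induct_linear:
  assumes f: "bounded_linear f" and z: "\<And>k \<beta>. 0 \<le> k \<Longrightarrow> f (single k \<beta>) = 0" and a: "pos a"
  shows "f a = 0"
proof -
  have z': "f (single k (cf a k)) = 0" for k
    using z[of k] a linear_simps(3)[OF f] by (cases "0 \<le> k") (auto simp: pos_def z)
  have "f (trunc N a) = 0" for N
    unfolding trunc_def using z' by (simp add: linear_sum[OF bounded_linear.linear[OF f]])
  moreover have "((\<lambda>N. f (trunc N a)) \<longlongrightarrow> f a) (finite_subsets_at_top UNIV)"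
    by (rule bounded_linear.tendsto[OF f tendsto_trunc])
  ultimately show ?thesis using tendsto_const_iff[OF finite_subsets_at_top_neq_bot]
    by (simp add: tendsto_const_iff)
qed

lemma conv_at_pos_neg: "pos a \<Longrightarrow> pos b \<Longrightarrow> n < 0 \<Longrightarrow> conv_at a b n = 0"
  by (rule pos_induct_linear[OF bounded_linear_conv_at]) (auto simp: conv_at_single pos_def)

lemma conv_at_pos_0: assumes "pos a" "pos b" shows "conv_at a b 0 = cf a 0 * cf b 0"
proof -
  have "bounded_linear (\<lambda>b. conv_at a b 0 - cf a 0 * cf b 0)"
    by (intro bounded_linear_sub bounded_linear_conv_at bounded_linear_const_mult bounded_linear_cf)
  from pos_induct_linear[OF this] assms show ?thesis by (auto simp: conv_at_single pos_def)
qed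

lemma pos_closed_subspace: "closed {a. \<forall>i\<in>I. cf a i = 0}" "subspace {a. \<forall>i\<in>I. cf a i = 0}"
proof -
  have "{a. \<forall>i\<in>I. cf a i = 0} = (\<Inter>i\<in>I. {a. cf a i = 0})" by auto
  moreover have "closed {a. cf a i = 0}" for i
    by (intro closed_Collect_eq continuous_intros linear_continuous_on bounded_linear_cf)
  ultimately show "closed {a. \<forall>i\<in>I. cf a i = 0}" by auto
qed (auto simp: subspace_def)

lemma closure_subspace:
  fixes S :: "'a :: real_normed_vector set"
  assumes S: "subspace S"
  shows "subspace (closure S)"
  unfolding subspace_def
proof (intro conjI ballI allI)
  show "0 \<in> closure S" using subspace_0[OF S] closure_subset by blast
next
  fix x y assume "x \<in> closure S" "y \<in> closure S"
  then obtain X Y where "\<And>n. X n \<in> S" "X \<longlonglongrightarrow> x" "\<And>n. Y n \<in> S" "Y \<longlonglongrightarrow> y"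
    by (metis closure_sequential)
  then show "x + y \<in> closure S"
    unfolding closure_sequential
    by (intro exI[of _ "\<lambda>n. X n + Y n"]) (auto intro: subspace_add[OF S] tendsto_add)
next
  fix c :: real and x assume "x \<in> closure S"
  then obtain X where "\<And>n. X n \<in> S" "X \<longlonglongrightarrow> x" by (metis closure_sequential)
  then show "c *\<^sub>R x \<in> closure S"
    unfolding closure_sequential
    by (intro exI[of _ "\<lambda>n. c *\<^sub>R X n"]) (auto intro: subspace_scale[OF S] tendsto_intros)
qed

text \<open>For \<open>m = 0\<close> the coefficient form of \<open>E_span g\<close>, for
  \<open>m = 1\<close> that of its multiple by \<open>q\<close>. A real span suffices, since the
  generators already carry all right quaternionic factors.\<close>

definition shift_closure :: "nat \<Rightarrow> l2 \<Rightarrow> l2 set" where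
  "shift_closure m g = closure (span {shift_mult n \<alpha> g | n \<alpha>. int m \<le> n})"

lemma shift_closure_closed: "closed (shift_closure m g)"
  and shift_closure_subspace: "subspace (shift_closure m g)"
  by (auto simp: shift_closure_def closure_subspace)

lemma shift_closure_subset:
  assumes "closed C" "subspace C" "\<And>n \<alpha>. int m \<le> n \<Longrightarrow> shift_mult n \<alpha> g \<in> C"
  shows "shift_closure m g \<subseteq> C"
  unfolding shift_closure_def using assms by (intro closure_minimal span_minimal) auto

lemma shift_mult_in_shift_closure: "int m \<le> n \<Longrightarrow> shift_mult n \<alpha> g \<in> shift_closure m g"
  unfolding shift_closure_def by (rule closure_subset[THEN subsetD], rule span_base) auto

lemma shift_mult_0_1 [simp]: "shift_mult 0 1 g = g"
  by (rule l2_eqI) simp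

lemma shift_mult_shift_mult: "shift_mult n \<alpha> (shift_mult m \<beta> g) = shift_mult (n + m) (\<beta> * \<alpha>) g"
  by (rule l2_eqI) (simp add: mult.assoc diff_diff_eq)

lemma shift_mult_shift_closure:
  assumes "y \<in> shift_closure k g" "int m \<le> n + int k"
  shows "shift_mult n \<alpha> y \<in> shift_closure m g"
proof -
  have "shift_closure k g \<subseteq> shift_mult n \<alpha> -` shift_closure m g"
  proof (rule shift_closure_subset)
    show "closed (shift_mult n \<alpha> -` shift_closure m g)"
      by (intro closed_vimage shift_closure_closed linear_continuous_on bounded_linear_shift_mult)
    show "subspace (shift_mult n \<alpha> -` shift_closure m g)"
      by (intro linear_subspace_vimage shift_closure_subspace bounded_linear.linear
        bounded_linear_shift_mult)
    show "shift_mult l \<beta> g \<in> shift_mult n \<alpha> -` shift_closure m g" if "int k \<le> l" for l \<beta>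
      using that assms(2) by (auto simp: shift_mult_shift_mult intro!: shift_mult_in_shift_closure)
  qed
  then show ?thesis using assms(1) by auto
qed

lemma shift_closure_pos: "pos g \<Longrightarrow> y \<in> shift_closure 0 g \<Longrightarrow> pos y"
  using shift_closure_subset[OF pos_closed_subspace[of "{..<0}"], of 0 g] by (auto simp: pos_def)

text \<open>Reaching the constant 1 is enough, because the closure is stable under forward shifts
  and right multiplication by constants.\<close>

definition l2_cyclic :: "l2 \<Rightarrow> bool" where
  "l2_cyclic g \<longleftrightarrow> single 0 1 \<in> shift_closure 0 g"

text \<open>The sequences \<open>y\<close> for which \<open>r * y\<close> has no negative
  coefficients form a closed subspace. It contains the forward shifts of \<open>g\<close>, hence the
  constant 1.\<close>

lemma l2_cyclic_pos:
  assumes "l2_cyclic g" "\<And>n. n < 0 \<Longrightarrow> conv_at r g n = 0"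
  shows "pos r"
proof -
  have "shift_closure 0 g \<subseteq> (\<Inter>n\<in>{..<0}. {y. conv_at r y n = 0})"
  proof (rule shift_closure_subset)
    show "closed (\<Inter>n\<in>{..<0}. {y. conv_at r y n = 0})"
      by (intro closed_INT ballI closed_Collect_eq continuous_intros linear_continuous_on
        bounded_linear_conv_at)
    show "subspace (\<Inter>n\<in>{..<0}. {y. conv_at r y n = 0})"
      by (auto simp: subspace_def linear_simps[OF bounded_linear_conv_at])
  qed (use assms(2) in \<open>auto simp: conv_at_shift_mult\<close>)
  then have "conv_at r (single 0 1) n = 0" if "n < 0" for n
    using assms(1) that by (auto simp: l2_cyclic_def)
  then show ?thesis by (auto simp: conv_at_single pos_def)
qed

lemma AE_pmul_eqI:
  assumes "\<And>n. conv_at a b n = conv_at c d n"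
  shows "AE t in circ. l2_fun a t \<odot> l2_fun b t = l2_fun c t \<odot> l2_fun d t"
  by (intro fcoef_unique integrable_pmul psym_intros(4) sqf_l2_fun sqf_psym assms[unfolded
    conv_at_def])

section \<open>Inner functions\<close>

text \<open>The determinant of the corresponding complex matrix. Both components are real, so it is
  central.\<close>

definition pdet :: "quat \<times> quat \<Rightarrow> quat \<times> quat" where
  "pdet x = x \<odot> pcnj x"

lemma pcnj_pmul_self: "pcnj x \<odot> x = pdet x"
  by (simp add: pdet_def pmul_def pcnj_def quat_eq_iff)

lemma pdet_real: "\<exists>r s. pdet x = (of_real r, of_real s)"
  by (rule exI[of _ "qRe (fst (pdet x))"], rule exI[of _ "qRe (snd (pdet x))"])
    (simp add: pdet_def pmul_def pcnj_def prod_eq_iff quat_eq_iff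
      del: of_real_mult of_real_add of_real_diff)

lemma pdet_central: "pdet x \<odot> y = y \<odot> pdet x"
proof -
  obtain r s where "pdet x = (of_real r, of_real s)" using pdet_real by blast
  then show ?thesis by (simp add: pmul_def of_real_def)
qed

lemma pcnj_pdet: "pcnj (pdet x) = pdet x"
  by (simp add: pdet_def pcnj_pmul)

lemma pflip_pdet: "pflip (pdet x) = pdet (pflip x)"
  by (simp add: pdet_def pflip_pmul pflip_pcnj)

text \<open>Adjugate over determinant; the reciprocal of the central \<open>pdet x\<close> is its
  complex conjugate \<open>padj (pdet x)\<close> over the squared modulus.\<close>

definition pinv :: "quat \<times> quat \<Rightarrow> quat \<times> quat" where
  "pinv x = padj (pdet x) \<odot> pcnj x /\<^sub>R (norm (pdet x))\<^sup>2"

lemma pinv_mult: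
  assumes "pdet x \<noteq> 0"
  shows "pinv x \<odot> x = (1, 0)" "x \<odot> pinv x = (1, 0)"
proof -
  obtain r s where rs: "pdet x = (of_real r, of_real s)" using pdet_real by blast
  have n: "padj (pdet x) \<odot> pdet x = ((norm (pdet x))\<^sup>2) *\<^sub>R (1, 0)"
  proof -
    have "qcnj (of_real c) = of_real c" for c by (simp add: of_real_def)
    then show ?thesis
      by (simp add: rs pmul_def padj_def norm_prod_def of_real_def power2_eq_square scaleR_add_left)
  qed
  have "pinv x \<odot> x = (padj (pdet x) \<odot> pdet x) /\<^sub>R (norm (pdet x))\<^sup>2"
    unfolding pinv_def by (simp only: pmul_distrib pmul_assoc pcnj_pmul_self)
  then show 1: "pinv x \<odot> x = (1, 0)" using assms by (simp add: n)
  have c: "x \<odot> padj (pdet x) = padj (pdet x) \<odot> x"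
    by (simp add: rs padj_def pmul_def of_real_def)
  have "x \<odot> pinv x = (padj (pdet x) \<odot> pdet x) /\<^sub>R (norm (pdet x))\<^sup>2"
    unfolding pinv_def pmul_distrib pmul_assoc[symmetric] c by (simp only: pmul_assoc pdet_def)
  then show "x \<odot> pinv x = (1, 0)" using assms by (simp add: n)
qed

definition punit :: "quat \<times> quat \<Rightarrow> bool" where
  "punit x \<longleftrightarrow> padj x \<odot> x = (1, 0)"

text \<open>For \<open>x = (b, c)\<close> the hypothesis says that the squared norms add up to 1 and
  that \<open>qcnj b * c\<close> is real. The product in the other order has the same real part and
  the same norm, so it is real too.\<close>

lemma punit_swap:
  assumes "punit x" shows "x \<odot> padj x = (1, 0)"
proof -
  obtain b c where x: "x = (b, c)" by (cases x)
  define y z where "y = qcnj b * c" and "z = c * qcnj b"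
  have 1: "qcnj b * b + qcnj c * c = 1" and 2: "y = qcnj y"
    using assms by (simp_all add: punit_def x pmul_def padj_def y_def)
  have im: "qI y = 0" "qJ y = 0" "qK y = 0"
    using arg_cong[OF 2, of qI] arg_cong[OF 2, of qJ] arg_cong[OF 2, of qK] by simp_all
  have "qRe z = qRe y" by (simp add: y_def z_def)
  moreover have "(norm z)\<^sup>2 = (norm y)\<^sup>2" by (simp add: y_def z_def norm_mult mult.commute)
  ultimately have "(qI z)\<^sup>2 + (qJ z)\<^sup>2 + (qK z)\<^sup>2 = 0" unfolding norm_quat_squared by (simp add: im)
  then have "z = qcnj z" by (simp add: quat_eq_iff add_nonneg_eq_0_iff)
  moreover have "b * qcnj b + c * qcnj c = 1" using 1 by (simp add: qcnj_mult_self)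
  ultimately show ?thesis by (simp add: x pmul_def padj_def z_def)
qed

lemma punit_norm_pmul:
  assumes "punit x" shows "norm (x \<odot> y) = norm y"
proof -
  have "inner (x \<odot> y) (x \<odot> y) = inner y ((padj x \<odot> x) \<odot> y)"
    by (simp add: inner_pmul_left pmul_assoc)
  then show ?thesis using assms by (simp add: punit_def norm_eq_sqrt_inner)
qed

lemma punit_norm: "punit x \<Longrightarrow> norm x = 1"
  using punit_norm_pmul[of x "(1, 0)"] by (simp add: norm_prod_def)

lemma punit_padj: "punit x \<Longrightarrow> punit (padj x)"
  using punit_swap by (simp add: punit_def)

lemma punit_pcnj: "punit x \<Longrightarrow> punit (pcnj x)"
  unfolding punit_def[of "pcnj x"] padj_pcnj pcnj_pmul[symmetric]
  by (simp add: punit_swap) (simp add: pcnj_def)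

lemma punit_pmul: "punit x \<Longrightarrow> punit y \<Longrightarrow> punit (x \<odot> y)"
  unfolding punit_def padj_pmul by (metis pmul_assoc pmul_one(1))

lemma l2_fun_single: "AE t in circ. l2_fun (single n \<alpha>) t = pexp n \<alpha> t"
  by (rule sqf_AE_eqI) (simp_all add: sqf_l2_fun sqf_pexp fcoef_pexp)

text \<open>The product of \<open>\<phi>\<close> with its adjoint on the left has coefficient 1 at 0
  and, by orthogonality, none at positive indices; the negative ones vanish by symmetry of the inner
  product. Hence this product is the constant 1.\<close>

lemma punit_AE_I:
  assumes "norm \<phi> = 1" "\<And>n \<alpha>. 1 \<le> n \<Longrightarrow> inner \<phi> (shift_mult n \<alpha> \<phi>) = 0"
  shows "AE t in circ. punit (l2_fun \<phi> t)"
proof -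
  have "inner (conv_at (ladj \<phi>) \<phi> n) \<alpha> = inner (conv_at (single 0 1) (single 0 1) n) \<alpha>" for n \<alpha>
  proof -
    consider "1 \<le> n" | "1 \<le> - n" | "n = 0" by linarith
    then show ?thesis
    proof cases
      case 1
      then show ?thesis by (simp add: inner_conv_at conv_at_single assms(2))
    next
      case 2
      have "inner (conv_at (ladj \<phi>) \<phi> n) \<alpha> = inner (shift_mult (- n) (qcnj \<alpha>) \<phi>) \<phi>"
        by (simp add: inner_conv_at inner_shift_mult[of \<phi> n])
      also have "\<dots> = 0" unfolding inner_commute[of "shift_mult _ _ _"] by (rule assms(2)[OF 2])
      finally show ?thesis using 2 by (simp add: conv_at_single)
    next
      case 3
      \<comment> \<open>Right multiplication by an imaginary quaternion is skew-symmetric, so only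
        the real part of \<open>\<alpha>\<close> contributes.\<close>
      have "inner x (x * \<alpha>) = (norm x)\<^sup>2 * qRe \<alpha>" for x
        unfolding norm_quat_squared inner_quat_def by (simp add: power2_eq_square algebra_simps)
      then have "((\<lambda>k. (norm (cf \<phi> k))\<^sup>2 * qRe \<alpha>) has_sum inner \<phi> (shift_mult 0 \<alpha> \<phi>)) UNIV"
        using has_sum_inner_l2[of \<phi> "shift_mult 0 \<alpha> \<phi>"] by simp
      moreover have "((\<lambda>k. (norm (cf \<phi> k))\<^sup>2 * qRe \<alpha>) has_sum ((norm \<phi>)\<^sup>2 * qRe \<alpha>)) UNIV"
        by (rule has_sum_cmult_left[OF has_sum_norm_l2])
      ultimately have "inner \<phi> (shift_mult 0 \<alpha> \<phi>) = qRe \<alpha>"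
        using has_sum_unique assms(1) by fastforce
      moreover have "inner 1 \<alpha> = qRe \<alpha>" by (simp add: inner_quat_def)
      ultimately show ?thesis by (simp add: 3 inner_conv_at conv_at_single)
    qed
  qed
  then have "conv_at (ladj \<phi>) \<phi> n = conv_at (single 0 1) (single 0 1) n" for n
    by (intro vector_eq_rdot[THEN iffD1]) simp
  from AE_pmul_eqI[OF this] l2_fun_ladj[of \<phi>] l2_fun_single[of 0 1] show ?thesis
    by eventually_elim (simp add: punit_def pexp_0)
qed

lemma lowest_coefficient:
  assumes a: "pos a" "a \<noteq> 0"
  obtains m where "cf a (int m) \<noteq> 0" "\<And>i. i < int m \<Longrightarrow> cf a i = 0"
proof -
  have ex: "\<exists>m. cf a (int m) \<noteq> 0"
  proof (rule ccontr)
    assume z: "\<nexists>m. cf a (int m) \<noteq> 0"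
    have "cf a n = 0" for n
    proof (cases "n < 0")
      case False
      then show ?thesis using z by (metis int_eq_iff linorder_not_less)
    qed (use a(1) in \<open>auto simp: pos_def\<close>)
    then have "a = 0" by (intro l2_eqI) simp
    with a(2) show False ..
  qed
  define m where "m = (LEAST m. cf a (int m) \<noteq> 0)"
  have m: "cf a (int m) \<noteq> 0" "\<And>k. k < m \<Longrightarrow> cf a (int k) = 0"
    unfolding m_def using LeastI_ex[OF ex] not_less_Least by blast+
  have "cf a i = 0" if "i < int m" for i
  proof (cases "i < 0")
    case False
    then have "i = int (nat i)" "nat i < m" using that by auto
    then show ?thesis using m(2) by metis
  qed (use a(1) in \<open>auto simp: pos_def\<close>)
  with m(1) that show ?thesis by blast
qed

text \<open>The wandering vector argument: \<open>\<phi>\<close> lies in the closure, so its forward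
  shifts lie in \<open>shift_closure 1 g\<close>, to which it is orthogonal by construction. It is
  thus orthogonal to its own shifts as well as to those of \<open>g\<close>.\<close>

theorem inner_function_exists:
  assumes g: "pos g" "g \<noteq> 0"
  obtains \<phi> where "\<phi> \<in> shift_closure 0 g" "norm \<phi> = 1"
    "\<And>n \<alpha>. 1 \<le> n \<Longrightarrow> inner \<phi> (shift_mult n \<alpha> g) = 0"
    "AE t in circ. punit (l2_fun \<phi> t)"
proof -
  obtain y where y: "y \<in> shift_closure 1 g" "\<And>z. z \<in> shift_closure 1 g \<Longrightarrow> inner (g - y) z = 0"
    using orthogonal_projection_exists[OF shift_closure_closed shift_closure_subspace, of 1 g g]
      by blast
  have sub: "shift_closure 1 g \<subseteq> shift_closure 0 g"
    by (intro shift_closure_subset shift_closure_closed shift_closure_subspace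
      shift_mult_in_shift_closure) auto
  obtain m where m: "cf g (int m) \<noteq> 0" "\<And>i. i < int m \<Longrightarrow> cf g i = 0"
    by (rule lowest_coefficient[OF g]) blast
  \<comment> \<open>Elements of \<open>shift_closure 1 g\<close> start after the lowest index
    \<open>m\<close> of \<open>g\<close>, so \<open>g\<close> is not among them and its orthogonal
    component is nonzero.\<close>
  have "shift_closure 1 g \<subseteq> {a. \<forall>i\<in>{..int m}. cf a i = 0}"
  proof (intro shift_closure_subset pos_closed_subspace)
    fix n :: int and \<alpha> assume n: "int 1 \<le> n"
    have "cf g (i - n) = 0" if "i \<le> int m" for i
      using that n by (intro m(2)) simp
    then show "shift_mult n \<alpha> g \<in> {a. \<forall>i\<in>{..int m}. cf a i = 0}" by simp
  qed
  with y(1) have "cf y (int m) = 0" by auto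
  with m(1) have ne: "g - y \<noteq> 0" by auto
  define \<phi> where "\<phi> = (g - y) /\<^sub>R norm (g - y)"
  have "g \<in> shift_closure 0 g" using shift_mult_in_shift_closure[of 0 0 1 g] by simp
  then have E: "\<phi> \<in> shift_closure 0 g"
    unfolding \<phi>_def using y(1) sub by (intro subspace_scale subspace_diff shift_closure_subspace)
      auto
  have orth: "inner \<phi> z = 0" if "z \<in> shift_closure 1 g" for z
    using y(2)[OF that] by (simp add: \<phi>_def)
  have "norm \<phi> = 1" using ne by (simp add: \<phi>_def)
  moreover have "inner \<phi> (shift_mult n \<alpha> g) = 0" if "1 \<le> n" for n \<alpha>
    using that by (intro orth shift_mult_in_shift_closure) simp
  moreover have "inner \<phi> (shift_mult n \<alpha> \<phi>) = 0" if "1 \<le> n" for n \<alpha>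
    using that by (intro orth shift_mult_shift_closure[OF E]) simp
  ultimately show ?thesis using that E punit_AE_I by blast
qed

text \<open>The boundary value of a nonzero function of the Hardy space is left cancellable, because the
  annihilator of \<open>g\<close> also annihilates an inner function.\<close>

lemma AE_pmul_eq_0D:
  assumes g: "pos g" "g \<noteq> 0" and w: "sqf w" and z: "AE t in circ. w t \<odot> l2_fun g t = 0"
  shows "AE t in circ. w t = 0"
proof -
  obtain \<phi> where \<phi>: "\<phi> \<in> shift_closure 0 g" "AE t in circ. punit (l2_fun \<phi> t)"
    using inner_function_exists[OF g] by metis
  have [measurable]: "w \<in> borel_measurable borel" "l2_fun a \<in> borel_measurable borel" for a
    using sqf_measurable[OF sqf_l2_fun] sqf_measurable[OF w] by auto
  have "conv_at (fourier w) g n = 0" for n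
  proof -
    have "conv_at (fourier w) g n = fcoef (\<lambda>t. w t \<odot> l2_fun g t) n"
      by (rule fcoef_pmul[symmetric]) (use l2_fun_fourier[OF w] in auto)
    also have "\<dots> = fcoef (pexp 0 0) n"
      by (rule fcoef_cong_AE) (use z in auto)
    finally show ?thesis by (simp add: fcoef_pexp)
  qed
  \<comment> \<open>Annihilation by \<open>w\<close> passes from \<open>g\<close> to the closure and
    so to \<open>\<phi>\<close>, whose unitary values can be cancelled.\<close>
  then have "shift_closure 0 g \<subseteq> (\<Inter>n. {y. conv_at (fourier w) y n = 0})"
  proof (intro shift_closure_subset)
    show "closed (\<Inter>n. {y. conv_at (fourier w) y n = 0})"
      by (intro closed_INT ballI closed_Collect_eq continuous_intros linear_continuous_on
        bounded_linear_conv_at)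
    show "subspace (\<Inter>n. {y. conv_at (fourier w) y n = 0})"
      by (auto simp: subspace_def linear_simps[OF bounded_linear_conv_at])
  qed (auto simp: conv_at_shift_mult)
  then have "conv_at (fourier w) \<phi> n = conv_at (fourier w) (single 0 0) n" for n
    using \<phi>(1) linear_simps(3)[OF bounded_linear_conv_at] by auto
  from AE_pmul_eqI[OF this] l2_fun_single[of 0 0] l2_fun_fourier[OF w] \<phi>(2)
  show ?thesis
  proof eventually_elim
    case (elim t)
    then have "w t \<odot> l2_fun \<phi> t = 0" by simp
    then have "w t \<odot> (l2_fun \<phi> t \<odot> padj (l2_fun \<phi> t)) = 0" by (simp flip: pmul_assoc)
    then show ?case using punit_swap[of "l2_fun \<phi> t"] elim by simp
  qed
qed

lemma borel_measurable_pdet: "u \<in> borel_measurable borel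
  \<Longrightarrow> (\<lambda>t. pdet (u t)) \<in> borel_measurable borel"
  unfolding pdet_def
  by (intro borel_measurable_pmul measurable_compose[OF _ borel_measurable_pcnj])

text \<open>On the zero set \<open>Z\<close> of the determinant, the conjugate of \<open>g\<close>
  annihilates \<open>g\<close> from the left, so cancellation gives \<open>g = 0\<close> there. Then
  the indicator of \<open>Z\<close> annihilates \<open>g\<close> too, and \<open>Z\<close> is
  null.\<close>

lemma pdet_AE_neq_0:
  assumes g: "pos g" "g \<noteq> 0"
  shows "AE t in circ. pdet (l2_fun g t) \<noteq> 0"
proof -
  define Z where "Z = {t. pdet (l2_fun g t) = 0}"
  have [measurable]: "l2_fun g \<in> borel_measurable borel" using sqf_measurable[OF sqf_l2_fun] .
  have [measurable]: "Z \<in> sets borel"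
    using borel_measurable_pdet[of "l2_fun g"] unfolding Z_def by measurable
  have sym: "l2_fun g (2 * pi - t) = pflip (l2_fun g t)" for t
    using sqf_psym[OF sqf_l2_fun] by (auto simp: psym_def)
  \<comment> \<open>Invariance of \<open>Z\<close> under the reflection keeps functions cut off to
    \<open>Z\<close> symmetric.\<close>
  have Z: "2 * pi - t \<in> Z \<longleftrightarrow> t \<in> Z" for t
    unfolding Z_def by (simp add: sym pflip_pdet[symmetric]) (metis pflip_pflip pflip_simps(1))
  have s: "sqf (\<lambda>t. indicator Z t *\<^sub>R u t)" if "sqf u" for u
  proof (rule sqf_bound[OF _ that])
    have "(\<lambda>t. indicator Z t *\<^sub>R u t) \<in> borel_measurable borel" using sqf_measurable[OF that]
      by measurable
    then show "psym (\<lambda>t. indicator Z t *\<^sub>R u t)"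
      using sqf_psym[OF that] by (auto simp: psym_def indicator_def Z)
    show "AE t in circ. norm (indicator Z t *\<^sub>R u t) \<le> 1 * norm (u t)" by (auto simp: indicator_def)
  qed
  have "AE t in circ. indicator Z t *\<^sub>R pcnj (l2_fun g t) = 0"
    by (rule AE_pmul_eq_0D[OF g s[OF sqf_pcnj[OF sqf_l2_fun]]])
      (auto simp: pmul_distrib pcnj_pmul_self Z_def indicator_def)
  then have "AE t in circ. (indicator Z t *\<^sub>R pexp 0 1 t) \<odot> l2_fun g t = 0"
  proof eventually_elim
    case (elim t)
    then have "t \<in> Z \<Longrightarrow> l2_fun g t = 0" by (metis pcnj_pcnj norm_eq_zero norm_pcnj(1)
      indicator_simps(1) scaleR_one)
    then show ?case by (auto simp: indicator_def)
  qed
  from AE_pmul_eq_0D[OF g s[OF sqf_pexp] this] show ?thesis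
    by eventually_elim (auto simp: Z_def indicator_def pexp_0 zero_prod_def split: if_splits)
qed

section \<open>Cyclicity and conjugation\<close>

lemma measurable_l2_fun [measurable]: "l2_fun a \<in> borel_measurable borel"
  using sqf_measurable[OF sqf_l2_fun] .

text \<open>The negative coefficients of \<open>h\<close> are given by inner products of
  \<open>\<phi>\<close> with shifts of \<open>g\<close> by positive powers, which vanish by the
  choice of \<open>\<phi>\<close>. Unitarity of its values keeps \<open>h\<close>
  square-integrable.\<close>

lemma inner_factorization:
  assumes g: "pos g" "g \<noteq> 0"
  obtains \<phi> h where "\<phi> \<in> shift_closure 0 g" "pos \<phi>" "norm \<phi> = 1" "AE t in circ. punit (l2_fun \<phi> t)"
    "pos h" "AE t in circ. l2_fun h t = padj (l2_fun \<phi> t) \<odot> l2_fun g t"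
proof -
  obtain \<phi> where \<phi>: "\<phi> \<in> shift_closure 0 g" "norm \<phi> = 1"
    "\<And>n \<alpha>. 1 \<le> n \<Longrightarrow> inner \<phi> (shift_mult n \<alpha> g) = 0"
    "AE t in circ. punit (l2_fun \<phi> t)"
    by (rule inner_function_exists[OF g]) blast
  define w where "w = (\<lambda>t. padj (l2_fun \<phi> t) \<odot> l2_fun g t)"
  have sw: "sqf w"
  proof (rule sqf_bound[where u = "l2_fun g" and c = 1])
    show "psym w" unfolding w_def by (intro psym_intros(4,6) sqf_psym sqf_l2_fun)
    show "AE t in circ. norm (w t) \<le> 1 * norm (l2_fun g t)"
      using \<phi>(4) by eventually_elim (simp add: w_def punit_norm_pmul punit_padj)
  qed (rule sqf_l2_fun)
  have "cf (fourier w) n = 0" if "n < 0" for n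
  proof -
    have "cf (fourier w) n = conv_at (ladj \<phi>) g n"
      unfolding cf_fourier[OF sw] unfolding w_def
      by (rule fcoef_pmul) (use l2_fun_ladj in \<open>auto intro: measurable_compose[OF _
        borel_measurable_padj]\<close>)
    moreover have "inner (conv_at (ladj \<phi>) g n) \<alpha> = 0" for \<alpha>
    proof -
      have "inner (conv_at (ladj \<phi>) g n) \<alpha> = inner (shift_mult (- n) (qcnj \<alpha>) g) \<phi>"
        by (simp add: inner_conv_at inner_shift_mult[of g n])
      also have "\<dots> = 0" unfolding inner_commute[of "shift_mult _ _ _"] using that
        by (intro \<phi>(3)) simp
      finally show ?thesis .
    qed
    ultimately show ?thesis by (metis inner_eq_zero_iff)
  qed
  then have "pos (fourier w)" by (simp add: pos_def)
  moreover have "AE t in circ. l2_fun (fourier w) t = padj (l2_fun \<phi> t) \<odot> l2_fun g t"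
    using l2_fun_fourier[OF sw] by (simp add: w_def)
  ultimately show ?thesis using that \<phi> shift_closure_pos[OF g(1)] by blast
qed

text \<open>A unit vector whose coefficient at 0 has norm at least 1 has no other coefficients, so
  the closure contains a nonzero constant.\<close>

lemma l2_cyclic_of_constant:
  assumes "\<phi> \<in> shift_closure 0 g" "norm \<phi> = 1" "1 \<le> norm (cf \<phi> 0)"
  shows "l2_cyclic g"
proof -
  have "(norm (\<phi> - trunc {0} \<phi>))\<^sup>2 \<le> 0"
    using norm_diff_trunc[of "{0}" \<phi>] assms(2,3) by simp
  then have \<phi>: "\<phi> = single 0 (cf \<phi> 0)" by (simp add: trunc_def)
  have "cf \<phi> 0 \<noteq> 0" using assms(3) by auto
  have "single 0 1 = shift_mult 0 (inverse (cf \<phi> 0)) \<phi>"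
    by (rule l2_eqI, subst \<phi>) (simp add: \<open>cf \<phi> 0 \<noteq> 0\<close>)
  also have "\<dots> \<in> shift_closure 0 g" using assms(1) by (rule shift_mult_shift_closure) simp
  finally show ?thesis by (simp add: l2_cyclic_def)
qed

lemma AE_cf_eq:
  assumes "AE t in circ. l2_fun a t \<odot> l2_fun b t = l2_fun c t"
  shows "conv_at a b n = cf c n"
proof -
  have "conv_at a b n = fcoef (l2_fun c) n"
    unfolding conv_at_def by (rule fcoef_cong_AE[OF assms]) measurable
  then show ?thesis by simp
qed

lemma l2_cyclic_AE_pos:
  assumes "l2_cyclic g" "pos f" "AE t in circ. l2_fun r t \<odot> l2_fun g t = l2_fun f t"
  shows "pos r"
  using l2_cyclic_pos[OF assms(1)] AE_cf_eq[OF assms(3)] assms(2) by (simp add: pos_def)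

lemma lcnj_neq_0: "g \<noteq> 0 \<Longrightarrow> lcnj g \<noteq> 0"
  by (metis norm_eq_zero norm_lcnj)

text \<open>Passing to the conjugate reverses products, so this exchanges left and right multiplication.
  The proof runs through the determinant: the inner factor \<open>U\<close> of the conjugate of \<open>g\<close>
  contributes the central inner function \<open>pcnj U \<odot> U\<close> to \<open>g\<close>, and cyclicity forces it to be
  constant.\<close>

theorem l2_cyclic_lcnj:
  assumes g: "pos g" "g \<noteq> 0" and c: "l2_cyclic g"
  shows "l2_cyclic (lcnj g)"
proof -
  obtain \<psi> h where \<psi>: "\<psi> \<in> shift_closure 0 (lcnj g)" "pos \<psi>" "norm \<psi> = 1"
    "AE t in circ. punit (l2_fun \<psi> t)"
    and h: "pos h" "AE t in circ. l2_fun h t = padj (l2_fun \<psi> t) \<odot> l2_fun (lcnj g) t"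
    using inner_factorization[of "lcnj g"] g(1) lcnj_neq_0[OF g(2)] by auto
  define U where "U = l2_fun \<psi>"
  define H where "H = l2_fun h"
  define G where "G = l2_fun g"
  have [measurable]: "U \<in> borel_measurable borel" "H \<in> borel_measurable borel"
    "G \<in> borel_measurable borel"
    by (auto simp: U_def H_def G_def)
  have sym: "psym U" "psym H" "psym G" unfolding U_def H_def G_def by (intro sqf_psym sqf_l2_fun)+
  have GUH: "AE t in circ. pcnj (G t) = U t \<odot> H t \<and> punit (U t)"
    using \<psi>(4) h(2) l2_fun_lcnj[of g]
  proof eventually_elim
    case (elim t)
    then show ?case by (simp add: U_def H_def G_def punit_swap flip: pmul_assoc)
  qed
  \<comment> \<open>Division of \<open>H\<close> by \<open>pcnj U\<close> on the left. Since
    \<open>G\<close> is \<open>pcnj H\<close> times \<open>pcnj U\<close>, centrality of the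
    determinant of \<open>H\<close> makes \<open>R\<close> times \<open>G\<close> equal to
    \<open>H\<close> times \<open>pcnj H\<close>, which has no negative coefficients.\<close>
  define R where "R = (\<lambda>t. padj (pcnj (U t)) \<odot> H t)"
  have sR: "sqf R"
  proof (rule sqf_bound[where u = H and c = 1])
    show "psym R" unfolding R_def by (intro psym_intros(4,5,6) sym)
    show "AE t in circ. norm (R t) \<le> 1 * norm (H t)"
      using GUH by eventually_elim (simp add: R_def punit_norm_pmul punit_padj punit_pcnj)
  qed (simp add: H_def sqf_l2_fun)
  have RG: "AE t in circ. R t \<odot> G t = H t \<odot> pcnj (H t)"
    using GUH
  proof eventually_elim
    case (elim t)
    have "G t = pcnj (H t) \<odot> pcnj (U t)"
      using elim by (metis pcnj_pcnj pcnj_pmul)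
    then have "R t \<odot> G t = padj (pcnj (U t)) \<odot> (pdet (H t) \<odot> pcnj (U t))"
      by (simp add: R_def pmul_assoc pdet_def)
    also have "\<dots> = padj (pcnj (U t)) \<odot> pcnj (U t) \<odot> pdet (H t)"
      by (simp only: pdet_central pmul_assoc)
    also have "\<dots> = H t \<odot> pcnj (H t)"
      using elim punit_pcnj[of "U t"] by (simp add: punit_def pdet_def)
    finally show ?case .
  qed
  have [measurable]: "R \<in> borel_measurable borel" by (rule sqf_measurable[OF sR])
  have pR: "pos (fourier R)"
  proof (rule l2_cyclic_pos[OF c])
    fix n :: int assume "n < 0"
    have "conv_at (fourier R) g n = fcoef (\<lambda>t. R t \<odot> G t) n"
      by (rule fcoef_pmul[symmetric]) (use l2_fun_fourier[OF sR] in \<open>auto simp: G_def\<close>)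
    also have "\<dots> = fcoef (\<lambda>t. H t \<odot> pcnj (H t)) n"
      by (rule fcoef_cong_AE[OF RG]) (auto intro!: borel_measurable_pmul measurable_compose[OF _
        borel_measurable_pcnj])
    also have "\<dots> = conv_at h (lcnj h) n"
      by (rule fcoef_pmul) (use l2_fun_lcnj[of h] in \<open>auto simp: H_def intro: measurable_compose[OF
        _ borel_measurable_pcnj]\<close>)
    also have "\<dots> = 0" using h(1) \<open>n < 0\<close> by (simp add: conv_at_pos_neg)
    finally show "conv_at (fourier R) g n = 0" .
  qed
  \<comment> \<open>The determinant of \<open>U\<close>. As \<open>H\<close> is
    \<open>pcnj U\<close> times \<open>R\<close>, the conjugate of \<open>G\<close> is
    \<open>D\<close> times \<open>R\<close>; being central, \<open>D\<close> can be moved to the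
    left of \<open>G\<close> itself.\<close>
  define D where "D = (\<lambda>t. pcnj (U t) \<odot> U t)"
  have uD: "AE t in circ. punit (D t)"
    using GUH by eventually_elim (simp add: D_def punit_pmul punit_pcnj)
  have sD: "sqf D"
  proof (rule sqf_bounded[where c = 1])
    show "psym D" unfolding D_def by (intro psym_intros(4,5) sym)
    show "AE t in circ. norm (D t) \<le> 1" using uD by eventually_elim (simp add: punit_norm)
  qed
  have D0: "fcoef D n = conv_at (lcnj \<psi>) \<psi> n" for n
    unfolding D_def by (rule fcoef_pmul) (use l2_fun_lcnj[of \<psi>] in \<open>auto simp: U_def intro:
      measurable_compose[OF _ borel_measurable_pcnj]\<close>)
  \<comment> \<open>\<open>padj D\<close> is the left quotient of the conjugate of \<open>R\<close>
    by \<open>G\<close>, so cyclicity removes its negative coefficients. \<open>D\<close> itself has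
    none, as a product of Hardy space elements, and is therefore constant.\<close>
  have "pos (fourier (\<lambda>t. padj (D t)))"
  proof (rule l2_cyclic_AE_pos[OF c])
    show "pos (lcnj (fourier R))" using pR by simp
    show "AE t in circ. l2_fun (fourier (\<lambda>t. padj (D t))) t \<odot> l2_fun g t
      = l2_fun (lcnj (fourier R)) t"
      using l2_fun_fourier[OF sqf_padj[OF sD]] l2_fun_lcnj[of "fourier R"] l2_fun_fourier[OF sR] GUH
        uD
    proof eventually_elim
      case (elim t)
      have "pcnj (U t) \<odot> R t = H t"
        using punit_swap[OF punit_pcnj[of "U t"]] elim by (simp add: R_def flip: pmul_assoc)
      then have "pcnj (G t) = U t \<odot> pcnj (U t) \<odot> R t" using elim by (simp add: pmul_assoc)
      also have "U t \<odot> pcnj (U t) = D t" by (simp add: D_def pcnj_pmul_self pdet_def)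
      finally have "G t = pcnj (R t) \<odot> pcnj (D t)" by (metis pcnj_pcnj pcnj_pmul)
      also have "\<dots> = D t \<odot> pcnj (R t)" by (simp add: D_def pcnj_pmul_self pcnj_pdet pdet_central)
      finally show ?case using elim by (simp add: punit_def G_def flip: pmul_assoc)
    qed
  qed
  then have Dp: "fcoef D n = 0" if "0 < n" for n
    using that by (auto simp: pos_def cf_fourier sqf_padj sD fcoef_padj sqf_integrable)
      (metis neg_0_less_iff_less neg_less_0_iff_less qcnj_simps(4,7) add.inverse_inverse)
  have Dn: "fcoef D n = 0" if "n < 0" for n
    unfolding D0 using \<psi>(2) that by (simp add: conv_at_pos_neg)
  have "AE t in circ. D t = pexp 0 (fcoef D 0) t"
  proof (rule sqf_AE_eqI[OF sD sqf_pexp])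
    show "fcoef D n = fcoef (pexp 0 (fcoef D 0)) n" for n
      using Dp[of n] Dn[of n] by (cases n "0 :: int" rule: linorder_cases) (auto simp: fcoef_pexp)
  qed
  with uD have "AE t in circ. norm (fcoef D 0) = 1"
    by eventually_elim (metis punit_norm norm_pexp)
  then have "norm (fcoef D 0) = 1" by simp
  \<comment> \<open>The coefficient at 0 is multiplicative on the Hardy space, so the unimodular
    constant \<open>D\<close> forces the coefficient of \<open>\<psi>\<close> at 0 to have norm
    1.\<close>
  moreover have "norm (fcoef D 0) = (norm (cf \<psi> 0))\<^sup>2"
    unfolding D0 using \<psi>(2) by (simp add: conv_at_pos_0 norm_mult power2_eq_square)
  ultimately have "norm (cf \<psi> 0) = 1" by (simp add: power2_eq_1_iff) (smt (verit) norm_ge_zero)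
  then show ?thesis by (intro l2_cyclic_of_constant[OF \<psi>(1,3)]) simp
qed

text \<open>Condition (ii) without reciprocals: \<open>k\<close> is a square-integrable left
  quotient of \<open>h\<close> by \<open>g\<close>.\<close>

definition div_closed :: "l2 \<Rightarrow> bool" where
  "div_closed g \<longleftrightarrow> (\<forall>h k. pos h \<longrightarrow> (AE t in circ. l2_fun k t \<odot> l2_fun g t = l2_fun h t) \<longrightarrow> pos k)"

theorem l2_cyclic_iff_div_closed:
  assumes g: "pos g" "g \<noteq> 0"
  shows "l2_cyclic g \<longleftrightarrow> div_closed g"
proof
  assume "l2_cyclic g"
  then show "div_closed g" unfolding div_closed_def using l2_cyclic_AE_pos by blast
next
  assume d: "div_closed g"
  obtain \<phi> h where \<phi>: "\<phi> \<in> shift_closure 0 g" "pos \<phi>" "norm \<phi> = 1" "pos h"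
    "AE t in circ. l2_fun h t = padj (l2_fun \<phi> t) \<odot> l2_fun g t"
    using inner_factorization[OF g] by metis
  have "AE t in circ. l2_fun (ladj \<phi>) t \<odot> l2_fun g t = l2_fun h t"
    using l2_fun_ladj[of \<phi>] \<phi>(5) by eventually_elim simp
  then have "pos (ladj \<phi>)" using d \<phi>(4) by (auto simp: div_closed_def)
  then have "cf \<phi> n = 0" if "n \<noteq> 0" for n
  proof (cases "n < 0")
    case False
    then have "qcnj (cf \<phi> (- (- n))) = 0" using that \<open>pos (ladj \<phi>)\<close>
      by (auto simp: pos_def simp del: minus_minus)
    then show ?thesis by (metis minus_minus qcnj_simps(4,7))
  qed (use \<phi>(2) in \<open>auto simp: pos_def\<close>)
  then have "\<phi> = single 0 (cf \<phi> 0)" by (intro l2_eqI) simp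
  then have "1 \<le> norm (cf \<phi> 0)" using \<phi>(3) by (metis norm_single order_refl)
  then show "l2_cyclic g" by (rule l2_cyclic_of_constant[OF \<phi>(1,3)])
qed

section \<open>Evaluation in the ball\<close>

text \<open>Takes an arbitrary sequence because it is also applied to the merely bounded
  convolutions \<open>conv_at a b\<close>. Negative indices are ignored.\<close>

definition ball_eval :: "(int \<Rightarrow> quat) \<Rightarrow> quat \<Rightarrow> quat" where
  "ball_eval s q = (\<Sum>n. q ^ n * s (int n))"

lemma summable_ball_eval:
  assumes s: "\<And>n. norm (s n) \<le> C" and q: "norm q < 1"
  shows "summable (\<lambda>n. q ^ n * s (int n))" "norm (ball_eval s q) \<le> C / (1 - norm q)"
proof -
  have le: "norm (q ^ n * s (int n)) \<le> C * norm q ^ n" for n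
    using mult_left_mono[OF s, of "norm q ^ n" "int n"]
      by (simp add: norm_mult norm_power mult.commute)
  have geo: "summable (\<lambda>n. C * norm q ^ n)"
    using q by (intro summable_mult summable_geometric) simp
  show "summable (\<lambda>n. q ^ n * s (int n))"
    by (rule summable_comparison_test'[OF geo, of 0]) (rule le)
  have "norm (ball_eval s q) \<le> (\<Sum>n. C * norm q ^ n)"
    unfolding ball_eval_def by (rule norm_suminf_le[OF le geo])
  also have "\<dots> = C / (1 - norm q)"
    using q by (subst suminf_mult) (simp_all add: suminf_geometric summable_geometric)
  finally show "norm (ball_eval s q) \<le> C / (1 - norm q)" .
qed

lemma bounded_linear_ball_eval:
  assumes f: "\<And>n. bounded_linear (\<lambda>a. f a n)" and le: "\<And>a n. norm (f a n) \<le> C * norm a"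
    and q: "norm q < 1"
  shows "bounded_linear (\<lambda>a. ball_eval (f a) q)"
proof (rule bounded_linear_intro)
  fix a b r
  have s: "summable (\<lambda>n. q ^ n * f a (int n))" for a by (rule summable_ball_eval(1)[OF le q])
  show "ball_eval (f (a + b)) q = ball_eval (f a) q + ball_eval (f b) q"
    unfolding ball_eval_def using s by (simp add: suminf_add linear_simps[OF f] distrib_left)
  show "ball_eval (f (r *\<^sub>R a)) q = r *\<^sub>R ball_eval (f a) q"
    unfolding ball_eval_def using s by (simp add: suminf_scaleR_right linear_simps[OF f])
  show "norm (ball_eval (f a) q) \<le> norm a * (C / (1 - norm q))"
    using summable_ball_eval(2)[OF le q, of a] by (simp add: mult.commute)
qed

lemma conj_power: "a \<noteq> 0 \<Longrightarrow> a * (inverse a * q * a) ^ n = q ^ n * (a :: quat)"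
proof (induction n)
  case (Suc n)
  have "a * (inverse a * q * a) ^ Suc n = a * (inverse a * q * a) * (inverse a * q * a) ^ n"
    by (simp add: mult.assoc)
  also have "a * (inverse a * q * a) = q * a"
    using Suc.prems by (simp flip: mult.assoc)
  also have "q * a * (inverse a * q * a) ^ n = q * (a * (inverse a * q * a) ^ n)"
    by (simp only: mult.assoc)
  finally show ?case using Suc by (simp add: mult.assoc)
qed simp

lemma norm_conj: "a \<noteq> 0 \<Longrightarrow> norm (inverse a * q * a) = norm (q :: quat)"
  by (simp add: norm_mult norm_inverse)

lemma bounded_linear_ev: "norm q < 1 \<Longrightarrow> bounded_linear (\<lambda>a. ball_eval (cf a) q)"
  by (rule bounded_linear_ball_eval[of cf 1]) (auto simp: bounded_linear_cf norm_cf_le)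

lemma ball_eval_single: "0 \<le> k \<Longrightarrow> ball_eval (cf (single k \<beta>)) q = q ^ nat k * \<beta>"
proof -
  assume "0 \<le> k"
  then have "ball_eval (cf (single k \<beta>)) q = (\<Sum>n\<in>{nat k}. q ^ n * cf (single k \<beta>) (int n))"
    unfolding ball_eval_def by (intro suminf_finite) auto
  then show ?thesis using \<open>0 \<le> k\<close> by simp
qed

text \<open>Both sides are bounded and linear in \<open>b\<close>, since the convolution
  coefficients are uniformly bounded. It remains to compare monomials, where moving powers of
  \<open>q\<close> past \<open>A\<close> produces the conjugated point.\<close>

lemma ball_eval_conv_at:
  assumes a: "pos a" and b: "pos b" and q: "norm q < 1"
  defines "A \<equiv> ball_eval (cf a) q"
  shows "ball_eval (conv_at a b) q = A * ball_eval (cf b) (inverse A * q * A)"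
proof -
  define p where "p = inverse A * q * A"
  \<comment> \<open>For \<open>A = 0\<close> the default \<open>inverse A = 0\<close> gives
    \<open>p = 0\<close>, which is also in the ball.\<close>
  have p: "norm p < 1" unfolding p_def using q norm_conj[of A q] by (cases "A = 0") auto
  have Ap: "A * p ^ n = q ^ n * A" for n
    unfolding p_def using conj_power[of A q n] by (cases "A = 0") auto
  have bl: "bounded_linear (\<lambda>b. ball_eval (conv_at a b) q - A * ball_eval (cf b) p)"
    by (intro bounded_linear_sub bounded_linear_const_mult bounded_linear_ev p
        bounded_linear_ball_eval[OF bounded_linear_conv_at norm_conv_at_le q])
  have "ball_eval (conv_at a b) q - A * ball_eval (cf b) p = 0"
  proof (rule pos_induct_linear[OF bl _ b])
    fix k :: int and \<beta> assume k: "0 \<le> k"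
    have "ball_eval (conv_at a (single k \<beta>)) q = (\<Sum>n. q ^ n * (cf a (int n - k) * \<beta>))"
      by (simp add: ball_eval_def conv_at_single)
    also have "\<dots> = (\<Sum>n. q ^ (n + nat k) * (cf a (int (n + nat k) - k) * \<beta>))"
    proof -
      have s: "summable (\<lambda>n. q ^ n * (cf a (int n - k) * \<beta>))"
        using summable_ball_eval(1)[of "\<lambda>n. conv_at a (single k \<beta>) n", OF norm_conv_at_le q]
          by (simp add: conv_at_single)
      have "(\<Sum>n<nat k. q ^ n * (cf a (int n - k) * \<beta>)) = 0"
        using a by (intro sum.neutral) (auto simp: pos_def)
      then show ?thesis using suminf_split_initial_segment[OF s, of "nat k"] by simp
    qed
    also have "\<dots> = (\<Sum>n. q ^ nat k * (q ^ n * cf a (int n)) * \<beta>)"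
      using k by (simp add: power_add mult.assoc) (simp add: mult.assoc[symmetric] power_commutes
        power_add[symmetric] add.commute)
    also have "\<dots> = q ^ nat k * A * \<beta>"
    proof -
      have s: "summable (\<lambda>n. q ^ n * cf a (int n))" by (rule summable_ball_eval(1)[OF norm_cf_le q])
      have "bounded_linear (\<lambda>x. q ^ nat k * x * \<beta>)"
        by (rule bounded_linear_compose[OF bounded_linear_mult_left bounded_linear_mult_right])
      from bounded_linear.suminf[OF this s] show ?thesis
        unfolding A_def ball_eval_def by simp
    qed
    also have "\<dots> = A * ball_eval (cf (single k \<beta>)) p"
      using k by (simp add: ball_eval_single Ap flip: mult.assoc)
    finally show "ball_eval (conv_at a (single k \<beta>)) q - A * ball_eval (cf (single k \<beta>)) p = 0"
      by simp
  qed
  then show ?thesis by (simp add: p_def)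
qed

text \<open>The reproducing kernel at \<open>q\<close>, with coefficients \<open>qcnj q ^ n\<close>.
  Its value at \<open>q\<close> equals its squared norm, which makes the bound on evaluation
  sharp.\<close>

lemma Szego_kernel:
  assumes q: "norm q < 1"
  obtains y where "pos y" "(norm y)\<^sup>2 = 1 / (1 - (norm q)\<^sup>2)"
    "ball_eval (cf y) q = of_real ((norm y)\<^sup>2)"
    "\<forall>a. norm (ball_eval (cf a) q) \<le> norm a * norm y"
proof -
  define k :: "int \<Rightarrow> quat" where "k = (\<lambda>n. if 0 \<le> n then qcnj q ^ nat n else 0)"
  define N where "N = 1 / (1 - (norm q)\<^sup>2)"
  have q2: "(norm q)\<^sup>2 < 1" using q by (simp add: power_less_one_iff abs_square_less_1)
  have hs: "((\<lambda>n. f (int n)) has_sum S) UNIV \<Longrightarrow> (f has_sum S) UNIV" if "\<And>n. n < 0 \<Longrightarrow> f n = 0"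
    for f :: "int \<Rightarrow> real" and S
  proof -
    assume "((\<lambda>n. f (int n)) has_sum S) UNIV"
    then have "((f \<circ> int) has_sum S) UNIV" by (simp add: o_def)
    then have "(f has_sum S) (range int)"
      by (subst has_sum_reindex) (auto simp: inj_on_def)
    then show "(f has_sum S) UNIV"
    proof (rule has_sum_cong_neutral[THEN iffD1, rotated -1])
      fix n assume "n \<in> UNIV - range int"
      then have "n < 0" by (metis DiffE UNIV_I nonneg_int_cases not_less rangeI)
      then show "f n = 0" by (rule that)
    qed auto
  qed
  have geo: "((\<lambda>n. ((norm q)\<^sup>2) ^ n) has_sum N) UNIV"
    unfolding N_def using q2
    by (intro sums_nonneg_imp_has_sum geometric_sums) (auto simp: norm_power)
  have kn: "((\<lambda>n. (norm (k n))\<^sup>2) has_sum N) UNIV"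
  proof (rule hs)
    show "((\<lambda>n. (norm (k (int n)))\<^sup>2) has_sum N) UNIV"
      using geo by (simp add: k_def norm_power power_mult[symmetric] mult.commute)
  qed (simp add: k_def)
  define y where "y = Abs_l2 k"
  have y: "cf y n = k n" for n
    unfolding y_def using kn by (subst Abs_l2_inverse) (auto simp: summable_on_def)
  have "pos y" by (simp add: pos_def y k_def)
  moreover have ny: "(norm y)\<^sup>2 = N"
    using has_sum_norm_l2[of y] kn has_sum_unique unfolding y by blast
  moreover have "ball_eval (cf y) q = of_real N"
  proof -
    have qq: "q ^ n * qcnj q ^ n = of_real (((norm q)\<^sup>2) ^ n)" for n
    proof (induction n)
      case (Suc n)
      have "q ^ Suc n * qcnj q ^ Suc n = q * (q ^ n * qcnj q ^ n) * qcnj q"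
        by (simp add: mult.assoc power_commutes)
      also have "\<dots> = of_real (((norm q)\<^sup>2) ^ n) * (q * qcnj q)"
        unfolding Suc by (simp add: of_real_def)
      finally show ?case
        unfolding qcnj_mult_self of_real_mult[symmetric] power_Suc2[of "(norm q)\<^sup>2"] .
    qed simp
    have "(\<lambda>n. ((norm q)\<^sup>2) ^ n) sums N"
      unfolding N_def using q2 by (intro geometric_sums) (simp add: norm_power)
    then have "(\<lambda>n. of_real (((norm q)\<^sup>2) ^ n) :: quat) sums of_real N" by (rule sums_of_real)
    then show ?thesis unfolding ball_eval_def y k_def using qq by (simp add: sums_iff)
  qed
  moreover have "norm (ball_eval (cf a) q) \<le> norm a * norm y" for a
  proof (cases "ball_eval (cf a) q = 0")
    case False
    \<comment> \<open>Pairing the power series with its own value turns evaluation into an inner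
      product of \<open>a\<close> with the kernel times \<open>\<alpha>\<close>.\<close>
    define \<alpha> where "\<alpha> = ball_eval (cf a) q"
    have s: "summable (\<lambda>n. q ^ n * cf a (int n))" by (rule summable_ball_eval(1)[OF norm_cf_le q])
    have "qcnj q ^ n = qcnj (q ^ n)" for n
    proof (induction n)
      case (Suc n)
      have "qcnj (q ^ Suc n) = qcnj q * qcnj (q ^ n)" by (simp only: power_Suc2 qcnj_simps)
      then show ?case by (simp add: Suc)
    qed simp
    then have ie: "inner (q ^ n * cf a (int n)) \<alpha>
      = inner (cf a (int n)) (cf (shift_mult 0 \<alpha> y) (int n))" for n
      by (simp add: y k_def inner_quat_mult(1))
    have "(\<lambda>n. inner (q ^ n * cf a (int n)) \<alpha>) sums inner \<alpha> \<alpha>"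
      using bounded_linear.sums[OF bounded_linear_inner_left summable_sums[OF s], of \<alpha>]
      by (simp add: \<alpha>_def ball_eval_def)
    moreover have "(\<lambda>n. inner (q ^ n * cf a (int n)) \<alpha>) sums inner a (shift_mult 0 \<alpha> y)"
    proof -
      have "((\<lambda>n. inner (cf a n) (cf (shift_mult 0 \<alpha> y) n)) has_sum inner a (shift_mult 0 \<alpha> y))
        (range int)"
        using has_sum_inner_l2[of a "shift_mult 0 \<alpha> y"]
      proof (rule has_sum_cong_neutral[THEN iffD1, rotated -1])
        fix n assume "n \<in> UNIV - range int"
        then have "n < 0" by (metis DiffE UNIV_I nonneg_int_cases not_less rangeI)
        then show "inner (cf a n) (cf (shift_mult 0 \<alpha> y) n) = 0" by (simp add: y k_def)
      qed auto
      then have "(((\<lambda>n. inner (cf a n) (cf (shift_mult 0 \<alpha> y) n)) \<circ> int) has_sum inner a (shift_mult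
        0 \<alpha> y)) UNIV"
        by (subst (asm) has_sum_reindex) (auto simp: inj_on_def)
      then show ?thesis unfolding o_def ie[symmetric] by (rule has_sum_imp_sums)
    qed
    ultimately have "inner \<alpha> \<alpha> = inner a (shift_mult 0 \<alpha> y)" by (rule sums_unique2)
    also have "\<dots> \<le> norm a * norm (shift_mult 0 \<alpha> y)" by (rule norm_cauchy_schwarz)
    finally have "norm \<alpha> * norm \<alpha> \<le> norm a * norm y * norm \<alpha>"
      by (simp add: power2_norm_eq_inner mult.assoc flip: power2_eq_square)
    then show ?thesis using False by (simp add: \<alpha>_def)
  qed simp
  ultimately show ?thesis using that unfolding N_def by metis
qed

text \<open>Schwarz lemma for the unimodular multiplier \<open>w\<close>: test it on the Szego kernel of the point
  at which the second factor of the star product is evaluated.\<close>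

lemma norm_ball_eval_le_1:
  assumes w: "pos w" "AE t in circ. punit (l2_fun w t)" and q: "norm q < 1"
  shows "norm (ball_eval (cf w) q) \<le> 1"
proof (cases "ball_eval (cf w) q = 0")
  case False
  define A where "A = ball_eval (cf w) q"
  define p where "p = inverse A * q * A"
  have p: "norm p = norm q" unfolding p_def using False by (intro norm_conj) (simp add: A_def)
  obtain x where "pos x" and x: "(norm x)\<^sup>2 = 1 / (1 - (norm q)\<^sup>2)"
    and "ball_eval (cf x) q = of_real ((norm x)\<^sup>2)"
      and x': "\<forall>a. norm (ball_eval (cf a) q) \<le> norm a * norm x"
    by (rule Szego_kernel[OF q]) blast
  \<comment> \<open>Since \<open>p\<close> and \<open>q\<close> have equal norm, the kernels at both
    points have squared norm \<open>N\<close>. The product of \<open>w\<close> and \<open>y\<close>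
    has the value \<open>A * N\<close> at \<open>q\<close> and the same norm as \<open>y\<close>;
    the evaluation bound at \<open>q\<close> then gives \<open>norm A \<le> 1\<close>.\<close>
  obtain y where y: "pos y" "(norm y)\<^sup>2 = 1 / (1 - (norm p)\<^sup>2)"
    "ball_eval (cf y) p = of_real ((norm y)\<^sup>2)"
    using Szego_kernel[of p] q unfolding p by metis
  note ny = y(2)[unfolded p]
  note y = y(1) y(2)[unfolded p] y(3)[unfolded ny]
  define N where "N = 1 / (1 - (norm q)\<^sup>2)"
  have "(norm q)\<^sup>2 < 1" using q by (simp add: power_less_one_iff abs_square_less_1)
  then have N: "0 < N" by (simp add: N_def)
  define v where "v = (\<lambda>t. l2_fun w t \<odot> l2_fun y t)"
  have nv: "AE t in circ. norm (v t) = norm (l2_fun y t)"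
    using w(2) by eventually_elim (simp add: v_def punit_norm_pmul)
  have pv: "psym v" unfolding v_def by (intro psym_intros(4) sqf_psym sqf_l2_fun)
  have sv: "sqf v"
    by (rule sqf_bound[where u = "l2_fun y" and c = 1, OF pv sqf_l2_fun]) (use nv in auto)
  have "(norm (fourier v))\<^sup>2 = (norm y)\<^sup>2"
  proof -
    have "(norm (fourier v))\<^sup>2 = (\<integral>t. (norm (v t))\<^sup>2 \<partial>circ)" by (simp add: Parseval sv)
    also have "\<dots> = (\<integral>t. (norm (l2_fun y t))\<^sup>2 \<partial>circ)"
      using nv sqf_measurable[OF sv] by (intro integral_cong_AE) auto
    finally show ?thesis by (simp add: Parseval sqf_l2_fun)
  qed
  then have nfv: "norm (fourier v) = norm y" by simp
  have "cf (fourier v) = conv_at w y"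
    by (rule ext) (simp only: cf_fourier[OF sv], simp add: v_def conv_at_def)
  then have "ball_eval (cf (fourier v)) q = A * of_real N"
    using ball_eval_conv_at[OF w(1) y(1) q] y(3) by (simp add: A_def p_def N_def)
  then have "norm A * N \<le> norm y * norm x"
    using x'[rule_format, of "fourier v"] N by (simp add: norm_mult nfv)
  also have "norm y * norm x = N"
  proof -
    have "norm x = norm y" using x y(2) by (metis norm_ge_zero power2_eq_imp_eq)
    then show ?thesis using y(2) by (simp add: N_def power2_eq_square)
  qed
  finally show ?thesis using N by (simp add: A_def)
qed simp

text \<open>Outerness in terms of coefficients. The modulus may vary over a sphere; its equality for
  \<open>f\<close> and \<open>g\<close> at all points amounts to equality of the pairs multiplied by
  their adjoints.\<close>

definition dominating :: "l2 \<Rightarrow> bool" where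
  "dominating g \<longleftrightarrow> (\<forall>f. pos f \<longrightarrow>
     (AE t in circ. l2_fun f t \<odot> padj (l2_fun f t) = l2_fun g t \<odot> padj (l2_fun g t)) \<longrightarrow>
     (\<forall>q. norm q < 1 \<longrightarrow> norm (ball_eval (cf f) q) \<le> norm (ball_eval (cf g) q)))"

lemma measurable_pinv:
  "u \<in> borel_measurable borel \<Longrightarrow> (\<lambda>t. pinv (u t)) \<in> borel_measurable borel"
  unfolding pinv_def pdet_def
  by (intro borel_measurable_scaleR borel_measurable_inverse borel_measurable_power
      borel_measurable_norm borel_measurable_pmul measurable_compose[OF _ borel_measurable_padj]
      measurable_compose[OF _ borel_measurable_pcnj]) auto

lemma pflip_pinv: "pinv (pflip x) = pflip (pinv x)"
proof -
  have "norm (pdet (pflip x)) = norm (pdet x)" by (metis pflip_pdet norm_pcnj(3))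
  then show ?thesis by (simp add: pinv_def pflip_pmul pflip_pcnj pflip_padj pflip_pdet)
qed

lemma psym_pinv: "psym u \<Longrightarrow> psym (\<lambda>t. pinv (u t))"
  by (simp add: psym_def measurable_pinv pflip_pinv)

text \<open>The right quotient of \<open>f\<close> by \<open>g\<close> is unitary on the boundary.
  Once it is known to lie in the Hardy space, the evaluation formula and the Schwarz bound give the
  inequality.\<close>

theorem l2_cyclic_imp_dominating:
  assumes g: "pos g" "g \<noteq> 0" and c: "l2_cyclic g"
  shows "dominating g"
  unfolding dominating_def
proof (intro allI impI)
  fix f and q :: quat
  assume f: "pos f" and eq: "AE t in circ. l2_fun f t \<odot> padj (l2_fun f t)
    = l2_fun g t \<odot> padj (l2_fun g t)" and q: "norm q < 1"
  define W where "W = (\<lambda>t. pinv (l2_fun g t) \<odot> l2_fun f t)"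
  have W: "AE t in circ. l2_fun g t \<odot> W t = l2_fun f t \<and> punit (W t)"
    using eq pdet_AE_neq_0[OF g]
  proof eventually_elim
    case (elim t)
    note inv = pinv_mult[OF elim(2)]
    have "W t \<odot> padj (W t) = pinv (l2_fun g t) \<odot> (l2_fun f t \<odot> padj (l2_fun f t)) \<odot> padj (pinv
      (l2_fun g t))"
      by (simp add: W_def padj_pmul pmul_assoc)
    also have "\<dots> = (pinv (l2_fun g t) \<odot> l2_fun g t) \<odot> padj (pinv (l2_fun g t) \<odot> l2_fun g t)"
      unfolding elim(1) by (simp add: padj_pmul pmul_assoc)
    also have "\<dots> = (1, 0)" by (simp add: inv(1) padj_def)
    finally have "punit (padj (W t))" by (simp add: punit_def)
    from punit_padj[OF this] have "punit (W t)" by simp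
    then show ?case by (simp add: W_def inv(2) flip: pmul_assoc)
  qed
  have sW: "sqf W"
  proof (rule sqf_bounded[of _ 1])
    show "psym W" unfolding W_def by (intro psym_intros(4) psym_pinv sqf_psym sqf_l2_fun)
    show "AE t in circ. norm (W t) \<le> 1" using W by eventually_elim (simp add: punit_norm)
  qed
  define w where "w = fourier W"
  have fw: "AE t in circ. l2_fun w t = W t" unfolding w_def by (rule l2_fun_fourier[OF sW])
  \<comment> \<open>Cyclicity controls left quotients, whereas \<open>w\<close> stands to the right
    of \<open>g\<close>. Conjugation exchanges the sides, and \<open>lcnj g\<close> is cyclic
    too.\<close>
  have "pos (lcnj w)"
  proof (rule l2_cyclic_AE_pos[OF l2_cyclic_lcnj[OF g c]])
    show "pos (lcnj f)" using f by simp
    show "AE t in circ. l2_fun (lcnj w) t \<odot> l2_fun (lcnj g) t = l2_fun (lcnj f) t"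
      using l2_fun_lcnj[of w] l2_fun_lcnj[of g] l2_fun_lcnj[of f] fw W
      by eventually_elim (simp flip: pcnj_pmul)
  qed
  then have w: "pos w" by simp
  have "cf f = conv_at g w"
    by (rule ext, rule AE_cf_eq[symmetric]) (use fw W in eventually_elim, simp)
  then have "ball_eval (cf f) q = ball_eval (cf g) q * ball_eval (cf w) (inverse (ball_eval (cf g)
    q) * q * ball_eval (cf g) q)"
    using ball_eval_conv_at[OF g(1) w q] by simp
  moreover have "norm (ball_eval (cf w) (inverse (ball_eval (cf g) q) * q * ball_eval (cf g) q))
    \<le> 1"
  proof (rule norm_ball_eval_le_1[OF w])
    show "AE t in circ. punit (l2_fun w t)" using fw W by eventually_elim simp
    show "norm (inverse (ball_eval (cf g) q) * q * ball_eval (cf g) q) < 1"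
      using norm_conj[of "ball_eval (cf g) q" q] q by (cases "ball_eval (cf g) q = 0") auto
  qed
  ultimately show "norm (ball_eval (cf f) q) \<le> norm (ball_eval (cf g) q)"
    by (simp add: norm_mult mult_left_le)
qed

text \<open>Leading term at small positive real points. The factor 2 is the sum of the geometric
  series of ratio 1/2 that dominates the tail.\<close>

lemma ball_eval_lowest:
  assumes low: "\<And>k. k < m \<Longrightarrow> cf a (int k) = 0" and x: "0 < x" "x \<le> 1/2"
  shows "norm (ball_eval (cf a) (of_real x) - x ^ m *\<^sub>R cf a (int m)) \<le> 2 * norm a * x ^ Suc m"
proof -
  define T where "T = (\<lambda>n. (of_real x :: quat) ^ n * cf a (int n))"
  have nx: "norm (of_real x :: quat) < 1" using x by simp
  have s: "summable T" unfolding T_def by (rule summable_ball_eval(1)[OF norm_cf_le nx])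
  have "(\<Sum>n<Suc m. T n) = T m" using low by (simp add: T_def)
  then have "ball_eval (cf a) (of_real x) - T m = (\<Sum>n. T (n + Suc m))"
    using suminf_split_initial_segment[OF s, of "Suc m"] by (simp add: ball_eval_def T_def)
  also have "norm \<dots> \<le> (\<Sum>n. norm a * x ^ Suc m * (1/2) ^ n)"
  proof (rule norm_suminf_le)
    show "norm (T (n + Suc m)) \<le> norm a * x ^ Suc m * (1/2) ^ n" for n
    proof -
      have "norm (T (n + Suc m)) = x ^ Suc m * x ^ n * norm (cf a (int (n + Suc m)))"
        using x by (simp add: T_def norm_mult norm_power power_add mult_ac)
      also have "\<dots> \<le> x ^ Suc m * (1/2) ^ n * norm a"
        using x by (intro mult_mono power_mono norm_cf_le) auto
      finally show ?thesis by (simp add: mult_ac)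
    qed
  qed (intro summable_mult summable_geometric, simp)
  also have "\<dots> = 2 * norm a * x ^ Suc m"
    by (subst suminf_mult) (simp_all add: suminf_geometric summable_geometric)
  also have "T m = x ^ m *\<^sub>R cf a (int m)"
    by (simp add: T_def scaleR_conv_of_real)
  finally show ?thesis .
qed

theorem dominating_imp_l2_cyclic:
  assumes g: "pos g" "g \<noteq> 0" and d: "dominating g"
  shows "l2_cyclic g"
proof -
  have g': "pos (lcnj g)" "lcnj g \<noteq> 0" using g lcnj_neq_0 by auto
  obtain \<psi> h where \<psi>: "\<psi> \<in> shift_closure 0 (lcnj g)" "pos \<psi>" "norm \<psi> = 1"
    "AE t in circ. punit (l2_fun \<psi> t)"
    and h: "pos h" "AE t in circ. l2_fun h t = padj (l2_fun \<psi> t) \<odot> l2_fun (lcnj g) t"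
    by (rule inner_factorization[OF g']) blast
  \<comment> \<open>Conjugation puts the inner factor on the right, so that \<open>k\<close> has the
    same boundary modulus as \<open>g\<close> and competes with it in
    \<open>dominating\<close>.\<close>
  define k where "k = lcnj h"
  have k: "pos k" using h(1) by (simp add: k_def)
  have GK: "AE t in circ. l2_fun k t \<odot> l2_fun (lcnj \<psi>) t = l2_fun g t \<and> punit (l2_fun (lcnj \<psi>) t)"
    using h(2) \<psi>(4) l2_fun_lcnj[of h] l2_fun_lcnj[of \<psi>] l2_fun_lcnj[of g]
  proof eventually_elim
    case (elim t)
    have "l2_fun \<psi> t \<odot> l2_fun h t = pcnj (l2_fun g t)"
      using elim punit_swap[OF elim(2)] by (simp flip: pmul_assoc)
    then have "pcnj (l2_fun h t) \<odot> pcnj (l2_fun \<psi> t) = l2_fun g t" by (metis pcnj_pcnj pcnj_pmul)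
    then show ?case using elim punit_pcnj by (simp add: k_def)
  qed
  have "AE t in circ. l2_fun k t \<odot> padj (l2_fun k t) = l2_fun g t \<odot> padj (l2_fun g t)"
    using GK
  proof eventually_elim
    case (elim t)
    have "l2_fun g t \<odot> padj (l2_fun g t) = l2_fun k t \<odot> (l2_fun (lcnj \<psi>) t \<odot> padj (l2_fun (lcnj \<psi>)
      t)) \<odot> padj (l2_fun k t)"
      using elim by (metis padj_pmul pmul_assoc)
    then show ?case using elim punit_swap by simp
  qed
  then have le: "norm (ball_eval (cf k) q) \<le> norm (ball_eval (cf g) q)" if "norm q < 1" for q
    using d k that by (auto simp: dominating_def)
  have cvg: "conv_at k (lcnj \<psi>) n = cf g n" for n
    by (rule AE_cf_eq) (use GK in eventually_elim, simp)
  have "k \<noteq> 0"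
  proof
    assume "k = 0"
    then have "cf g n = 0" for n
      using norm_conv_at_le[of k "lcnj \<psi>" n] unfolding cvg by (simp add: \<open>k = 0\<close>)
    then have "g = 0" by (intro l2_eqI) simp
    with g(2) show False ..
  qed
  obtain m where m: "cf k (int m) \<noteq> 0" "\<And>i. i < int m \<Longrightarrow> cf k i = 0"
    by (rule lowest_coefficient[OF k \<open>k \<noteq> 0\<close>]) blast
  have bl: "bounded_linear (\<lambda>b. conv_at k b n - cf k n * cf b 0)" for n
    by (intro bounded_linear_sub bounded_linear_conv_at bounded_linear_const_mult bounded_linear_cf)
  \<comment> \<open>\<open>k\<close> starts at index \<open>m\<close>, so up to degree
    \<open>m\<close> only the constant coefficient of the second factor contributes.\<close>
  have gl: "cf g (int j) = cf k (int j) * cf (lcnj \<psi>) 0" if "j \<le> m" for j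
  proof -
    have "conv_at k (lcnj \<psi>) (int j) - cf k (int j) * cf (lcnj \<psi>) 0 = 0"
    proof (rule pos_induct_linear[OF bl])
      fix i :: int and \<beta> assume "0 \<le> i"
      have "cf k (int j - i) = 0" if "0 < i"
        using that \<open>j \<le> m\<close> by (intro m(2)) simp
      then show "conv_at k (single i \<beta>) (int j) - cf k (int j) * cf (single i \<beta>) 0 = 0"
        using \<open>0 \<le> i\<close> by (cases "i = 0") (auto simp: conv_at_single)
    qed (use \<psi>(2) in simp)
    then show ?thesis by (simp add: cvg)
  qed
  \<comment> \<open>Both series have no terms below \<open>x ^ m\<close>. Comparing them at the real
    point \<open>x\<close> and letting \<open>x\<close> tend to 0 compares the coefficients at
    \<open>m\<close>.\<close>
  have bound: "norm (cf k (int m)) \<le> norm (cf g (int m)) + (2 * norm k + 2 * norm g) * x"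
    if x: "0 < x" "x \<le> 1/2" for x
  proof -
    let ?q = "of_real x :: quat"
    have "norm ?q < 1" using x by simp
    note le[OF this]
    moreover have "norm (ball_eval (cf k) ?q - x ^ m *\<^sub>R cf k (int m)) \<le> 2 * norm k * x ^ Suc m"
      by (rule ball_eval_lowest[OF _ x]) (simp add: m(2))
    moreover have "norm (ball_eval (cf g) ?q - x ^ m *\<^sub>R cf g (int m)) \<le> 2 * norm g * x ^ Suc m"
      by (rule ball_eval_lowest[OF _ x]) (simp add: gl m(2))
    moreover have "norm (x ^ m *\<^sub>R cf k (int m))
      \<le> norm (ball_eval (cf k) ?q) + norm (ball_eval (cf k) ?q - x ^ m *\<^sub>R cf k (int m))"
      by (metis norm_triangle_sub norm_minus_commute)
    moreover have "norm (ball_eval (cf g) ?q)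
      \<le> norm (x ^ m *\<^sub>R cf g (int m)) + norm (ball_eval (cf g) ?q - x ^ m *\<^sub>R cf g (int m))"
      by (rule norm_triangle_sub)
    ultimately have "norm (x ^ m *\<^sub>R cf k (int m))
      \<le> norm (x ^ m *\<^sub>R cf g (int m)) + 2 * norm g * x ^ Suc m + 2 * norm k * x ^ Suc m"
      by linarith
    then have "x ^ m * norm (cf k (int m))
      \<le> x ^ m * (norm (cf g (int m)) + (2 * norm k + 2 * norm g) * x)"
      using x by (simp add: algebra_simps)
    then show ?thesis using x by (simp add: mult_le_cancel_left_pos)
  qed
  have "norm (cf k (int m)) \<le> norm (cf g (int m)) + (2 * norm k + 2 * norm g) * 0"
  proof (rule tendsto_lowerbound)
    show "((\<lambda>x. norm (cf g (int m)) + (2 * norm k + 2 * norm g) * x) \<longlongrightarrow>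
        norm (cf g (int m)) + (2 * norm k + 2 * norm g) * 0) (at_right 0)"
      by (intro tendsto_intros)
    show "\<forall>\<^sub>F x in at_right 0. norm (cf k (int m))
      \<le> norm (cf g (int m)) + (2 * norm k + 2 * norm g) * x"
      unfolding eventually_at_right_field using bound by (intro exI[of _ "1/2"]) auto
  qed simp
  then have "norm (cf k (int m)) * 1 \<le> norm (cf k (int m)) * norm (cf \<psi> 0)"
    by (simp add: gl norm_mult)
  then have "1 \<le> norm (cf \<psi> 0)" using m(1) by (subst (asm) mult_le_cancel_left_pos) simp_all
  \<comment> \<open>The inner factor was taken from \<open>lcnj g\<close>; conjugating once more
    returns to \<open>g\<close>.\<close>
  then have "l2_cyclic (lcnj g)" by (rule l2_cyclic_of_constant[OF \<psi>(1,3)])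
  from l2_cyclic_lcnj[OF g' this] show ?thesis by simp
qed

section \<open>Slice functions and the measure on the boundary\<close>

definition on_sphere :: "(quat \<Rightarrow> quat) \<Rightarrow> real \<Rightarrow> quat \<times> quat \<Rightarrow> bool" where
  "on_sphere f t p \<longleftrightarrow> (\<forall>I\<in>imag_units. f (qcis t I) = fst p + I * snd p)"

abbreviation "iu \<equiv> Quat 0 1 0 0"

lemma iu_imag_units: "iu \<in> imag_units" "- iu \<in> imag_units"
  by (simp_all add: imag_units_eq norm_quat_def)

lemma uminus_imag_units: "I \<in> imag_units \<Longrightarrow> - I \<in> imag_units"
  by (simp add: imag_units_eq)

lemma imag_units_square: "I \<in> imag_units \<Longrightarrow> I * I = - 1"
  by (simp add: imag_units_def power2_eq_square)

lemma iu_square: "iu * iu = - 1" "iu * (iu * x) = - x"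
  by (simp_all add: quat_eq_iff)

text \<open>Solves \<open>b + iu * c\<close> and \<open>b - iu * c\<close> for \<open>b\<close> and
  \<open>c\<close>. For a slice function any other imaginary unit would give the same pair.\<close>

definition slice_pair :: "(quat \<Rightarrow> quat) \<Rightarrow> real \<Rightarrow> quat \<times> quat" where
  "slice_pair f t = ((1/2) *\<^sub>R (f (qcis t iu) + f (qcis (- t) iu)),
    (-1/2) *\<^sub>R (iu * (f (qcis t iu) - f (qcis (- t) iu))))"

lemma qcis_minus: "qcis (- t) I = qcis t (- I)"
  by (simp add: qcis_def)

lemma on_sphere_unique:
  assumes "on_sphere f t p" shows "p = slice_pair f t"
proof -
  have "f (qcis t iu) = fst p + iu * snd p" "f (qcis (- t) iu) = fst p - iu * snd p"
    using assms iu_imag_units unfolding qcis_minus by (auto simp: on_sphere_def)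
  then show ?thesis
    by (simp add: slice_pair_def prod_eq_iff iu_square scaleR_2[symmetric] flip:
      scaleR_right_diff_distrib mult_2)
qed

lemma slice_fun_on_sphere:
  assumes "slice_fun f" shows "on_sphere f t (slice_pair f t)"
  unfolding on_sphere_def
proof
  fix I assume I: "I \<in> imag_units"
  have bd: "of_real (cos t) + of_real (sin t) * I \<in> bdry"
    using I by (auto simp: bdry_def qcis_def)
  have ne: "iu \<noteq> - iu" by (simp add: quat_eq_iff)
  have inv: "inverse (iu - - iu) = (-1/2) *\<^sub>R iu"
  proof -
    have "(iu - - iu) * ((-1/2) *\<^sub>R iu) = 1" by (simp add: quat_eq_iff)
    then show ?thesis by (rule inverse_unique)
  qed
  have "f (qcis t I) = ((-1/2) *\<^sub>R iu * iu + I * ((-1/2) *\<^sub>R iu)) * f (qcis t iu)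
      - ((-1/2) *\<^sub>R iu * (- iu) + I * ((-1/2) *\<^sub>R iu)) * f (qcis t (- iu))"
    using assms iu_imag_units I bd ne unfolding slice_fun_def qcis_def inv[symmetric] by blast
  also have "\<dots> = fst (slice_pair f t) + I * snd (slice_pair f t)"
    unfolding slice_pair_def qcis_minus
    by (simp add: iu_square algebra_simps)
  finally show "f (qcis t I) = fst (slice_pair f t) + I * snd (slice_pair f t)" .
qed

lemma slice_funI:
  assumes "\<And>t. \<exists>p. on_sphere f t p" shows "slice_fun f"
  unfolding slice_fun_def
proof (intro ballI allI impI)
  fix J K I :: quat and x y :: real
  assume J: "J \<in> imag_units" and K: "K \<in> imag_units" and I: "I \<in> imag_units" and "J \<noteq> K"
    and bd: "of_real x + of_real y * I \<in> bdry"
  have "(norm (of_real x + of_real y * I))\<^sup>2 = x\<^sup>2 + y\<^sup>2"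
  proof -
    have "qRe I = 0" "(norm I)\<^sup>2 = 1" using I by (auto simp: imag_units_eq)
    then show ?thesis unfolding norm_quat_squared
      by (simp add: power_mult_distrib flip: distrib_left)
  qed
  moreover have "norm (of_real x + of_real y * I) = 1" using bd by (simp add: bdry_eq_sphere)
  ultimately have "x\<^sup>2 + y\<^sup>2 = 1" by simp
  then obtain t where t: "x = cos t" "y = sin t" using sincos_total_2pi by metis
  obtain p where p: "on_sphere f t p" using assms by blast
  have v: "f (of_real x + of_real y * L) = fst p + L * snd p" if "L \<in> imag_units" for L
    using p that by (auto simp: on_sphere_def qcis_def t)
  let ?d = "inverse (J - K)"
  have d: "?d * J - ?d * K = 1" using \<open>J \<noteq> K\<close> by (simp flip: right_diff_distrib)
  have "(?d * J + I * ?d) * (fst p + J * snd p) - (?d * K + I * ?d) * (fst p + K * snd p)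
      = (?d * J - ?d * K) * fst p + ?d * (J * J - K * K) * snd p + I * (?d * J - ?d * K) * snd p"
    by (simp add: algebra_simps)
  also have "\<dots> = fst p + I * snd p"
    unfolding d by (simp add: imag_units_square J K)
  finally show "f (of_real x + of_real y * I) = (?d * J + I * ?d) * f (of_real x + of_real y * J)
      - (?d * K + I * ?d) * f (of_real x + of_real y * K)"
    by (simp add: v I J K)
qed

lemma qcis_in_bdry: "I \<in> imag_units \<Longrightarrow> qcis t I \<in> bdry"
  by (auto simp: bdry_def)

lemma qcis_2pi_minus: "qcis (2 * pi - t) I = qcis (- t) I"
  by (simp add: qcis_def)

lemma sets_bdry_measure: "sets bdry_measure = sets (restrict_space borel bdry)"
  by (simp add: bdry_measure_def)

lemma measurable_qcis: "I \<in> imag_units \<Longrightarrow> (\<lambda>t. qcis t I) \<in> borel \<rightarrow>\<^sub>M bdry_measure"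
  unfolding measurable_cong_sets[OF refl sets_bdry_measure]
proof (rule measurable_restrict_space2)
  show "(\<lambda>t. qcis t I) \<in> borel \<rightarrow>\<^sub>M borel"
    unfolding qcis_def of_real_def by (intro borel_measurable_continuous_onI continuous_intros)
qed (auto simp: qcis_in_bdry)

lemma psym_slice_pair:
  assumes "f \<in> borel_measurable bdry_measure" shows "psym (slice_pair f)"
  unfolding psym_def
proof (intro conjI allI)
  have 1: "(\<lambda>t. f (qcis t I)) \<in> borel_measurable borel" if "I \<in> imag_units" for I
    by (rule measurable_compose[OF measurable_qcis[OF that] assms])
  have [measurable]: "(\<lambda>t. f (qcis t iu)) \<in> borel_measurable borel"
    "(\<lambda>t. f (qcis (- t) iu)) \<in> borel_measurable borel"
    unfolding qcis_minus by (intro 1 iu_imag_units)+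
  have "(\<lambda>t. (1/2) *\<^sub>R (f (qcis t iu) + f (qcis (- t) iu))) \<in> borel_measurable borel"
    "(\<lambda>t. (-1/2) *\<^sub>R (iu * (f (qcis t iu) - f (qcis (- t) iu)))) \<in> borel_measurable borel"
    by measurable
  then show "slice_pair f \<in> borel_measurable borel" unfolding slice_pair_def[abs_def]
    by (rule borel_measurable_Pair)
  show "slice_pair f (2 * pi - t) = pflip (slice_pair f t)" for t
  proof -
    have "qcis (- (2 * pi - t)) iu = qcis t iu" by (simp add: qcis_def cos_diff sin_diff)
    then show ?thesis
      by (simp add: slice_pair_def pflip_def qcis_2pi_minus add.commute) (simp add: algebra_simps)
  qed
qed

section \<open>Null sets of spheres and of imaginary units\<close>

lemma space_area: "space area_imag_units = imag_units"
  by (simp add: area_imag_units_def space_restrict_space)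

interpretation area: prob_space area_imag_units
  by (rule prob_space_area_imag_units)

interpretation ca: pair_prob_space circ area_imag_units
  by unfold_locales

lemma bdry_measure_eq: "bdry_measure = distr (circ \<Otimes>\<^sub>M area_imag_units) (restrict_space borel bdry)
  (\<lambda>(t, I). qcis t I)"
  by (simp add: bdry_measure_def circ_def)

lemma qcis_pair_measurable: "(\<lambda>(t, I). qcis t I)
  \<in> circ \<Otimes>\<^sub>M area_imag_units \<rightarrow>\<^sub>M restrict_space borel bdry"
  using qcis_measurable by (simp add: circ_def)

lemma AE_bdry_D:
  assumes "AE q in bdry_measure. P q"
  shows "AE t in circ. AE I in area_imag_units. P (qcis t I)"
proof -
  have "AE x in circ \<Otimes>\<^sub>M area_imag_units. P (case x of (t, I) \<Rightarrow> qcis t I)"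
    using AE_distrD[OF qcis_pair_measurable, of P] assms unfolding bdry_measure_eq .
  then have "AE x in circ \<Otimes>\<^sub>M area_imag_units. P (qcis (fst x) (snd x))"
    by (simp add: case_prod_beta)
  from ca.AE_pair[OF this] show ?thesis by simp
qed

lemma measurable_arccos_Re: "(\<lambda>q. arccos (qRe q)) \<in> borel_measurable (restrict_space borel bdry)"
proof (rule borel_measurable_continuous_on_restrict)
  have Re: "continuous_on bdry qRe"
    by (rule continuous_on_subset[OF linear_continuous_on[of qRe]])
      (auto intro!: bounded_linear_intro[of _ 1] simp: norm_quat_def intro!: real_le_rsqrt)
  have "\<bar>qRe q\<bar> \<le> 1" if "q \<in> bdry" for q
  proof -
    have "\<bar>qRe q\<bar> \<le> norm q" by (simp add: norm_quat_def real_le_rsqrt)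
    then show ?thesis using that by (simp add: bdry_eq_sphere)
  qed
  then show "continuous_on bdry (\<lambda>q. arccos (qRe q))"
    by (intro continuous_on_arccos Re) (auto simp: abs_le_iff)
qed

text \<open>The predicate need not be measurable, so Fubini's theorem is applied to a Borel null set
  \<open>N\<close> containing the exceptional angles, pulled back along the angle
  \<open>arccos (qRe q)\<close> of a point.\<close>

lemma AE_bdry_I:
  assumes "AE t in circ. \<forall>I\<in>imag_units. P (qcis t I)"
  shows "AE q in bdry_measure. P q"
proof -
  define Q where "Q = (\<lambda>t. \<forall>I\<in>imag_units. P (qcis t I))"
  obtain N where N: "N \<in> null_sets circ" "{t. \<not> Q t} \<subseteq> N"
    using assms unfolding Q_def[symmetric] by (rule AE_E3) auto
  have NS [measurable]: "N \<in> sets borel" using N(1) by (auto simp: null_sets_def)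
  have Nn: "AE t in circ. t \<notin> N" using N(1) by (rule AE_not_in)
  \<comment> \<open>Folding the period onto \<open>{0..pi}\<close> sends \<open>t\<close> to
    \<open>t\<close> or to \<open>2 * pi - t\<close>, so both have to avoid
    \<open>N\<close>.\<close>
  have sym: "AE t in circ. arccos (cos t) \<notin> N"
  proof -
    have "AE t in circ. t \<in> {0..2*pi}" unfolding AE_circ_iff by simp
    with Nn AE_circ_reflect[OF Nn] show ?thesis
    proof eventually_elim
      case (elim t)
      show ?case
      proof (cases "t \<le> pi")
        case True
        then show ?thesis using elim by (simp add: arccos_cos)
      next
        case False
        then have "arccos (cos (2 * pi - t)) = 2 * pi - t" using elim by (intro arccos_cos) auto
        moreover have "cos (2 * pi - t) = cos t" by (simp add: cos_diff)
        ultimately show ?thesis using elim by simp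
      qed
    qed
  qed
  have "AE q in bdry_measure. arccos (qRe q) \<notin> N"
    unfolding bdry_measure_eq
  proof (subst AE_distr_iff[OF qcis_pair_measurable])
    show "{q \<in> space (restrict_space borel bdry). arccos (qRe q) \<notin> N}
      \<in> sets (restrict_space borel bdry)"
      using measurable_arccos_Re by measurable
    have re: "qRe (qcis t I) = cos t" if "I \<in> imag_units" for t I
      using that by (simp add: qcis_def imag_units_eq)
    show "AE x in circ \<Otimes>\<^sub>M area_imag_units. arccos (qRe (case x of (t, I) \<Rightarrow> qcis t I)) \<notin> N"
    proof (rule ca.AE_pair_measure)
      have m: "(\<lambda>x. arccos (qRe (case x of (t, I) \<Rightarrow> qcis t I)))
        \<in> borel_measurable (circ \<Otimes>\<^sub>M area_imag_units)"
        by (rule measurable_compose[OF qcis_pair_measurable measurable_arccos_Re])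
      then show "{x \<in> space (circ \<Otimes>\<^sub>M area_imag_units). arccos (qRe (case x of (t,
        I) \<Rightarrow> qcis t I)) \<notin> N}
          \<in> sets (circ \<Otimes>\<^sub>M area_imag_units)"
        by measurable
      show "AE t in circ. AE I in area_imag_units. arccos (qRe (case (t, I) of (t,
        I) \<Rightarrow> qcis t I)) \<notin> N"
        using sym by eventually_elim (auto simp: re space_area intro!: AE_I2)
    qed
  qed
  moreover have "AE q in bdry_measure. q \<in> bdry"
    using AE_space[of bdry_measure] by (simp add: space_bdry_measure)
  ultimately show ?thesis
  proof eventually_elim
    case (elim q)
    then obtain s I where q: "q = qcis s I" and I: "I \<in> imag_units" by (auto simp: bdry_def)
    define t where "t = arccos (qRe q)"
    have qr: "qRe q = cos s" using I by (simp add: q qcis_def imag_units_eq)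
    have "cos t = cos s" unfolding t_def qr by (simp add: cos_arccos)
    moreover from this have "(sin t)\<^sup>2 = (sin s)\<^sup>2" by (simp add: sin_squared_eq)
    then have "sin t = sin s \<or> sin t = - sin s" by (simp add: power2_eq_iff)
    ultimately have "q = qcis t I \<or> q = qcis t (- I)" by (auto simp: q qcis_def)
    moreover have "Q t" using elim N(2) by (auto simp: t_def)
    ultimately show ?case using I uminus_imag_units[OF I] by (auto simp: Q_def)
  qed
qed

text \<open>The density is positive on the open parameter rectangle, so a continuous function that
  vanishes almost everywhere vanishes there and, by continuity, on the closed rectangle. The poles
  come from its boundary. Four axis points suffice for the affine functions considered
  later.\<close>

lemma AE_area_support:
  fixes \<phi> :: "quat \<Rightarrow> 'b :: real_normed_vector"
  assumes \<phi>: "continuous_on UNIV \<phi>" and ae: "AE I in area_imag_units. \<phi> I = 0"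
  shows "\<phi> (Quat 0 1 0 0) = 0" "\<phi> (Quat 0 0 1 0) = 0" "\<phi> (Quat 0 0 0 1) = 0"
    "\<phi> (Quat 0 0 0 (-1)) = 0"
proof -
  define w where "w = (\<lambda>(\<theta>, \<phi>). ennreal (indicator ({0..pi} \<times> {0..2*pi}) (\<theta>,
    \<phi>) * sin \<theta> / (4 * pi)) :: ennreal)"
  have sph: "spherical = (\<lambda>x. (sin (fst x) * cos (snd x)) *\<^sub>R Quat 0 1 0 0
      + (sin (fst x) * sin (snd x)) *\<^sub>R Quat 0 0 1 0 + cos (fst x) *\<^sub>R Quat 0 0 0 1)"
    by (auto simp: spherical_def quat_eq_iff)
  have cs: "continuous_on UNIV (\<lambda>x. \<phi> (spherical x))"
    unfolding sph by (intro continuous_on_compose2[OF \<phi>] continuous_intros) auto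
  have wm: "w \<in> borel_measurable lborel"
  proof -
    have "w \<in> borel_measurable (lborel \<Otimes>\<^sub>M lborel)" unfolding w_def by measurable
    then show ?thesis by (simp add: lborel_prod)
  qed
  have "AE x in density lborel w. \<phi> (spherical x) = 0"
    using ae unfolding area_imag_units_def w_def[symmetric]
    by (rule AE_distrD[rotated]) (use spherical_measurable in simp)
  then have ae': "AE x in lborel. 0 < w x \<longrightarrow> \<phi> (spherical x) = 0"
    by (simp add: AE_density[OF wm])
  define O' where "O' = {0<..<pi} \<times> {0<..<2*pi}"
  have "\<phi> (spherical x) = 0" if x: "x \<in> O'" for x
  proof (rule ccontr)
    assume nz: "\<phi> (spherical x) \<noteq> 0"
    define V where "V = O' \<inter> {x. \<phi> (spherical x) \<noteq> 0}"
    have "open V" unfolding V_def O'_def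
      by (intro open_Int open_Times open_Collect_neq cs continuous_on_const) auto
    moreover have "x \<in> V" using x nz by (simp add: V_def)
    moreover have "AE y in lborel. y \<notin> V"
      using ae'
    proof eventually_elim
      case (elim y)
      have "0 < w y" if "y \<in> O'"
        using that by (auto simp: w_def O'_def sin_gt_zero)
      then show ?case using elim by (auto simp: V_def)
    qed
    ultimately obtain e where e: "0 < e" "ball x e \<subseteq> V" and V: "AE y in lborel. y \<notin> V"
      using open_contains_ball by blast
    from V have "AE y in lborel. y \<notin> ball x e" by eventually_elim (use e(2) in blast)
    then have "ball x e \<in> null_sets lborel" by (subst AE_iff_null_sets) simp_all
    then have "measure lborel (ball x e) = 0" by (simp add: measure_eq_0_null_sets)
    with content_ball_pos[OF e(1), of x] show False by simp
  qed
  then have "O' \<subseteq> {x. \<phi> (spherical x) = 0}" by blast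
  moreover have "closed {x. \<phi> (spherical x) = 0}"
    by (intro closed_Collect_eq cs continuous_on_const)
  ultimately have "closure O' \<subseteq> {x. \<phi> (spherical x) = 0}" by (rule closure_minimal)
  moreover have "closure O' = {0..pi} \<times> {0..2*pi}"
    unfolding O'_def closure_Times by simp
  ultimately have sub: "{0..pi} \<times> {0..2*pi} \<subseteq> {x. \<phi> (spherical x) = 0}" by simp
  have *: "\<phi> (spherical (\<theta>, \<psi>)) = 0" if "0 \<le> \<theta>" "\<theta> \<le> pi" "0 \<le> \<psi>" "\<psi> \<le> 2 * pi" for \<theta> \<psi>
  proof -
    have "(\<theta>, \<psi>) \<in> {0..pi} \<times> {0..2*pi}" using that by simp
    then show ?thesis using sub by blast
  qed
  show "\<phi> (Quat 0 1 0 0) = 0" using *[of "pi/2" 0] by (simp add: spherical_def)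
  show "\<phi> (Quat 0 0 1 0) = 0" using *[of "pi/2" "pi/2"] by (simp add: spherical_def)
  show "\<phi> (Quat 0 0 0 1) = 0" using *[of 0 0] by (simp add: spherical_def)
  show "\<phi> (Quat 0 0 0 (-1)) = 0" using *[of pi 0] by (simp add: spherical_def)
qed

lemma AE_area_affine_0:
  assumes "AE I in area_imag_units. A + I * C = 0"
  shows "A = 0 \<and> C = (0 :: quat)"
proof -
  have "continuous_on UNIV (\<lambda>I. A + I * C)" by (intro continuous_intros)
  note AE_area_support(3,4)[OF this assms]
  then show ?thesis by (simp add: quat_eq_iff)
qed

lemma AE_area_real_affine_0:
  assumes "AE I in area_imag_units. r + qRe (I * C) = 0"
  shows "r = 0 \<and> qI C = 0 \<and> qJ C = 0 \<and> qK C = 0"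
proof -
  have "bounded_linear qRe"
    by (auto intro!: bounded_linear_intro[of _ 1] simp: norm_quat_def real_le_rsqrt)
  then have "continuous_on UNIV qRe" by (rule linear_continuous_on)
  moreover have "continuous_on UNIV (\<lambda>I. I * C)" by (intro continuous_intros)
  ultimately have "continuous_on UNIV (\<lambda>I. qRe (I * C))"
    using continuous_on_compose2[of UNIV qRe UNIV "\<lambda>I. I * C"] by blast
  then have "continuous_on UNIV (\<lambda>I. r + qRe (I * C))"
    by (rule continuous_on_add[OF continuous_on_const])
  note AE_area_support[OF this assms]
  then show ?thesis by simp
qed

section \<open>Coefficients of slice functions\<close>

definition slice_meas :: "(quat \<Rightarrow> quat) \<Rightarrow> bool" where
  "slice_meas f \<longleftrightarrow> slice_fun f \<and> f \<in> borel_measurable bdry_measure"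

lemma inner_imag_mult:
  assumes "I \<in> imag_units" shows "norm (I * c) = norm c"
  using assms by (simp add: norm_mult imag_units_eq)

text \<open>For fixed \<open>I\<close> the angles \<open>t\<close> and \<open>2 * pi - t\<close>
  contribute \<open>b + I * c\<close> and \<open>b - I * c\<close>, whose squared norms add up to
  twice that of the pair. The integral over the angle thus does not depend on
  \<open>I\<close>.\<close>

lemma nn_integral_slice_meas:
  assumes f: "slice_meas f"
  shows "(\<integral>\<^sup>+ q. ennreal ((norm (f q))\<^sup>2) \<partial>bdry_measure)
    = (\<integral>\<^sup>+ t. ennreal ((norm (slice_pair f t))\<^sup>2) \<partial>circ)"
proof -
  have l2_slice: "on_sphere f t (slice_pair f t)" for t using f slice_fun_on_sphere
    by (auto simp: slice_meas_def)
  have ps: "psym (slice_pair f)" using f psym_slice_pair by (auto simp: slice_meas_def)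
  note [measurable] = psym_measurable[OF ps] borel_measurable_fst_snd[OF psym_measurable[OF ps]]
  have fm: "f \<in> borel_measurable (restrict_space borel bdry)"
    using f by (simp add: slice_meas_def measurable_cong_sets[OF sets_bdry_measure refl])
  define F where "F = (\<lambda>x. ennreal ((norm (f (case x of (t, I) \<Rightarrow> qcis t I)))\<^sup>2))"
  have Fm: "F \<in> borel_measurable (circ \<Otimes>\<^sub>M area_imag_units)"
    unfolding F_def using measurable_compose[OF qcis_pair_measurable fm] by measurable
  have "(\<integral>\<^sup>+ q. ennreal ((norm (f q))\<^sup>2) \<partial>bdry_measure) = (\<integral>\<^sup>+ x. F x \<partial>(circ \<Otimes>\<^sub>M area_imag_units))"
    unfolding bdry_measure_eq F_def by (rule nn_integral_distr[OF qcis_pair_measurable]) (use fm in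
      measurable)
  also have "\<dots> = (\<integral>\<^sup>+ I. \<integral>\<^sup>+ t. F (t, I) \<partial>circ \<partial>area_imag_units)"
    by (rule ca.nn_integral_snd[symmetric]) (use Fm in simp)
  also have "\<dots> = (\<integral>\<^sup>+ I. (\<integral>\<^sup>+ t. ennreal ((norm (slice_pair f t))\<^sup>2) \<partial>circ) \<partial>area_imag_units)"
  proof (rule nn_integral_cong)
    fix I assume "I \<in> space area_imag_units"
    then have I: "I \<in> imag_units" by (simp add: space_area)
    define u where "u = (\<lambda>t. ennreal ((norm (fst (slice_pair f t) + I * snd (slice_pair f t)))\<^sup>2))"
    have [measurable]: "u \<in> borel_measurable borel" unfolding u_def by measurable
    have "(\<integral>\<^sup>+ t. u (2 * pi - t) \<partial>circ) = (\<integral>\<^sup>+ t. u t \<partial>circ)"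
      by (rule nn_integral_circ_reflect) measurable
    moreover have "(\<integral>\<^sup>+ t. u t + u (2 * pi - t) \<partial>circ)
      = (\<integral>\<^sup>+ t. u t \<partial>circ) + (\<integral>\<^sup>+ t. u (2 * pi - t) \<partial>circ)"
      by (rule nn_integral_add) measurable
    ultimately have "2 * (\<integral>\<^sup>+ t. u t \<partial>circ) = (\<integral>\<^sup>+ t. u t + u (2 * pi - t) \<partial>circ)"
      by (simp only: mult_2)
    also have "\<dots> = (\<integral>\<^sup>+ t. 2 * ennreal ((norm (slice_pair f t))\<^sup>2) \<partial>circ)"
    proof (rule nn_integral_cong)
      fix t
      have r: "slice_pair f (2 * pi - t) = pflip (slice_pair f t)" using ps by (simp add: psym_def)
      have "(norm (a + b))\<^sup>2 + (norm (a + - b))\<^sup>2 = 2 * ((norm a)\<^sup>2 + (norm b)\<^sup>2)" for a b :: quat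
        by (simp add: power2_norm_eq_inner inner_simps inner_commute)
      then have "(norm (fst (slice_pair f t) + I * snd (slice_pair f t)))\<^sup>2
        + (norm (fst (slice_pair f t) + I * - snd (slice_pair f t)))\<^sup>2
          = 2 * (norm (slice_pair f t))\<^sup>2"
        using inner_imag_mult[OF I] by (simp add: norm_prod_def)
      then show "u t + u (2 * pi - t) = 2 * ennreal ((norm (slice_pair f t))\<^sup>2)"
        unfolding u_def r pflip_def fst_conv snd_conv
        by (simp flip: ennreal_plus) (simp add: ennreal_mult)
    qed
    also have "\<dots> = 2 * (\<integral>\<^sup>+ t. ennreal ((norm (slice_pair f t))\<^sup>2) \<partial>circ)"
      by (rule nn_integral_cmult) measurable
    finally have "(\<integral>\<^sup>+ t. u t \<partial>circ) = (\<integral>\<^sup>+ t. ennreal ((norm (slice_pair f t))\<^sup>2) \<partial>circ)"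
      by (subst (asm) ennreal_mult_cancel_left) auto
    moreover have "F (t, I) = u t" for t using l2_slice[of t] I
      by (simp add: F_def u_def on_sphere_def)
    ultimately show "(\<integral>\<^sup>+ t. F (t, I) \<partial>circ) = (\<integral>\<^sup>+ t. ennreal ((norm (slice_pair f t))\<^sup>2) \<partial>circ)"
      by simp
  qed
  also have "\<dots> = (\<integral>\<^sup>+ t. ennreal ((norm (slice_pair f t))\<^sup>2) \<partial>circ)"
    by (simp add: area.emeasure_space_1)
  finally show ?thesis .
qed

lemma L2s_iff: "f \<in> L2s \<longleftrightarrow> slice_meas f \<and> sqf (slice_pair f)"
proof (cases "slice_meas f")
  case True
  then have ps: "psym (slice_pair f)" using psym_slice_pair by (auto simp: slice_meas_def)
  show ?thesis
  proof
    assume "f \<in> L2s"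
    then have "(\<integral>\<^sup>+ t. ennreal ((norm (slice_pair f t))\<^sup>2) \<partial>circ) < \<infinity>"
      using nn_integral_slice_meas[OF True] by (simp add: L2s_def)
    then obtain c where "0 \<le> c" "(\<integral>\<^sup>+ t. ennreal ((norm (slice_pair f t))\<^sup>2) \<partial>circ) = ennreal c"
      by (cases "\<integral>\<^sup>+ t. ennreal ((norm (slice_pair f t))\<^sup>2) \<partial>circ") auto
    then show "slice_meas f \<and> sqf (slice_pair f)" using sqf_nn_integralI(1)[OF ps] True by auto
  next
    assume "slice_meas f \<and> sqf (slice_pair f)"
    then show "f \<in> L2s"
      using nn_integral_slice_meas[OF True]
        by (simp add: L2s_def slice_meas_def nn_integral_norm_sqf)
  qed
qed (auto simp: L2s_def slice_meas_def)

lemma on_sphere_slice_pair: "slice_meas f \<Longrightarrow> on_sphere f t (slice_pair f t)"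
  by (simp add: slice_meas_def slice_fun_on_sphere)

lemma on_sphere_add: "on_sphere f t x \<Longrightarrow> on_sphere g t y \<Longrightarrow> on_sphere (\<lambda>q. f q + g q) t (x + y)"
  and on_sphere_diff: "on_sphere f t x \<Longrightarrow> on_sphere g t y \<Longrightarrow> on_sphere (\<lambda>q. f q - g q) t (x - y)"
  by (simp_all add: on_sphere_def algebra_simps)

lemma on_sphere_sum: "(\<And>n. n \<in> N \<Longrightarrow> on_sphere (f n) t (x n))
  \<Longrightarrow> on_sphere (\<lambda>q. \<Sum>n\<in>N. f n q) t (\<Sum>n\<in>N. x n)"
proof (induction N rule: infinite_finite_induct)
  case (insert n N)
  then show ?case using on_sphere_add[of "f n" t "x n" "\<lambda>q. \<Sum>n\<in>N. f n q" "\<Sum>n\<in>N. x n"] by simp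
qed (simp_all add: on_sphere_def)

lemma qcis_power: "I \<in> imag_units \<Longrightarrow> qcis t I ^ n = qcis (real n * t) I"
proof (induction n)
  case (Suc n)
  have "qcis s I * qcis t I = qcis (s + t) I" for s t
    using imag_units_square[OF Suc.prems]
    by (simp add: qcis_def cos_add sin_add algebra_simps of_real_def)
  then show ?case using Suc by (simp add: distrib_right)
qed (simp add: qcis_def)

lemma qcis_powi: "I \<in> imag_units \<Longrightarrow> qcis t I powi n = qcis (of_int n * t) I"
proof (cases "0 \<le> n")
  case False
  assume I: "I \<in> imag_units"
  define m where "m = nat (- n)"
  have n: "n = - int m" using False by (simp add: m_def)
  have "qcis t I powi n = inverse (qcis (real m * t) I)"
    by (simp add: n power_int_minus qcis_power I)
  also have "\<dots> = qcis (- (real m * t)) I"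
  proof (rule inverse_unique)
    have "qcis s I * qcis (- s) I = 1" for s
      using imag_units_square[OF I]
      by (simp add: qcis_def algebra_simps of_real_def)
        (simp flip: power2_eq_square scaleR_add_left)
    then show "qcis (real m * t) I * qcis (- (real m * t)) I = 1" .
  qed
  finally show ?thesis by (simp add: n)
qed (simp add: power_int_def qcis_power)

lemma on_sphere_powi: "on_sphere (\<lambda>q. q powi n * a) t (pexp n a t)"
  by (simp add: on_sphere_def qcis_powi) (simp add: qcis_def pexp_def algebra_simps of_real_def)

lemma borel_measurable_bdry_cong:
  "f \<in> borel_measurable bdry_measure \<longleftrightarrow> f \<in> borel_measurable (restrict_space borel bdry)"
  by (rule measurable_cong_sets[OF sets_bdry_measure refl, THEN arg_cong[of _ _ "\<lambda>A. f \<in> A"]])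

lemma continuous_on_powi:
  assumes "0 \<notin> S" shows "continuous_on S (\<lambda>q :: quat. q powi n)"
proof (cases "0 \<le> n")
  case True
  then show ?thesis by (simp add: power_int_def continuous_on_power)
next
  case False
  then have "(\<lambda>q :: quat. q powi n) = (\<lambda>q. inverse (q ^ nat (- n)))"
    by (auto simp: power_int_def power_inverse)
  then show ?thesis using assms by (auto intro!: continuous_intros)
qed

lemma slice_meas_powi: "slice_meas (\<lambda>q. q powi n * a)"
proof -
  have "continuous_on bdry (\<lambda>q. q powi n * a)"
    by (intro continuous_intros continuous_on_powi) (simp add: bdry_eq_sphere)
  then show ?thesis
    unfolding slice_meas_def borel_measurable_bdry_cong
    by (auto intro: slice_funI on_sphere_powi borel_measurable_continuous_on_restrict)
qed

lemma slmI: "(\<And>t. \<exists>p. on_sphere f t p) \<Longrightarrow> f \<in> borel_measurable bdry_measure \<Longrightarrow> slice_meas f"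
  by (simp add: slice_meas_def slice_funI)

lemma slice_meas_measurable: "slice_meas f \<Longrightarrow> f \<in> borel_measurable bdry_measure"
  by (simp add: slice_meas_def)

lemma slice_meas_sum: "(\<And>n. n \<in> N \<Longrightarrow> slice_meas (f n)) \<Longrightarrow> slice_meas (\<lambda>q. \<Sum>n\<in>N. f n q)"
proof (rule slmI)
  assume f: "\<And>n. n \<in> N \<Longrightarrow> slice_meas (f n)"
  show "\<exists>p. on_sphere (\<lambda>q. \<Sum>n\<in>N. f n q) t p" for t
    by (rule exI, rule on_sphere_sum, rule on_sphere_slice_pair[OF f])
  show "(\<lambda>q. \<Sum>n\<in>N. f n q) \<in> borel_measurable bdry_measure"
    by (rule borel_measurable_sum, rule slice_meas_measurable[OF f])
qed

lemma slice_meas_diff: "slice_meas f \<Longrightarrow> slice_meas g \<Longrightarrow> slice_meas (\<lambda>q. f q - g q)"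
  by (rule slmI, rule exI, rule on_sphere_diff, erule on_sphere_slice_pair,
    erule on_sphere_slice_pair)
    (rule borel_measurable_diff, simp_all add: slice_meas_measurable)

lemma slice_pair_eq: "slice_meas f \<Longrightarrow> on_sphere f t x \<Longrightarrow> slice_pair f t = x"
  using on_sphere_unique by metis

definition l2_coef :: "(quat \<Rightarrow> quat) \<Rightarrow> l2" where
  "l2_coef f = fourier (slice_pair f)"

lemma l2_fun_l2_coef: "f \<in> L2s \<Longrightarrow> AE t in circ. l2_fun (l2_coef f) t = slice_pair f t"
  unfolding l2_coef_def by (rule l2_fun_fourier) (simp add: L2s_iff)

lemma nn_integral_partial_sum:
  assumes f: "f \<in> L2s" and N: "finite N"
  shows "(\<integral>\<^sup>+ q. ennreal ((norm (f q - (\<Sum>n\<in>N. q powi n * cf A n)))\<^sup>2) \<partial>bdry_measure)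
    = ennreal ((norm (l2_coef f - trunc N A))\<^sup>2)"
proof -
  have sf: "slice_meas f" "sqf (slice_pair f)" using f by (auto simp: L2s_iff)
  have l2_slice: "slice_meas (\<lambda>q. f q - (\<Sum>n\<in>N. q powi n * cf A n))"
    by (intro slice_meas_diff slice_meas_sum slice_meas_powi sf)
  have "slice_pair (\<lambda>q. f q - (\<Sum>n\<in>N. q powi n * cf A n)) t = slice_pair f t - ptrig N (cf A) t"
    for t
    unfolding ptrig_def by (intro slice_pair_eq[OF l2_slice] on_sphere_diff on_sphere_slice_pair[OF
      sf(1)] on_sphere_sum on_sphere_powi)
  then have "(\<integral>\<^sup>+ q. ennreal ((norm (f q - (\<Sum>n\<in>N. q powi n * cf A n)))\<^sup>2) \<partial>bdry_measure)
      = ennreal (\<integral>t. (norm (slice_pair f t - ptrig N (cf A) t))\<^sup>2 \<partial>circ)"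
    using nn_integral_slice_meas[OF l2_slice] nn_integral_norm_sqf[OF sqf_diff[OF sf(2) sqf_ptrig]]
      by simp
  also have "\<dots> = ennreal ((norm (l2_coef f - fourier (ptrig N (cf A))))\<^sup>2)"
    by (simp add: Parseval sqf_diff sf sqf_ptrig fourier_diff l2_coef_def)
  also have "fourier (ptrig N (cf A)) = trunc N A"
    by (rule l2_eqI) (simp add: cf_fourier sqf_ptrig fcoef_ptrig N)
  finally show ?thesis .
qed

text \<open>The error of a partial sum is the distance from \<open>l2_coef f\<close> to a truncation
  of the given sequence, and truncations converge to that sequence.\<close>

lemma has_expansion_iff:
  assumes f: "f \<in> L2s"
  shows "has_expansion f a \<longleftrightarrow> a = cf (l2_coef f)"
proof
  assume h: "has_expansion f a"
  then have "(\<lambda>n. (norm (a n))\<^sup>2) summable_on UNIV" by (simp add: has_expansion_def)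
  then obtain A where A: "a = cf A" by (metis Abs_l2_inverse mem_Collect_eq)
  have "((\<lambda>N. ennreal ((norm (l2_coef f - trunc N A))\<^sup>2)) \<longlongrightarrow> 0) (finite_subsets_at_top UNIV)"
  proof (rule Lim_transform_eventually)
    show "((\<lambda>N. \<integral>\<^sup>+ q. ennreal ((norm (f q - (\<Sum>n\<in>N. q powi n * a n)))\<^sup>2) \<partial>bdry_measure) \<longlongrightarrow> 0)
        (finite_subsets_at_top UNIV)" using h by (simp add: has_expansion_def)
    show "\<forall>\<^sub>F N in finite_subsets_at_top UNIV.
        (\<integral>\<^sup>+ q. ennreal ((norm (f q - (\<Sum>n\<in>N. q powi n * a n)))\<^sup>2) \<partial>bdry_measure)
        = ennreal ((norm (l2_coef f - trunc N A))\<^sup>2)"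
      unfolding A by (rule eventually_finite_subsets_at_top_weakI) (rule nn_integral_partial_sum[OF
        f])
  qed
  moreover have "((\<lambda>N. ennreal ((norm (l2_coef f - trunc N A))\<^sup>2)) \<longlongrightarrow> ennreal ((norm (l2_coef f
    - A))\<^sup>2)) (finite_subsets_at_top UNIV)"
    by (intro tendsto_intros tendsto_trunc)
  ultimately have "ennreal ((norm (l2_coef f - A))\<^sup>2) = 0"
    using tendsto_unique[OF finite_subsets_at_top_neq_bot] by metis
  then show "a = cf (l2_coef f)" by (simp add: A)
next
  assume a: "a = cf (l2_coef f)"
  have "((\<lambda>N. ennreal ((norm (l2_coef f - trunc N (l2_coef f)))\<^sup>2)) \<longlongrightarrow> ennreal ((norm (l2_coef f
    - l2_coef f))\<^sup>2)) (finite_subsets_at_top UNIV)"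
    by (intro tendsto_intros tendsto_trunc)
  then have "((\<lambda>N. ennreal ((norm (l2_coef f
    - trunc N (l2_coef f)))\<^sup>2)) \<longlongrightarrow> 0) (finite_subsets_at_top UNIV)" by simp
  then have "((\<lambda>N. \<integral>\<^sup>+ q. ennreal ((norm (f q - (\<Sum>n\<in>N. q powi n * a n)))\<^sup>2) \<partial>bdry_measure) \<longlongrightarrow> 0)
      (finite_subsets_at_top UNIV)"
  proof (rule Lim_transform_eventually)
    show "\<forall>\<^sub>F N in finite_subsets_at_top UNIV. ennreal ((norm (l2_coef f - trunc N (l2_coef f)))\<^sup>2)
        = (\<integral>\<^sup>+ q. ennreal ((norm (f q - (\<Sum>n\<in>N. q powi n * a n)))\<^sup>2) \<partial>bdry_measure)"
      unfolding a by (rule eventually_finite_subsets_at_top_weakI) (rule nn_integral_partial_sum[OF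
        f, symmetric])
  qed
  then show "has_expansion f a" by (simp add: has_expansion_def a summable_cf)
qed

lemma coef_eq: "f \<in> L2s \<Longrightarrow> coef f = cf (l2_coef f)"
  unfolding coef_def by (rule the_equality) (simp_all add: has_expansion_iff)

lemma H2_iff: "f \<in> H2 \<longleftrightarrow> f \<in> L2s \<and> pos (l2_coef f)"
  by (auto simp: H2_def pos_def coef_eq)

section \<open>A slice function with given coefficients\<close>

definition qIm :: "quat \<Rightarrow> quat" where
  "qIm q = q - of_real (qRe q)"

text \<open>The angle is taken in \<open>{0..pi}\<close> and the unit from the imaginary part. At
  real points \<open>sgn 0 = 0\<close> drops the second term, so the slice identity has no
  exceptions on the boundary.\<close>

definition l2_slice :: "l2 \<Rightarrow> quat \<Rightarrow> quat" where
  "l2_slice a q = fst (l2_fun a (arccos (qRe q))) + sgn (qIm q) * snd (l2_fun a (arccos (qRe q)))"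

lemma l2_slice_qcis:
  assumes I: "I \<in> imag_units"
  shows "l2_slice a (qcis t I) = fst (l2_fun a (arccos (cos t)))
    + I * (sgn (sin t) *\<^sub>R snd (l2_fun a (arccos (cos t))))"
proof -
  have q: "qRe (qcis t I) = cos t" "qIm (qcis t I) = sin t *\<^sub>R I" "norm I = 1"
    using I by (simp_all add: qcis_def imag_units_eq qIm_def of_real_def)
  have "sgn (qIm (qcis t I)) = sgn (sin t) *\<^sub>R I"
    using q by (simp add: sgn_scaleR) (simp add: sgn_div_norm)
  then show ?thesis unfolding l2_slice_def q(1) by simp
qed

lemma slice_meas_l2_slice: "slice_meas (l2_slice a)"
  unfolding slice_meas_def
proof
  show "slice_fun (l2_slice a)"
  proof (rule slice_funI, rule exI)
    show "on_sphere (l2_slice a) t (fst (l2_fun a (arccos (cos t))),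
      sgn (sin t) *\<^sub>R snd (l2_fun a (arccos (cos t))))" for t
      by (simp add: on_sphere_def l2_slice_qcis)
  qed
  have 1: "(\<lambda>q. l2_fun a (arccos (qRe q))) \<in> borel_measurable (restrict_space borel bdry)"
    by (rule measurable_compose[OF measurable_arccos_Re measurable_l2_fun])
  have "qIm \<in> borel_measurable borel"
  proof -
    have "linear qIm" by (rule linearI) (simp_all add: qIm_def algebra_simps of_real_def)
    then show ?thesis by (intro borel_measurable_continuous_onI linear_continuous_on
      linear_conv_bounded_linear[THEN iffD1])
  qed
  then have "(\<lambda>q. sgn (qIm q)) \<in> borel_measurable borel" unfolding sgn_div_norm by measurable
  then have 2: "(\<lambda>q. sgn (qIm q)) \<in> borel_measurable (restrict_space borel bdry)"
    by (rule measurable_restrict_space1)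
  show "l2_slice a \<in> borel_measurable bdry_measure"
    unfolding borel_measurable_bdry_cong l2_slice_def[abs_def]
    by (intro borel_measurable_add borel_measurable_times 2 borel_measurable_fst_snd[OF 1])
qed

lemma slice_pair_l2_slice: "AE t in circ. slice_pair (l2_slice a) t = l2_fun a t"
proof -
  have "AE t in circ. t \<in> {0..2*pi}" unfolding AE_circ_iff by simp
  then show ?thesis
    using AE_circ_singleton[of 0] AE_circ_singleton[of pi] AE_circ_singleton[of "2 * pi"]
  proof eventually_elim
    case (elim t)
    have "on_sphere (l2_slice a) t (l2_fun a t)"
    proof (cases "t < pi")
      case True
      then have "arccos (cos t) = t" "0 < sin t" using elim by (auto intro: arccos_cos sin_gt_zero)
      then show ?thesis by (simp add: on_sphere_def l2_slice_qcis)
    next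
      case False
      then have "arccos (cos (2 * pi - t)) = 2 * pi - t" using elim by (intro arccos_cos) auto
      moreover have "cos (2 * pi - t) = cos t" by (simp add: cos_diff)
      moreover have "0 < sin (2 * pi - t)" using False elim by (intro sin_gt_zero) auto
      moreover have "sin (2 * pi - t) = - sin t" by (simp add: sin_diff)
      moreover have "l2_fun a (2 * pi - t) = pflip (l2_fun a t)" using sqf_psym[OF sqf_l2_fun]
        by (simp add: psym_def)
      ultimately show ?thesis by (simp add: on_sphere_def l2_slice_qcis pflip_def)
    qed
    then show ?case by (rule slice_pair_eq[OF slice_meas_l2_slice])
  qed
qed

lemma l2_slice_L2s: "l2_slice a \<in> L2s" and l2_coef_l2_slice [simp]: "l2_coef (l2_slice a) = a"
proof -
  have ps: "psym (slice_pair (l2_slice a))" using slice_meas_l2_slice psym_slice_pair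
    by (auto simp: slice_meas_def)
  have sq: "sqf (slice_pair (l2_slice a))"
    by (rule sqf_bound[where u = "l2_fun a"
      and c = 1, OF ps sqf_l2_fun]) (use slice_pair_l2_slice[of a] in eventually_elim, simp)
  then show "l2_slice a \<in> L2s" by (simp add: L2s_iff slice_meas_l2_slice)
  show "l2_coef (l2_slice a) = a"
    unfolding l2_coef_def
  proof (rule l2_eqI)
    fix n
    have "fcoef (slice_pair (l2_slice a)) n = fcoef (l2_fun a) n"
      by (rule fcoef_cong_AE[OF slice_pair_l2_slice psym_measurable[OF ps] measurable_l2_fun])
    then show "cf (fourier (slice_pair (l2_slice a))) n = cf a n" by (simp add: cf_fourier sq)
  qed
qed

section \<open>The star product and the main theorem\<close>

text \<open>Where \<open>f\<close> has a nonzero value \<open>a\<close>, conjugation by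
  \<open>a\<close> maps \<open>I\<close> to a unit \<open>J\<close> with
  \<open>a * J = I * a\<close>, and the pointwise formula becomes the product of pairs. Where
  \<open>f\<close> vanishes, both sides are 0.\<close>

lemma on_sphere_star:
  assumes f: "on_sphere f t x" and g: "on_sphere g t y"
  shows "on_sphere (f \<circledast> g) t (x \<odot> y)"
  unfolding on_sphere_def
proof
  fix I assume I: "I \<in> imag_units"
  define a where "a = f (qcis t I)"
  have a: "a = fst x + I * snd x" using f I by (simp add: a_def on_sphere_def)
  have "(f \<circledast> g) (qcis t I) = a * fst y + I * (a * snd y)"
  proof (cases "a = 0")
    case True
    then show ?thesis by (simp add: star_def a_def)
  next
    case False
    define J where "J = inverse a * I * a"
    have aJ: "a * J = I * a" using False by (simp add: J_def flip: mult.assoc)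
    have "J * J = inverse a * I * (a * inverse a) * I * a" unfolding J_def
      by (simp only: mult.assoc)
    also have "\<dots> = inverse a * (I * I) * a" using False by (simp add: mult.assoc)
    also have "\<dots> = - 1" using False by (simp add: imag_units_square[OF I])
    finally have J: "J \<in> imag_units" by (simp add: imag_units_def power2_eq_square)
    have "inverse a * qcis t I * a = qcis t J"
      using False by (simp add: qcis_def J_def algebra_simps of_real_def)
    then have "(f \<circledast> g) (qcis t I) = a * (fst y + J * snd y)"
      using False J g by (simp add: star_def a_def on_sphere_def)
    also have "\<dots> = a * fst y + I * (a * snd y)"
      using aJ by (metis distrib_left mult.assoc)
    finally show ?thesis .
  qed
  also have "\<dots> = fst (x \<odot> y) + I * snd (x \<odot> y)"
  proof -
    have "I * (I * z) = - z" for z using imag_units_square[OF I] by (simp flip: mult.assoc)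
    then show ?thesis by (simp add: a pmul_def algebra_simps)
  qed
  finally show "(f \<circledast> g) (qcis t I) = fst (x \<odot> y) + I * snd (x \<odot> y)" .
qed

text \<open>The symmetrization takes the value \<open>r + I * s\<close> with real \<open>r\<close>
  and \<open>s\<close>, inverted as a complex number. A nonzero determinant makes it nonzero for all
  \<open>I\<close> at once, so the default \<open>inverse 0 = 0\<close> is not met.\<close>

lemma on_sphere_star_recip:
  assumes g: "on_sphere g t y" and gc: "on_sphere (star_conj g) t (pcnj y)" and nz: "pdet y \<noteq> 0"
  shows "on_sphere (star_recip g) t (pinv y)"
  unfolding on_sphere_def
proof
  fix I assume I: "I \<in> imag_units"
  have II: "I * I = - 1" "I * (I * z) = - z" for z
    using imag_units_square[OF I] by (simp_all flip: mult.assoc)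
  obtain r s where rs: "pdet y = (of_real r, of_real s)" using pdet_real by blast
  have n: "(norm (pdet y))\<^sup>2 = r\<^sup>2 + s\<^sup>2" by (simp add: rs norm_prod_def)
  then have pos: "r\<^sup>2 + s\<^sup>2 \<noteq> 0" using nz by (metis power_eq_0_iff norm_eq_zero)
  have "symmetrization g (qcis t I) = of_real r + I * of_real s"
    using on_sphere_star[OF g gc] I rs by (simp add: symmetrization_def on_sphere_def pdet_def)
  moreover have "inverse (of_real r + I * of_real s) = (of_real r - I * of_real s) /\<^sub>R (r\<^sup>2 + s\<^sup>2)"
  proof (rule inverse_unique)
    have "(of_real r + I * of_real s) * (of_real r - I * of_real s) = (r\<^sup>2 + s\<^sup>2) *\<^sub>R 1"
      by (simp add: algebra_simps of_real_def II power2_eq_square)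
    then show "(of_real r + I * of_real s) * ((of_real r - I * of_real s) /\<^sub>R (r\<^sup>2 + s\<^sup>2)) = 1"
      using pos by simp
  qed
  ultimately have "star_recip g (qcis t I)
    = ((of_real r - I * of_real s) * (fst (pcnj y) + I * snd (pcnj y))) /\<^sub>R (r\<^sup>2 + s\<^sup>2)"
    using gc I by (simp add: star_recip_def on_sphere_def)
  also have "(of_real r - I * of_real s) * (fst (pcnj y) + I * snd (pcnj y))
      = fst (padj (pdet y) \<odot> pcnj y) + I * snd (padj (pdet y) \<odot> pcnj y)"
  proof -
    have "qcnj (of_real c) = of_real c" for c by (simp add: of_real_def)
    then show ?thesis by (simp add: rs padj_def pmul_def algebra_simps of_real_def II)
  qed
  finally show "star_recip g (qcis t I) = fst (pinv y) + I * snd (pinv y)"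
    by (simp add: pinv_def n scaleR_add_right)
qed

lemma AE_slice_pair_eqD:
  assumes "AE q in bdry_measure. f q = h q" "AE t in circ. on_sphere f t (u t)" "slice_meas h"
  shows "AE t in circ. u t = slice_pair h t"
  using AE_bdry_D[OF assms(1)] assms(2)
proof eventually_elim
  case (elim t)
  have "AE I in area_imag_units. (fst (u t) - fst (slice_pair h t)) + I * (snd (u t)
    - snd (slice_pair h t)) = 0"
    using elim(1) AE_space
  proof eventually_elim
    case (elim I)
    then have "fst (u t) + I * snd (u t) = fst (slice_pair h t) + I * snd (slice_pair h t)"
      using \<open>on_sphere f t (u t)\<close> on_sphere_slice_pair[OF assms(3), of t]
        by (simp add: on_sphere_def space_area)
    then show ?case by (simp add: algebra_simps)
  qed
  from AE_area_affine_0[OF this] show ?case by (simp add: prod_eq_iff)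
qed

lemma AE_eq_bdryI:
  assumes "AE t in circ. on_sphere f t (u t)" "AE t in circ. on_sphere h t (v t)"
    "AE t in circ. u t = v t"
  shows "AE q in bdry_measure. f q = h q"
proof (rule AE_bdry_I)
  show "AE t in circ. \<forall>I\<in>imag_units. f (qcis t I) = h (qcis t I)"
    using assms by eventually_elim (simp add: on_sphere_def)
qed

text \<open>The conjugate is chosen among all functions with given coefficients, so its pair is
  known at almost every angle, but there it is known on the entire sphere.\<close>

lemma slice_pair_star_conj:
  assumes "g \<in> L2s"
  shows "AE t in circ. on_sphere (star_conj g) t (pcnj (slice_pair g t))"
proof -
  have "\<exists>h. h \<in> L2s \<and> has_expansion h (\<lambda>n. qcnj (coef g n))"
    by (rule exI[of _ "l2_slice (lcnj (l2_coef g))"]) (auto simp: l2_slice_L2s has_expansion_iff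
      coef_eq assms)
  then have h: "star_conj g \<in> L2s" "has_expansion (star_conj g) (\<lambda>n. qcnj (coef g n))"
    unfolding star_conj_def by (metis (mono_tags, lifting) someI_ex)+
  then have e: "l2_coef (star_conj g) = lcnj (l2_coef g)"
    by (intro l2_eqI) (auto simp: has_expansion_iff coef_eq assms fun_eq_iff)
  from l2_fun_l2_coef[OF h(1)] l2_fun_lcnj[of "l2_coef g"] l2_fun_l2_coef[OF assms] show ?thesis
  proof eventually_elim
    case (elim t)
    have "on_sphere (star_conj g) t (slice_pair (star_conj g) t)" using h(1)
      by (simp add: L2s_iff on_sphere_slice_pair)
    then show ?case using elim by (simp add: e)
  qed
qed

lemma on_sphere_star_star_recip:
  assumes g: "g \<in> L2s" "pos (l2_coef g)" "l2_coef g \<noteq> 0" and f: "f \<in> L2s"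
  shows "AE t in circ. on_sphere (f \<circledast> star_recip g) t (slice_pair f t \<odot> pinv (slice_pair g t)) \<and>
    pdet (slice_pair g t) \<noteq> 0"
  using slice_pair_star_conj[OF g(1)] pdet_AE_neq_0[OF g(2,3)] l2_fun_l2_coef[OF g(1)]
proof eventually_elim
  case (elim t)
  then have nz: "pdet (slice_pair g t) \<noteq> 0" by metis
  have "on_sphere (star_recip g) t (pinv (slice_pair g t))"
    using on_sphere_star_recip[OF on_sphere_slice_pair _ nz] elim(1) g(1) by (simp add: L2s_iff)
  then show ?case using f nz by (simp add: on_sphere_star on_sphere_slice_pair L2s_iff)
qed

text \<open>At almost every angle \<open>pinv\<close> is a two-sided inverse, so the quotient can be
  traded for multiplication by \<open>g\<close> on the right.\<close>

lemma star_star_recip_AE_iff: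
  assumes g: "g \<in> L2s" "pos (l2_coef g)" "l2_coef g \<noteq> 0" and f: "f \<in> L2s" and h: "h \<in> L2s"
  shows "(AE q in bdry_measure. (f \<circledast> star_recip g) q = h q) \<longleftrightarrow>
    (AE t in circ. l2_fun (l2_coef h) t \<odot> l2_fun (l2_coef g) t = l2_fun (l2_coef f) t)"
proof
  note sp = on_sphere_star_star_recip[OF g f]
  then have sp': "AE t in circ. on_sphere (f \<circledast> star_recip g) t (slice_pair f t \<odot> pinv (slice_pair g
    t))"
    by eventually_elim simp
  {
    assume "AE q in bdry_measure. (f \<circledast> star_recip g) q = h q"
    from AE_slice_pair_eqD[OF this sp'] h have "AE t in circ. slice_pair f t \<odot> pinv (slice_pair g t)
      = slice_pair h t"
      by (simp add: L2s_iff)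
    then show "AE t in circ. l2_fun (l2_coef h) t \<odot> l2_fun (l2_coef g) t = l2_fun (l2_coef f) t"
      using sp l2_fun_l2_coef[OF f] l2_fun_l2_coef[OF g(1)] l2_fun_l2_coef[OF h]
    proof eventually_elim
      case (elim t)
      then have "slice_pair h t \<odot> slice_pair g t
        = slice_pair f t \<odot> (pinv (slice_pair g t) \<odot> slice_pair g t)" by (simp flip: pmul_assoc)
      then show ?case using elim by (simp add: pinv_mult)
    qed
  next
    assume "AE t in circ. l2_fun (l2_coef h) t \<odot> l2_fun (l2_coef g) t = l2_fun (l2_coef f) t"
    then have "AE t in circ. slice_pair f t \<odot> pinv (slice_pair g t) = slice_pair h t"
      using sp l2_fun_l2_coef[OF f] l2_fun_l2_coef[OF g(1)] l2_fun_l2_coef[OF h]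
    proof eventually_elim
      case (elim t)
      then have "slice_pair f t \<odot> pinv (slice_pair g t)
        = slice_pair h t \<odot> (slice_pair g t \<odot> pinv (slice_pair g t))" by (simp flip: pmul_assoc)
      then show ?case using elim by (simp add: pinv_mult)
    qed
    then show "AE q in bdry_measure. (f \<circledast> star_recip g) q = h q"
      by (rule AE_eq_bdryI[OF sp', rotated]) (use h in \<open>simp add: L2s_iff on_sphere_slice_pair\<close>)
  }
qed

section \<open>Equality of moduli on the boundary\<close>

lemma norm_on_sphere:
  assumes "I \<in> imag_units"
  shows "(norm (fst x + I * snd x))\<^sup>2 = qRe (fst (x \<odot> padj x)) + qRe (I * snd (x \<odot> padj x))"
proof -
  have r: "qRe I = 0" "(qI I)\<^sup>2 + (qJ I)\<^sup>2 + (qK I)\<^sup>2 = 1"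
    using assms norm_quat_squared[of I] by (auto simp: imag_units_eq)
  have nI: "(norm (I * snd x))\<^sup>2 = (norm (snd x))\<^sup>2" using inner_imag_mult[OF assms] by simp
  have "(norm (fst x + I * snd x))\<^sup>2 = (norm (fst x))\<^sup>2 + (norm (I * snd x))\<^sup>2
    + 2 * inner (fst x) (I * snd x)"
    by (simp add: power2_norm_eq_inner inner_simps inner_commute)
  also have "\<dots> = qRe (fst (x \<odot> padj x)) + qRe (I * snd (x \<odot> padj x))"
    unfolding nI unfolding norm_quat_squared
    by (simp add: r(1) pmul_def padj_def inner_quat_def power2_eq_square algebra_simps)
  finally show ?thesis .
qed

lemma pmul_padj_self:
  "qI (fst (x \<odot> padj x)) = 0" "qJ (fst (x \<odot> padj x)) = 0" "qK (fst (x \<odot> padj x)) = 0"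
    "qRe (snd (x \<odot> padj x)) = 0"
  by (simp_all add: pmul_def padj_def)

text \<open>The squared modulus on a sphere is an affine function of \<open>I\<close> with
  coefficients from the pair times its adjoint. This product has a real first and an imaginary
  second component, so the affine function determines it.\<close>

lemma AE_norm_eq_iff:
  assumes f: "f \<in> L2s" and g: "g \<in> L2s"
  shows "(AE q in bdry_measure. norm (f q) = norm (g q)) \<longleftrightarrow>
    (AE t in circ. l2_fun (l2_coef f) t \<odot> padj (l2_fun (l2_coef f) t)
      = l2_fun (l2_coef g) t \<odot> padj (l2_fun (l2_coef g) t))"
proof
  have sp: "on_sphere f t (slice_pair f t)" "on_sphere g t (slice_pair g t)" for t using f g
    by (auto simp: L2s_iff on_sphere_slice_pair)
  {
    assume "AE q in bdry_measure. norm (f q) = norm (g q)"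
    from AE_bdry_D[OF this] l2_fun_l2_coef[OF f] l2_fun_l2_coef[OF g]
    show "AE t in circ. l2_fun (l2_coef f) t \<odot> padj (l2_fun (l2_coef f) t)
      = l2_fun (l2_coef g) t \<odot> padj (l2_fun (l2_coef g) t)"
    proof eventually_elim
      case (elim t)
      define x y where "x = slice_pair f t \<odot> padj (slice_pair f t)"
        and "y = slice_pair g t \<odot> padj (slice_pair g t)"
      have "AE I in area_imag_units. (qRe (fst x) - qRe (fst y)) + qRe (I * (snd x - snd y)) = 0"
        using elim(1) AE_space
      proof eventually_elim
        case (elim I)
        then have I: "I \<in> imag_units" by (simp add: space_area)
        have "(norm (f (qcis t I)))\<^sup>2 = (norm (g (qcis t I)))\<^sup>2" using elim by simp
        then have "(norm (fst (slice_pair f t) + I * snd (slice_pair f t)))\<^sup>2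
          = (norm (fst (slice_pair g t) + I * snd (slice_pair g t)))\<^sup>2"
          using sp I by (simp add: on_sphere_def)
        then show ?case
          unfolding norm_on_sphere[OF I] x_def[symmetric] y_def[symmetric]
            by (simp add: algebra_simps)
      qed
      note z = AE_area_real_affine_0[OF this]
      have "x = y"
        using z pmul_padj_self[of "slice_pair f t"] pmul_padj_self[of "slice_pair g t"]
        by (simp add: x_def[symmetric] y_def[symmetric] prod_eq_iff quat_eq_iff)
      then show ?case using elim by (simp add: x_def y_def)
    qed
  next
    assume "AE t in circ. l2_fun (l2_coef f) t \<odot> padj (l2_fun (l2_coef f) t)
      = l2_fun (l2_coef g) t \<odot> padj (l2_fun (l2_coef g) t)"
    then show "AE q in bdry_measure. norm (f q) = norm (g q)"
    proof (intro AE_bdry_I)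
      show "AE t in circ. \<forall>I\<in>imag_units. norm (f (qcis t I)) = norm (g (qcis t I))"
        if "AE t in circ. l2_fun (l2_coef f) t \<odot> padj (l2_fun (l2_coef f) t)
          = l2_fun (l2_coef g) t \<odot> padj (l2_fun (l2_coef g) t)"
        using that l2_fun_l2_coef[OF f] l2_fun_l2_coef[OF g]
      proof eventually_elim
        case (elim t)
        show ?case
        proof
          fix I assume I: "I \<in> imag_units"
          have "(norm (f (qcis t I)))\<^sup>2 = (norm (g (qcis t I)))\<^sup>2"
            using sp[of t] I elim norm_on_sphere[OF I, of "slice_pair f t"] norm_on_sphere[OF I,
              of "slice_pair g t"]
            by (simp add: on_sphere_def)
          then show "norm (f (qcis t I)) = norm (g (qcis t I))" by simp
        qed
      qed
    qed
  }
qed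

lemma ball_ext_eq: "f \<in> L2s \<Longrightarrow> ball_ext f q = ball_eval (cf (l2_coef f)) q"
  by (simp add: ball_ext_def ball_eval_def coef_eq)

lemma outer_iff:
  assumes g: "g \<in> L2s"
  shows "outer g \<longleftrightarrow> dominating (l2_coef g)"
proof
  assume o: "outer g"
  show "dominating (l2_coef g)"
    unfolding dominating_def
  proof (intro allI impI)
    fix a and q :: quat
    assume a: "pos a" "AE t in circ. l2_fun a t \<odot> padj (l2_fun a t)
      = l2_fun (l2_coef g) t \<odot> padj (l2_fun (l2_coef g) t)" "norm q < 1"
    have "AE q in bdry_measure. norm (l2_slice a q) = norm (g q)"
      using a(2) by (simp add: AE_norm_eq_iff[OF l2_slice_L2s g])
    moreover have "l2_slice a \<in> H2" using a(1) by (simp add: H2_iff l2_slice_L2s)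
    ultimately have "norm (ball_ext (l2_slice a) q) \<le> norm (ball_ext g q)"
      using o a(3) by (auto simp: outer_def)
    then show "norm (ball_eval (cf a) q) \<le> norm (ball_eval (cf (l2_coef g)) q)"
      by (simp add: ball_ext_eq l2_slice_L2s g)
  qed
next
  assume d: "dominating (l2_coef g)"
  show "outer g"
    unfolding outer_def
  proof (intro ballI impI)
    fix f q assume f: "f \<in> H2" "AE q in bdry_measure. norm (f q) = norm (g q)"
      and q: "q \<in> ball (0 :: quat) 1"
    then have fL: "f \<in> L2s" "pos (l2_coef f)" by (auto simp: H2_iff)
    show "norm (ball_ext f q) \<le> norm (ball_ext g q)"
      using d fL(2) f(2) q unfolding dominating_def AE_norm_eq_iff[OF fL(1) g] ball_ext_eq[OF fL(1)]
        ball_ext_eq[OF g]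
      by simp
  qed
qed

lemma ae_in_iff_div_closed:
  assumes g: "g \<in> L2s" "pos (l2_coef g)" "l2_coef g \<noteq> 0"
  shows "(\<forall>f\<in>H2. ae_in (f \<circledast> star_recip g) L2s \<longrightarrow> ae_in (f \<circledast> star_recip g) H2)
    \<longleftrightarrow> div_closed (l2_coef g)"
proof
  assume l: "\<forall>f\<in>H2. ae_in (f \<circledast> star_recip g) L2s \<longrightarrow> ae_in (f \<circledast> star_recip g) H2"
  show "div_closed (l2_coef g)"
    unfolding div_closed_def
  proof (intro allI impI)
    fix h k assume h: "pos h" and eq: "AE t in circ. l2_fun k t \<odot> l2_fun (l2_coef g) t = l2_fun h t"
    have "AE q in bdry_measure. (l2_slice h \<circledast> star_recip g) q = l2_slice k q"
      using eq by (simp add: star_star_recip_AE_iff[OF g l2_slice_L2s l2_slice_L2s])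
    then have k: "ae_in (l2_slice h \<circledast> star_recip g) L2s"
      and k': "AE q in bdry_measure. l2_slice k q = (l2_slice h \<circledast> star_recip g) q"
      unfolding ae_in_def using l2_slice_L2s by (auto elim: eventually_mono)
    moreover have "l2_slice h \<in> H2" using h by (simp add: H2_iff l2_slice_L2s)
    ultimately obtain k2 where k2: "k2 \<in> H2"
      "AE q in bdry_measure. (l2_slice h \<circledast> star_recip g) q = k2 q"
      using l by (auto simp: ae_in_def)
    have k2L: "k2 \<in> L2s" "pos (l2_coef k2)" using k2(1) by (auto simp: H2_iff)
    \<comment> \<open>The witness in \<open>H2\<close> may be another function, but equality almost
      everywhere forces equal coefficients.\<close>
    have "AE q in bdry_measure. l2_slice k q = k2 q"
      using k' k2(2) by eventually_elim simp
    then have "AE t in circ. slice_pair (l2_slice k) t = slice_pair k2 t"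
      by (rule AE_slice_pair_eqD) (use l2_slice_L2s[of k] k2L in \<open>auto simp: L2s_iff
        on_sphere_slice_pair\<close>)
    then have "fcoef (slice_pair (l2_slice k)) n = fcoef (slice_pair k2) n" for n
      by (rule fcoef_cong_AE) (use l2_slice_L2s[of k] k2L in \<open>auto simp: L2s_iff sqf_measurable\<close>)
    then have "l2_coef (l2_slice k) = l2_coef k2"
      unfolding l2_coef_def using l2_slice_L2s[of k] k2L
        by (intro l2_eqI) (simp add: cf_fourier L2s_iff)
    then show "pos k" using k2L(2) by simp
  qed
next
  assume d: "div_closed (l2_coef g)"
  show "\<forall>f\<in>H2. ae_in (f \<circledast> star_recip g) L2s \<longrightarrow> ae_in (f \<circledast> star_recip g) H2"
  proof (intro ballI impI)
    fix f assume f: "f \<in> H2" and "ae_in (f \<circledast> star_recip g) L2s"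
    then obtain h where h: "h \<in> L2s" "AE q in bdry_measure. (f \<circledast> star_recip g) q = h q"
      by (auto simp: ae_in_def)
    have fL: "f \<in> L2s" "pos (l2_coef f)" using f by (auto simp: H2_iff)
    have "pos (l2_coef h)"
      using d fL(2) h(2) unfolding div_closed_def star_star_recip_AE_iff[OF g fL(1) h(1)] by blast
    then show "ae_in (f \<circledast> star_recip g) H2" using h by (auto simp: ae_in_def H2_iff)
  qed
qed

section \<open>The closed span of the shifts\<close>

lemma slice_norm_eq:
  assumes "f \<in> L2s" shows "slice_norm f = norm (l2_coef f)"
proof -
  have "qcnj (coef f n) * coef f n = of_real ((norm (cf (l2_coef f) n))\<^sup>2)" for n
    by (simp add: coef_eq assms qcnj_mult_self)
  moreover have "((\<lambda>n. of_real ((norm (cf (l2_coef f) n))\<^sup>2) :: quat) has_sum of_real ((norm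
    (l2_coef f))\<^sup>2)) UNIV"
    using has_sum_bounded_linear[OF bounded_linear_of_real has_sum_norm_l2, of "l2_coef f"]
      by (simp add: o_def)
  ultimately have "slice_inner f f = of_real ((norm (l2_coef f))\<^sup>2)"
    unfolding slice_inner_def by (simp only: infsumI)
  then show ?thesis by (simp add: slice_norm_def del: of_real_power)
qed

lemma star_power: "((\<lambda>q. q ^ n) \<circledast> g) q = q ^ n * g q"
proof (cases "q ^ n = 0")
  case False
  have "inverse (q ^ n) * q * q ^ n = inverse (q ^ n) * q ^ n * q"
    by (simp only: mult.assoc power_commutes)
  also have "\<dots> = q" using False by simp
  finally show ?thesis using False by (simp only: star_def if_False)
qed (simp add: star_def)

text \<open>On a sphere \<open>q ^ n\<close> is a central exponential, so it can be moved to the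
  right of \<open>g\<close> and joined with the coefficient.\<close>

lemma shift_sum_slice_pair:
  fixes M :: nat and \<alpha> :: "nat \<Rightarrow> quat"
  assumes g: "g \<in> L2s"
  defines "h \<equiv> (\<lambda>q. \<Sum>n\<le>M. ((\<lambda>q. q ^ n) \<circledast> g) q * \<alpha> n)"
  shows "h \<in> L2s" "l2_coef h = (\<Sum>n\<le>M. shift_mult (int n) (\<alpha> n) (l2_coef g))"
proof -
  have sg: "slice_meas g" "sqf (slice_pair g)" using g by (auto simp: L2s_iff)
  have sp: "on_sphere (\<lambda>q. ((\<lambda>q. q ^ n) \<circledast> g) q * a) t (slice_pair g t \<odot> pexp (int n) a t)" for n a t
    unfolding star_power on_sphere_def
  proof
    fix I assume I: "I \<in> imag_units"
    have II: "I * I = - 1" "I * (I * z) = - z" for z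
      using imag_units_square[OF I] by (simp_all flip: mult.assoc)
    show "qcis t I ^ n * g (qcis t I) * a
      = fst (slice_pair g t \<odot> pexp (int n) a t) + I * snd (slice_pair g t \<odot> pexp (int n) a t)"
      using on_sphere_slice_pair[OF sg(1), of t] I
      by (simp add: on_sphere_def qcis_power) (simp add: qcis_def pmul_def pexp_def algebra_simps
        of_real_def II)
  qed
  have sps: "on_sphere h t (\<Sum>n\<le>M. slice_pair g t \<odot> pexp (int n) (\<alpha> n) t)" for t
    unfolding h_def by (rule on_sphere_sum) (rule sp)
  have l2_slice: "slice_meas h"
  proof (rule slmI)
    show "\<exists>p. on_sphere h t p" for t using sps by blast
    have "(\<lambda>q. q ^ n) \<in> borel_measurable (restrict_space borel bdry)" for n :: nat
      by (intro borel_measurable_continuous_on_restrict continuous_intros)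
    moreover have "g \<in> borel_measurable (restrict_space borel bdry)"
      using slice_meas_measurable[OF sg(1)] by (simp add: borel_measurable_bdry_cong)
    ultimately show "h \<in> borel_measurable bdry_measure"
      unfolding borel_measurable_bdry_cong h_def star_power
      by (intro borel_measurable_sum borel_measurable_times borel_measurable_const)
  qed
  have slice_pair: "slice_pair h = (\<lambda>t. \<Sum>n\<le>M. slice_pair g t \<odot> pexp (int n) (\<alpha> n) t)"
    by (rule ext) (rule slice_pair_eq[OF l2_slice sps])
  have sq: "sqf (\<lambda>t. \<Sum>n\<in>N. slice_pair g t \<odot> pexp (int n) (\<alpha> n) t)" for N
    by (intro sqf_sum sqf_pmul_pexp sg)
  show "h \<in> L2s" using l2_slice sq by (simp add: L2s_iff slice_pair)
  have fcs: "fourier (\<lambda>t. \<Sum>n\<in>N. slice_pair g t \<odot> pexp (int n) (\<alpha> n) t)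
    = (\<Sum>n\<in>N. shift_mult (int n) (\<alpha> n) (l2_coef g))" if "finite N" for N
    using that
  proof (induction N rule: finite_induct)
    case empty
    have "(\<lambda>t. 0) = pexp 0 0" by (rule ext) simp
    then show ?case by (intro l2_eqI) (simp add: cf_fourier sqf_pexp fcoef_pexp)
  next
    case (insert n N)
    have "fourier (\<lambda>t. slice_pair g t \<odot> pexp (int n) (\<alpha> n) t)
      = shift_mult (int n) (\<alpha> n) (l2_coef g)"
      by (rule l2_eqI)
        (simp add: cf_fourier sqf_pmul_pexp sg fcoef_pmul_pexp_right sqf_integrable l2_coef_def)
    then show ?case using insert fourier_add[OF sqf_pmul_pexp[OF sg(2)] sq] by simp
  qed
  show "l2_coef h = (\<Sum>n\<le>M. shift_mult (int n) (\<alpha> n) (l2_coef g))"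
    unfolding l2_coef_def[of h] slice_pair by (rule fcs) simp
qed

lemma shift_mult_add: "shift_mult n (\<alpha> + \<beta>) a = shift_mult n \<alpha> a + shift_mult n \<beta> a"
  by (rule l2_eqI) (simp add: distrib_left)

lemma shift_mult_zero [simp]: "shift_mult n 0 a = 0"
  by (rule l2_eqI) simp

lemma shift_mult_scaleR: "shift_mult n (r *\<^sub>R \<alpha>) a = r *\<^sub>R shift_mult n \<alpha> a"
  by (rule l2_eqI) simp

text \<open>Generators of equal degree add up in their quaternionic factor; two sums are padded with
  zeros to a common degree.\<close>

lemma span_shift_mult_eq: "span {shift_mult n \<alpha> a | n \<alpha>. int 0 \<le> n}
  = {\<Sum>n\<le>M. shift_mult (int n) (\<alpha> n) a | (M :: nat) \<alpha>. True}"
    (is "span ?B = ?S")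
proof
  have "subspace ?S"
    unfolding subspace_def
  proof (intro conjI ballI allI)
    show "0 \<in> ?S" by (rule CollectI) (rule exI[of _ 0], rule exI[of _ "\<lambda>_. 0"], simp)
  next
    fix x y assume "x \<in> ?S" "y \<in> ?S"
    then obtain M \<alpha> N \<beta> where x: "x = (\<Sum>n\<le>M. shift_mult (int n) (\<alpha> n) a)"
      and y: "y = (\<Sum>n\<le>N. shift_mult (int n) (\<beta> n) a)" by blast
    have ext: "(\<Sum>n\<le>M. shift_mult (int n) (\<gamma> n) a) = (\<Sum>n\<le>K. shift_mult (int n) (if n
      \<le> M then \<gamma> n else 0) a)" if "M \<le> K" for M K \<gamma>
      using that by (intro sum.mono_neutral_cong_left) auto
    have "x + y = (\<Sum>n\<le>max M N. shift_mult (int n) ((if n \<le> M then \<alpha> n else 0) + (if n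
      \<le> N then \<beta> n else 0)) a)"
      unfolding x y ext[of M "max M N", OF max.cobounded1] ext[of N "max M N", OF max.cobounded2]
      by (simp add: shift_mult_add sum.distrib)
    then show "x + y \<in> ?S"
      by (intro CollectI exI[of _ "max M N"]
          exI[of _ "\<lambda>n. (if n \<le> M then \<alpha> n else 0) + (if n \<le> N then \<beta> n else 0)"]) simp
  next
    fix r x assume "x \<in> ?S"
    then obtain M \<alpha> where x: "x = (\<Sum>n\<le>M. shift_mult (int n) (\<alpha> n) a)" by blast
    have "r *\<^sub>R x = (\<Sum>n\<le>M. shift_mult (int n) (r *\<^sub>R \<alpha> n) a)"
      by (simp add: x shift_mult_scaleR scaleR_sum_right)
    then show "r *\<^sub>R x \<in> ?S" by (intro CollectI exI[of _ M] exI[of _ "\<lambda>n. r *\<^sub>R \<alpha> n"]) simp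
  qed
  moreover have "?B \<subseteq> ?S"
  proof
    fix x assume "x \<in> ?B"
    then obtain n \<alpha> where "x = shift_mult n \<alpha> a" "0 \<le> n" by auto
    then have "x = (\<Sum>k\<le>nat n. shift_mult (int k) (if k = nat n then \<alpha> else 0) a)"
      by (simp add: if_distrib[of "\<lambda>\<alpha>. shift_mult _ \<alpha> a"] cong: if_cong)
    then show "x \<in> ?S" by (intro CollectI exI[of _ "nat n"] exI[of _ "\<lambda>k.
      if k = nat n then \<alpha> else 0"]) simp
  qed
  ultimately show "span ?B \<subseteq> ?S" by (intro span_minimal)
  show "?S \<subseteq> span ?B"
  proof
    fix x assume "x \<in> ?S"
    then obtain M \<alpha> where x: "x = (\<Sum>n\<le>M. shift_mult (int n) (\<alpha> n) a)" by blast
    show "x \<in> span ?B" unfolding x by (rule span_sum, rule span_base) auto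
  qed
qed

lemma E_span_iff:
  assumes g: "g \<in> L2s"
  shows "f \<in> E_span g \<longleftrightarrow> f \<in> H2 \<and> l2_coef f \<in> shift_closure 0 (l2_coef g)"
proof (cases "f \<in> H2")
  case True
  then have f: "f \<in> L2s" by (simp add: H2_iff)
  have n: "slice_norm (\<lambda>q. f q - h q) = norm (l2_coef h - l2_coef f)" if "h \<in> L2s" for h
  proof -
    have s: "slice_meas (\<lambda>q. f q - h q)" using f that by (simp add: L2s_iff slice_meas_diff)
    have "slice_pair (\<lambda>q. f q - h q) = (\<lambda>t. slice_pair f t - slice_pair h t)"
      by (rule ext, rule slice_pair_eq[OF s]) (use f that in \<open>simp add: on_sphere_diff
        on_sphere_slice_pair L2s_iff\<close>)
    then have "(\<lambda>q. f q - h q) \<in> L2s" "l2_coef (\<lambda>q. f q - h q) = l2_coef f - l2_coef h"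
      using s f that by (simp_all add: L2s_iff l2_coef_def sqf_diff fourier_diff)
    then show ?thesis by (simp add: slice_norm_eq norm_minus_commute)
  qed
  have "f \<in> E_span g \<longleftrightarrow> (\<forall>e>0. \<exists>h\<in>shift_span g. slice_norm (\<lambda>q. f q - h q) < e)"
    using True by (simp add: E_span_def)
  also have "\<dots> \<longleftrightarrow> (\<forall>e>0. \<exists>M \<alpha>. norm ((\<Sum>n\<le>M. shift_mult (int n) (\<alpha> n) (l2_coef g)) - l2_coef f) < e)"
  proof -
    have gen: "(\<exists>h\<in>{F M \<alpha> | M \<alpha>. True}. P h) \<longleftrightarrow> (\<exists>M \<alpha>. P (F M \<alpha>))"
      for F :: "nat \<Rightarrow> (nat \<Rightarrow> quat) \<Rightarrow> quat \<Rightarrow> quat" and P by blast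
    have "(\<exists>h\<in>shift_span g. slice_norm (\<lambda>q. f q - h q) < e) \<longleftrightarrow>
        (\<exists>M \<alpha>. slice_norm (\<lambda>q. f q - (\<Sum>n\<le>M. ((\<lambda>q. q ^ n) \<circledast> g) q * \<alpha> n)) < e)" for e
      unfolding shift_span_def by (rule gen)
    then show ?thesis by (simp add: n shift_sum_slice_pair[OF g])
  qed
  also have "\<dots> \<longleftrightarrow> l2_coef f \<in> shift_closure 0 (l2_coef g)"
    unfolding shift_closure_def span_shift_mult_eq closure_approachable dist_norm by blast
  finally show ?thesis using True by simp
qed (simp add: E_span_def)

lemma l2_cyclic_shift_closure: "l2_cyclic g \<Longrightarrow> pos a \<Longrightarrow> a \<in> shift_closure 0 g"
proof -
  assume c: "l2_cyclic g" and a: "pos a"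
  have "single k \<beta> \<in> shift_closure 0 g" if "0 \<le> k" for k \<beta>
  proof -
    have "single k \<beta> = shift_mult k \<beta> (single 0 1)" by (rule l2_eqI) simp
    then show ?thesis using c that by (simp add: l2_cyclic_def shift_mult_shift_closure)
  qed
  moreover have "single k (cf a k) = 0" if "k < 0" for k using a that by (simp add: pos_def)
  ultimately have "single k (cf a k) \<in> shift_closure 0 g" for k
    using subspace_0[OF shift_closure_subspace] by (metis linorder_not_less)
  then have "trunc N a \<in> shift_closure 0 g" for N
    unfolding trunc_def by (intro subspace_sum shift_closure_subspace)
  then show "a \<in> shift_closure 0 g"
    by (intro Lim_in_closed_set[OF shift_closure_closed _ _ tendsto_trunc]) simp_all
qed

lemma cyclic_iff:
  assumes g: "g \<in> L2s"
  shows "cyclic g \<longleftrightarrow> l2_cyclic (l2_coef g)"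
proof
  assume "cyclic g"
  moreover have "l2_slice (single 0 1) \<in> H2" by (simp add: H2_iff l2_slice_L2s pos_def)
  ultimately have "l2_slice (single 0 1) \<in> E_span g" by (simp add: cyclic_def)
  then show "l2_cyclic (l2_coef g)" by (simp add: E_span_iff[OF g] l2_cyclic_def)
next
  assume "l2_cyclic (l2_coef g)"
  then show "cyclic g" by (auto simp: cyclic_def E_span_iff[OF g] H2_iff l2_cyclic_shift_closure)
qed

theorem theorem4p2:
  fixes g :: "quat \<Rightarrow> quat"
  assumes "g \<in> H2"
    and "\<not> (AE q in bdry_measure. g q = 0)"
  shows "(cyclic g \<longleftrightarrow>
            (\<forall>f\<in>H2. ae_in (f \<circledast> star_recip g) L2s \<longrightarrow> ae_in (f \<circledast> star_recip g) H2)) \<and>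
         ((\<forall>f\<in>H2. ae_in (f \<circledast> star_recip g) L2s \<longrightarrow> ae_in (f \<circledast> star_recip g) H2) \<longleftrightarrow>
            outer g)"
proof -
  have g: "g \<in> L2s" "pos (l2_coef g)" using assms(1) by (auto simp: H2_iff)
  \<comment> \<open>If \<open>g\<close> vanished almost everywhere, the default values would make
    \<open>star_recip g\<close> zero almost everywhere, and (ii) would hold although
    \<open>g\<close> is not cyclic.\<close>
  have nz: "l2_coef g \<noteq> 0"
  proof
    assume z: "l2_coef g = 0"
    have "AE t in circ. slice_pair g t = 0"
      using l2_fun_l2_coef[OF g(1)] l2_fun_single[of 0 0] by eventually_elim (simp add: z)
    then have "AE t in circ. on_sphere g t 0"
      by eventually_elim (metis g(1) L2s_iff on_sphere_slice_pair)
    then have "AE q in bdry_measure. g q = 0"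
      by (rule AE_eq_bdryI[where v = "\<lambda>_. 0"]) (simp_all add: on_sphere_def)
    with assms(2) show False ..
  qed
  show ?thesis
    unfolding cyclic_iff[OF g(1)] outer_iff[OF g(1)] ae_in_iff_div_closed[OF g nz]
    using l2_cyclic_iff_div_closed[OF g(2) nz] l2_cyclic_imp_dominating[OF g(2) nz]
      dominating_imp_l2_cyclic[OF g(2) nz]
    by blast
qed

end
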